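(* Let $\varphi:\mathbb{R}^d\to\mathbb{R}^d$ be a smooth mapping and let $\psi\in C^\infty(\mathbb{R}^d)$ (complex-valued). Then the following are equivalent. (i) $C_{\psi,\varphi}$ acts on $\mathscr{S}(\mathbb{R}^d)$ and is power bounded. (ii) For all $\alpha,\lambda\in\mathbb{N}_0^d$ with $|\lambda|\le|\alpha|$ and each $p>0$ there exists $q>0$ such that $$\sup_{n\in\mathbb{N}}\sup_{x\in\mathbb{R}^d}\frac{(1+|x|)^p}{(1+|\varphi_n(x)|)^q}\left|F_{\alpha,\lambda}^{\varphi_n,\psi^{n,\varphi}}(x)\right|<\infty.$$
   Context: $\mathscr{S}(\mathbb{R}^d)$ is the Schwartz space of complex-valued rapidly decreasing smooth functions with its standard Fréchet topology, given by the norms $\|f\|_{p,\alpha}=\sup_x(1+|x|)^p|f^{(\alpha)}(x)|$, $p>0$, $\alpha\in\mathbb{N}_0^d$. $\mathbb{N}=\{1,2,\dots\}$. $C_{\psi,\varphi}f=\psi\cdot(f\circ\varphi)$; it acts on $\mathscr{S}(\mathbb{R}^d)$ if $C_{\psi,\varphi}f\in\mathscr{S}(\mathbb{R}^d)$ for all $f\in\mathscr{S}(\mathbb{R}^d)$ (it is then automatically continuous). A continuous linear operator $T$ on a locally convex space is power bounded if $\{T^n:n\in\mathbb{N}\}$ is equicontinuous. Iterates: $\varphi_n=\varphi\circ\cdots\circ\varphi$ ($n$ times), $\varphi_0(x)=x$, and $\psi^{n,\varphi}(x)=\prod_{j=1}^n\psi(\varphi_{j-1}(x))$. Here $|x|$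 is the Euclidean norm for $x\in\mathbb{R}^d$, $|\alpha|=\sum_j\alpha_j$ for a multi-index, $f^{(\alpha)}=\partial^\alpha f$. Order on multi-indices: $\alpha\prec\beta$ iff $|\alpha|<|\beta|$, or $|\alpha|=|\beta|$ and $\alpha_1<\beta_1$, or $|\alpha|=|\beta|$, $\alpha_1=\beta_1,\dots,\alpha_k=\beta_k$ and $\alpha_{k+1}<\beta_{k+1}$ for some $1\le k<d$. As usual $\beta\le\alpha$ means componentwise. For $\beta\in\mathbb{N}_0^d\setminus\{0\}$, $\lambda\in\mathbb{N}_0^d$, let $p(\beta,\lambda)$ be the set of all $(k_1,\dots,k_{|\beta|};\ell_1,\dots,\ell_{|\beta|})\in\mathbb{N}_0^{2|\beta|d}$ (each $k_j,\ell_j\in\mathbb{N}_0^d$) such that for some $1\le s\le|\beta|$: $k_j=\ell_j=0$ for $1\le j\le|\beta|-s$; $|k_j|>0$ for $|\beta|-s+1\le j\le|\beta|$; $0\prec\ell_{|\beta|-s+1}\prec\cdots\prec\ell_{|\beta|}$; $\sum_{j=1}^{|\beta|}k_j=\lambda$ and $\sum_{j=1}^{|\beta|}|k_j|\ell_j=\beta$. Further $p(0,\lambda)=\emptyset$ if $\lambda\ne0$ and $p(0,0)$ is a one-element set. For $\eta\in C^\infty(\mathbb{R}^d)$, a smooth map $\theta=(\theta_1,\dots,\theta_d):\mathbb{R}^d\to\mathbb{R}^d$, and $\alpha,\lambda\in\mathbb{N}_0^d$ with $|\lambda|\le|\alpha|$, $$F_{\alpha,\lambda}^{\theta,\eta}(x)=\sum_{\substack{\beta\in\mathbb{N}_0^d\\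 \beta\le\alpha,\ |\lambda|\le|\beta|}}\binom{\alpha}{\beta}\eta^{(\alpha-\beta)}(x)\sum_{p(\beta,\lambda)}\beta!\prod_{j=1}^{|\beta|}\frac{\left(\theta^{(\ell_j)}(x)\right)^{k_j}}{k_j!\,(\ell_j!)^{|k_j|}},$$ where the inner sum runs over the elements of $p(\beta,\lambda)$, $\left(\theta^{(\ell)}(x)\right)^{k}=\prod_{i=1}^d\left(\theta_i^{(\ell)}(x)\right)^{k_i}$, $0^0=1$, empty sums are $0$ and empty products are $1$ (so the inner sum for $\beta=\lambda=0$ equals $1$). With this, $(\eta\cdot(f\circ\theta))^{(\alpha)}(x)=\sum_{|\lambda|\le|\alpha|}f^{(\lambda)}(\theta(x))F_{\alpha,\lambda}^{\theta,\eta}(x)$ for all smooth $f$ (Leibniz rule and Faà di Bruno formula). *)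

theory Defs
  imports "HOL-Analysis.Analysis"
begin

(* The coordinates 1 < ... < d of R^d are the elements of a finite linearly ordered index
   type 'd.  The linear order is used for the lexicographic part of mi_prec and to fix the order
   of differentiation in mderiv. *)

type_synonym 'd rvec = "real ^ 'd"

type_synonym 'd mindex = "nat ^ 'd"

definition mi_abs :: "'d::finite mindex \<Rightarrow> nat" where
  "mi_abs \<alpha> = (\<Sum>i\<in>UNIV. \<alpha> $ i)"

definition mi_fact :: "'d::finite mindex \<Rightarrow> nat" where
  "mi_fact \<alpha> = (\<Prod>i\<in>UNIV. fact (\<alpha> $ i))"

definition mi_binom :: "'d::finite mindex \<Rightarrow> 'd mindex \<Rightarrow> nat" where
  "mi_binom \<alpha> \<beta> = (\<Prod>i\<in>UNIV. (\<alpha> $ i) choose (\<beta> $ i))"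

definition mi_prec :: "'d::{finite,linorder} mindex \<Rightarrow> 'd mindex \<Rightarrow> bool" where
  "mi_prec \<alpha> \<beta> \<longleftrightarrow>
     mi_abs \<alpha> < mi_abs \<beta> \<or>
     mi_abs \<alpha> = mi_abs \<beta> \<and> (\<exists>i. (\<forall>j<i. \<alpha> $ j = \<beta> $ j) \<and> \<alpha> $ i < \<beta> $ i)"

definition pderiv_at :: "'d \<Rightarrow> ('d rvec \<Rightarrow> 'b::real_normed_vector) \<Rightarrow> 'd::finite rvec \<Rightarrow> 'b" where
  "pderiv_at i f x = vector_derivative (\<lambda>t. f (x + t *\<^sub>R axis i 1)) (at 0)"

definition mderiv ::
    "'d mindex \<Rightarrow> ('d rvec \<Rightarrow> 'b::real_normed_vector) \<Rightarrow> 'd::{finite,linorder} rvec \<Rightarrow> 'b" where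
  "mderiv \<alpha> f = foldr (\<lambda>i. pderiv_at i ^^ (\<alpha> $ i)) (sorted_list_of_set UNIV) f"

primrec Ck :: "nat \<Rightarrow> ('d::finite rvec \<Rightarrow> 'b::real_normed_vector) \<Rightarrow> bool" where
  "Ck 0 f \<longleftrightarrow> continuous_on UNIV f"
| "Ck (Suc k) f \<longleftrightarrow> f differentiable_on UNIV \<and> (\<forall>i. Ck k (pderiv_at i f))"

definition Cinf :: "('d::finite rvec \<Rightarrow> 'b::real_normed_vector) \<Rightarrow> bool" where
  "Cinf f \<longleftrightarrow> (\<forall>k. Ck k f)"

definition schwartz_norm ::
    "real \<Rightarrow> 'd mindex \<Rightarrow> ('d::{finite,linorder} rvec \<Rightarrow> complex) \<Rightarrow> ereal" where
  "schwartz_norm p \<alpha> f = (SUP x. ereal ((1 + norm x) powr p * cmod (mderiv \<alpha> f x)))"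

definition schwartz :: "('d::{finite,linorder} rvec \<Rightarrow> complex) set" where
  "schwartz = {f. Cinf f \<and> (\<forall>p>0. \<forall>\<alpha>. schwartz_norm p \<alpha> f < \<infinity>)}"

definition schwartz_topology :: "('d::{finite,linorder} rvec \<Rightarrow> complex) topology" where
  "schwartz_topology = topology_generated_by
     {{g \<in> schwartz. schwartz_norm p \<alpha> (\<lambda>x. g x - f x) < ereal \<epsilon>} | f p \<alpha> \<epsilon>.
        f \<in> schwartz \<and> p > 0 \<and> \<epsilon> > 0}"

(* The next three definitions concern operators on a vector space of complex functions, which is
   given, together with its (vector space) topology, by the abstract topology X. *)

definition continuous_linear_op ::
    "('x \<Rightarrow> complex) topology \<Rightarrow> (('x \<Rightarrow> complex) \<Rightarrow> ('x \<Rightarrow> complex)) \<Rightarrow> bool" where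
  "continuous_linear_op X T \<longleftrightarrow>
     continuous_map X X T \<and>
     (\<forall>f\<in>topspace X. \<forall>g\<in>topspace X. T (\<lambda>x. f x + g x) = (\<lambda>x. T f x + T g x)) \<and>
     (\<forall>c. \<forall>f\<in>topspace X. T (\<lambda>x. c * f x) = (\<lambda>x. c * T f x))"

definition equicontinuous ::
    "('x \<Rightarrow> complex) topology \<Rightarrow> (('x \<Rightarrow> complex) \<Rightarrow> ('x \<Rightarrow> complex)) set \<Rightarrow> bool" where
  "equicontinuous X H \<longleftrightarrow>
     (\<forall>f\<in>topspace X. \<forall>U. openin X U \<and> (\<lambda>_. 0) \<in> U \<longrightarrow>
        (\<exists>V. openin X V \<and> f \<in> V \<and> (\<forall>T\<in>H. \<forall>g\<in>V. (\<lambda>x. T g x - T f x) \<in> U)))"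

definition power_bounded ::
    "('x \<Rightarrow> complex) topology \<Rightarrow> (('x \<Rightarrow> complex) \<Rightarrow> ('x \<Rightarrow> complex)) \<Rightarrow> bool" where
  "power_bounded X T \<longleftrightarrow>
     continuous_linear_op X T \<and> equicontinuous X {T ^^ n | n. n \<ge> 1}"

definition wcomp ::
    "('x \<Rightarrow> complex) \<Rightarrow> ('x \<Rightarrow> 'x) \<Rightarrow> ('x \<Rightarrow> complex) \<Rightarrow> 'x \<Rightarrow> complex" where
  "wcomp \<psi> \<phi> f = (\<lambda>x. \<psi> x * f (\<phi> x))"

definition acts_on_schwartz ::
    "(('d::{finite,linorder} rvec \<Rightarrow> complex) \<Rightarrow> ('d rvec \<Rightarrow> complex)) \<Rightarrow> bool" where
  "acts_on_schwartz T \<longleftrightarrow> (\<forall>f\<in>schwartz. T f \<in> schwartz)"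

definition iter_weight :: "('x \<Rightarrow> complex) \<Rightarrow> ('x \<Rightarrow> 'x) \<Rightarrow> nat \<Rightarrow> 'x \<Rightarrow> complex" where
  "iter_weight \<psi> \<phi> n x = (\<Prod>j\<in>{1..n}. \<psi> ((\<phi> ^^ (j - 1)) x))"

(* The families (k_j) and (l_j), indexed by 1 \<le> j \<le> |\<beta>|, are functions that are undefined
   outside this range; hence fdb_set 0 0 has exactly one element. *)

definition fdb_set ::
    "'d::{finite,linorder} mindex \<Rightarrow> 'd mindex \<Rightarrow> ((nat \<Rightarrow> 'd mindex) \<times> (nat \<Rightarrow> 'd mindex)) set" where
  "fdb_set \<beta> \<mu> =
     (let m = mi_abs \<beta>; E = extensional {1..m} in
      if \<beta> = 0 then (if \<mu> = 0 then E \<times> E else {})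
      else {(k, l) \<in> E \<times> E. \<exists>s\<in>{1..m}.
              (\<forall>j\<in>{1..m-s}. k j = 0 \<and> l j = 0) \<and>
              (\<forall>j\<in>{m-s+1..m}. mi_abs (k j) > 0) \<and>
              mi_prec 0 (l (m-s+1)) \<and>
              (\<forall>j\<in>{m-s+1..<m}. mi_prec (l j) (l (j+1))) \<and>
              (\<Sum>j\<in>{1..m}. k j) = \<mu> \<and>
              (\<Sum>j\<in>{1..m}. mi_abs (k j) *s l j) = \<beta>})"

definition mderiv_pow ::
    "('d rvec \<Rightarrow> 'd rvec) \<Rightarrow> 'd mindex \<Rightarrow> 'd mindex \<Rightarrow> 'd::{finite,linorder} rvec \<Rightarrow> real" where
  "mderiv_pow \<theta> l k x = (\<Prod>i\<in>UNIV. (mderiv l (\<lambda>y. \<theta> y $ i) x) ^ (k $ i))"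

definition Ffun ::
    "'d mindex \<Rightarrow> 'd mindex \<Rightarrow> ('d rvec \<Rightarrow> 'd rvec) \<Rightarrow> ('d rvec \<Rightarrow> complex) \<Rightarrow>
     'd::{finite,linorder} rvec \<Rightarrow> complex" where
  "Ffun \<alpha> \<mu> \<theta> \<eta> x =
     (\<Sum>\<beta>\<in>{\<beta>. \<beta> \<le> \<alpha> \<and> mi_abs \<mu> \<le> mi_abs \<beta>}.
        of_nat (mi_binom \<alpha> \<beta>) * mderiv (\<alpha> - \<beta>) \<eta> x *
        of_real (\<Sum>(k, l)\<in>fdb_set \<beta> \<mu>.
          real (mi_fact \<beta>) *
          (\<Prod>j\<in>{1..mi_abs \<beta>}.
             mderiv_pow \<theta> (l j) (k j) x /
             (real (mi_fact (k j)) * real (mi_fact (l j)) ^ mi_abs (k j)))))"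

end

theory Submission
  imports Defs "HOL-Computational_Algebra.Polynomial"
begin

text \<open>By the Leibniz rule and the multivariate Faa di Bruno formula,
  \<open>(C\<^sub>\<psi>\<^sub>,\<^sub>\<phi>\<^sup>n f)\<^bsup>(\<alpha>)\<^esup>(x) = \<Sum>\<^bsub>|\<mu>| \<le> |\<alpha>|\<^esub> f\<^bsup>(\<mu>)\<^esup>(\<phi>\<^sub>n(x)) F\<^sub>\<alpha>\<^sub>,\<^sub>\<mu>(x)\<close>. Under (ii) every summand
  is controlled by a single Schwartz norm of \<open>f\<close>, uniformly in \<open>n\<close>. Conversely, translating a
  fixed Schwartz function \<open>g\<close> with \<open>g\<^bsup>(\<nu>)\<^esup>(0) = \<delta>\<^bsub>\<nu>\<mu>\<^esub>\<close> for \<open>|\<nu>| \<le> |\<alpha>|\<close> to \<open>\<phi>\<^sub>n(x)\<close> isolates \<open>F\<^sub>\<alpha>\<^sub>,\<^sub>\<mu>(x)\<close>,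
  and translation by \<open>y\<close> increases the norms of \<open>g\<close> at most by the factor \<open>(1 + |y|)\<^sup>q\<close>.

  For the Faa di Bruno formula itself, a derivative of order \<open>\<alpha>\<close> of \<open>\<eta> \<cdot> (f \<circ> \<theta>)\<close> at \<open>x\<close> vanishes when the
  derivatives of \<open>f\<close> up to order \<open>|\<alpha>|\<close> vanish at \<open>\<theta>(x)\<close>, so \<open>f\<close> may be replaced by its Taylor
  polynomial. For monomials, the derivatives and the combinatorial sums over \<open>p(\<beta>, \<mu>)\<close> satisfy the
  same recursion in \<open>\<mu>\<close>.\<close>

section \<open>Partial derivatives and their symmetry\<close>

text \<open>\<open>mderiv\<close> composes partial derivatives in one fixed order, and
  \<open>Ck\<close> only asks for differentiability and for partial derivatives of the next lower
  class. Every induction on multi-indices peels off an arbitrary coordinate, so the symmetry of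
  mixed partial derivatives has to come first.

  The sum in \<open>Ffun\<close> is awkward to differentiate: its data are padded, increasingly
  ordered lists whose length changes with \<beta>. It is unfolded only to show that
  \<open>Ffun \<alpha> \<mu> \<theta> \<eta> x\<close> is the \<alpha>-derivative at x' = x of
  (\<theta>(x') - \<theta>(x))^\<mu> / \<mu>! times \<eta>(x'). The centre \<theta>(x) stays frozen,
  so these functions are the terms of a Taylor polynomial.

  Power boundedness speaks of open sets, (ii) of numbers. The bridge is
  \<open>schwartz_bounded\<close>: each norm of T f is bounded by finitely many norms of f,
  uniformly in T. The largest weight exponent among these norms becomes the q of (ii). The test
  functions are products of polynomials with Gaussians, so that decay and prescribed derivatives at
  0 both reduce to one variable.\<close>

lemma pderiv_at_eq:
  assumes "(f has_derivative D) (at x)"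
  shows "pderiv_at i f x = D (axis i 1)"
proof -
  have "((\<lambda>t. x + t *\<^sub>R axis i 1) has_derivative (\<lambda>t. t *\<^sub>R axis i (1::real))) (at 0)"
    by (auto intro!: derivative_eq_intros)
  moreover have "(f has_derivative D) (at (x + 0 *\<^sub>R axis i 1))"
    using assms by simp
  ultimately have "((\<lambda>t. f (x + t *\<^sub>R axis i 1)) has_derivative (\<lambda>t. D (t *\<^sub>R axis i 1))) (at 0)"
    using has_derivative_compose by blast
  moreover have "D (t *\<^sub>R axis i 1) = t *\<^sub>R D (axis i 1)" for t
    using assms by (simp add: has_derivative_bounded_linear linear_simps)
  ultimately have "((\<lambda>t. f (x + t *\<^sub>R axis i 1)) has_vector_derivative D (axis i 1)) (at 0)"
    by (simp add: has_vector_derivative_def)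
  then show ?thesis
    unfolding pderiv_at_def by (rule vector_derivative_at)
qed

lemma has_derivative_pderiv:
  assumes "f differentiable_on UNIV"
  shows "(f has_derivative (\<lambda>h. \<Sum>i\<in>UNIV. h $ i *\<^sub>R pderiv_at i f x)) (at x)"
proof -
  obtain D where D: "(f has_derivative D) (at x)"
    using assms by (auto simp: differentiable_on_def differentiable_def)
  then interpret bounded_linear D
    by (rule has_derivative_bounded_linear)
  have "D h = (\<Sum>i\<in>UNIV. h $ i *\<^sub>R pderiv_at i f x)" for h
  proof -
    have "h = (\<Sum>i\<in>UNIV. h $ i *\<^sub>R axis i 1)"
      by (simp add: vec_eq_iff axis_def if_distrib sum.delta' cong: if_cong)
    then have "D h = D (\<Sum>i\<in>UNIV. h $ i *\<^sub>R axis i 1)" by (rule arg_cong)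
    also have "\<dots> = (\<Sum>i\<in>UNIV. h $ i *\<^sub>R D (axis i 1))"
      by (simp add: sum scaleR)
    finally show ?thesis using pderiv_at_eq[OF D] by simp
  qed
  then show ?thesis using D by presburger
qed

lemma sum_axis_scaleR:
  fixes c :: "'d::finite \<Rightarrow> 'b::real_vector"
  shows "(\<Sum>j\<in>UNIV. axis i (1::real) $ j *\<^sub>R c j) = c i"
proof -
  have "axis i (1::real) $ j *\<^sub>R c j = (if j = i then c j else 0)" for j
    by (simp add: axis_def)
  then show ?thesis by simp
qed

lemma differentiable_on_UNIV_I:
  "(\<And>x. \<exists>D. (f has_derivative D) (at x)) \<Longrightarrow> f differentiable_on UNIV"
  by (simp add: differentiable_on_def differentiable_def)

lemma differentiable_on_UNIV_E:
  assumes "f differentiable_on UNIV"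
  obtains D where "(f has_derivative D) (at x)"
  using assms unfolding differentiable_on_def differentiable_def by auto

lemma has_vector_derivative_line:
  assumes "f differentiable_on UNIV"
  shows "((\<lambda>t. f (x + t *\<^sub>R axis i 1)) has_vector_derivative pderiv_at i f (x + t *\<^sub>R axis i 1)) (at t)"
proof -
  have "((\<lambda>t. x + t *\<^sub>R axis i 1) has_derivative (\<lambda>t. t *\<^sub>R axis i (1::real))) (at t)"
    by (auto intro!: derivative_eq_intros)
  from has_derivative_compose[OF this has_derivative_pderiv[OF assms]]
  have "((\<lambda>t. f (x + t *\<^sub>R axis i 1)) has_derivative
      (\<lambda>s. \<Sum>j\<in>UNIV. (s *\<^sub>R axis i 1) $ j *\<^sub>R pderiv_at j f (x + t *\<^sub>R axis i 1))) (at t)" .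
  moreover have "(\<Sum>j\<in>UNIV. (s *\<^sub>R axis i 1) $ j *\<^sub>R pderiv_at j f y) = s *\<^sub>R pderiv_at i f y" for s y
    by (subst (2) sum_axis_scaleR[symmetric]) (simp add: scaleR_sum_right)
  ultimately show ?thesis
    by (simp only: has_vector_derivative_def)
qed

lemma pderiv_at_const [simp]: "pderiv_at i (\<lambda>x. c) = (\<lambda>x. 0)"
  by (rule ext) (simp add: pderiv_at_eq[OF has_derivative_const])

lemma pderiv_at_add:
  assumes "f differentiable_on UNIV" "g differentiable_on UNIV"
  shows "pderiv_at i (\<lambda>x. f x + g x) = (\<lambda>x. pderiv_at i f x + pderiv_at i g x)"
proof
  fix x
  obtain D E where D: "(f has_derivative D) (at x)" "(g has_derivative E) (at x)"
    using assms by (metis differentiable_on_UNIV_E)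
  show "pderiv_at i (\<lambda>x. f x + g x) x = pderiv_at i f x + pderiv_at i g x"
    using pderiv_at_eq[OF has_derivative_add[OF D]] pderiv_at_eq[OF D(1)] pderiv_at_eq[OF D(2)]
    by simp
qed

context bounded_bilinear
begin

text \<open>Stated for any bounded bilinear product: the chain rule produces scalings of vectors by
  real functions, the weights produce complex products, and one product rule covers both.\<close>

lemma pderiv_at:
  assumes "f differentiable_on UNIV" "g differentiable_on UNIV"
  shows "pderiv_at i (\<lambda>x. prod (f x) (g x)) =
           (\<lambda>x. prod (pderiv_at i f x) (g x) + prod (f x) (pderiv_at i g x))"
proof
  fix x
  obtain D E where D: "(f has_derivative D) (at x)" "(g has_derivative E) (at x)"
    using assms by (metis differentiable_on_UNIV_E)
  show "pderiv_at i (\<lambda>x. prod (f x) (g x)) x =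
      prod (pderiv_at i f x) (g x) + prod (f x) (pderiv_at i g x)"
    using pderiv_at_eq[OF FDERIV[OF D]] pderiv_at_eq[OF D(1)] pderiv_at_eq[OF D(2)]
    by (simp add: add.commute)
qed

lemma differentiable_on_UNIV:
  fixes f :: "'d::finite rvec \<Rightarrow> 'a"
  assumes "f differentiable_on UNIV" "g differentiable_on UNIV"
  shows "(\<lambda>x. prod (f x) (g x)) differentiable_on UNIV"
  using FDERIV[OF has_derivative_pderiv[OF assms(1)] has_derivative_pderiv[OF assms(2)]]
  by (intro differentiable_on_UNIV_I exI)

end

lemma pderiv_at_compose:
  fixes f :: "'d::finite rvec \<Rightarrow> 'b::real_normed_vector" and \<theta> :: "'e::finite rvec \<Rightarrow> 'd rvec"
  assumes "f differentiable_on UNIV" "\<theta> differentiable_on UNIV"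
  shows "pderiv_at i (\<lambda>x. f (\<theta> x)) =
           (\<lambda>x. \<Sum>j\<in>UNIV. pderiv_at i (\<lambda>x. \<theta> x $ j) x *\<^sub>R pderiv_at j f (\<theta> x))"
proof
  fix x
  obtain E where E: "(\<theta> has_derivative E) (at x)"
    using assms by (metis differentiable_on_UNIV_E)
  have *: "pderiv_at i (\<lambda>x. \<theta> x $ j) x = E (axis i 1) $ j" for j
    using bounded_linear.has_derivative[OF bounded_linear_vec_nth E] by (rule pderiv_at_eq)
  show "pderiv_at i (\<lambda>x. f (\<theta> x)) x =
      (\<Sum>j\<in>UNIV. pderiv_at i (\<lambda>x. \<theta> x $ j) x *\<^sub>R pderiv_at j f (\<theta> x))"
    using pderiv_at_eq[OF has_derivative_compose[OF E has_derivative_pderiv[OF assms(1)]]]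
    by (simp add: *)
qed

lemma pderiv_at_linear:
  assumes "bounded_linear h"
  shows "pderiv_at i h = (\<lambda>x. h (axis i 1))"
  using pderiv_at_eq[OF bounded_linear_imp_has_derivative[OF assms]] by blast

lemma pderiv_at_linear_compose:
  assumes "bounded_linear h" "f differentiable_on UNIV"
  shows "pderiv_at i (\<lambda>x. h (f x)) = (\<lambda>x. h (pderiv_at i f x))"
proof
  fix x
  obtain D where D: "(f has_derivative D) (at x)"
    using assms by (metis differentiable_on_UNIV_E)
  show "pderiv_at i (\<lambda>x. h (f x)) x = h (pderiv_at i f x)"
    using pderiv_at_eq[OF bounded_linear.has_derivative[OF assms(1) D]] pderiv_at_eq[OF D] by simp
qed

lemma pderiv_at_translate:
  "pderiv_at i (\<lambda>x. f (x + a)) = (\<lambda>x. pderiv_at i f (x + a))"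
  by (simp add: pderiv_at_def fun_eq_iff algebra_simps)

text \<open>For vector values the mean value theorem survives as an inequality.\<close>

lemma differentiable_bound_interval:
  fixes g :: "real \<Rightarrow> 'b::real_normed_vector"
  assumes "0 \<le> t" "\<And>s. 0 \<le> s \<Longrightarrow> s \<le> t \<Longrightarrow> (g has_vector_derivative g' s) (at s)"
    and "\<And>s. 0 \<le> s \<Longrightarrow> s \<le> t \<Longrightarrow> norm (g' s) \<le> B"
  shows "norm (g t - g 0) \<le> B * t"
proof -
  have "norm (g t - g 0) \<le> B * norm (t - 0)"
  proof (rule differentiable_bound)
    show "convex {0..t}" by simp
    fix s assume s: "s \<in> {0..t}"
    then show "(g has_derivative (\<lambda>x. x *\<^sub>R g' s)) (at s within {0..t})"
      using assms(2)[of s] by (simp add: has_vector_derivative_def has_derivative_at_withinI)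
    show "onorm (\<lambda>x. x *\<^sub>R g' s) \<le> B"
      using assms(3)[of s] s by (intro onorm_le) (simp add: mult.commute[of B] mult_left_mono)
  qed (use assms in auto)
  then show ?thesis using assms(1) by simp
qed

text \<open>Both mixed derivatives are the limit of the second difference quotient
  \<open>(f (x + t e\<^sub>i + t e\<^sub>j) - f (x + t e\<^sub>i) - f (x + t e\<^sub>j) + f x) / t\<^sup>2\<close>.\<close>

lemma second_difference_bound:
  fixes f :: "'d::finite rvec \<Rightarrow> 'b::real_normed_vector"
  assumes f: "f differentiable_on UNIV" and df: "pderiv_at i f differentiable_on UNIV" and "e > 0"
  shows "\<exists>\<delta>>0. \<forall>t. 0 < t \<and> t < \<delta> \<longrightarrow>
    norm (f (x + t *\<^sub>R axis j 1 + t *\<^sub>R axis i 1) - f (x + t *\<^sub>R axis i 1) - f (x + t *\<^sub>R axis j 1) + f x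
      - t\<^sup>2 *\<^sub>R pderiv_at j (pderiv_at i f) x) \<le> e * t\<^sup>2"
proof -
  let ?g = "pderiv_at i f"
  define D where "D = (\<lambda>h. \<Sum>k\<in>UNIV. h $ k *\<^sub>R pderiv_at k ?g x)"
  have D: "(?g has_derivative D) (at x)"
    using has_derivative_pderiv[OF df] by (simp add: D_def)
  then interpret D: bounded_linear D by (rule has_derivative_bounded_linear)
  have Dj: "D (axis j 1) = pderiv_at j ?g x"
    by (rule pderiv_at_eq[OF D, symmetric])
  \<comment> \<open>The estimate is applied to increments of length at most 2t and t; with a quarter
    of e the two errors add up to at most 3/4 e t.\<close>
  obtain \<delta> where "\<delta> > 0" and \<delta>: "\<And>y. norm (y - x) < \<delta> \<Longrightarrow>
      norm (?g y - ?g x - D (y - x)) \<le> e / 4 * norm (y - x)"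
    using D[unfolded has_derivative_at_alt, THEN conjunct2, rule_format, of "e / 4"] \<open>e > 0\<close>
    by auto
  have *: "norm (f (x + t *\<^sub>R axis j 1 + t *\<^sub>R axis i 1) - f (x + t *\<^sub>R axis i 1) - f (x + t *\<^sub>R axis j 1) + f x
      - t\<^sup>2 *\<^sub>R pderiv_at j (pderiv_at i f) x) \<le> e * t\<^sup>2" if t: "0 < t" "t < \<delta> / 2" for t
  proof -
    let ?a = "t *\<^sub>R axis j 1 :: 'd rvec"
    \<comment> \<open>\<open>G t - G 0\<close> is the second difference minus its expected value.
      The derivative of \<open>G\<close> compares \<open>pderiv_at i f\<close> at two points that
      differ by t e_j, so the differentiability of \<open>pderiv_at i f\<close> at x makes it
      small.\<close>
    define G where "G s = f (x + ?a + s *\<^sub>R axis i 1) - f (x + s *\<^sub>R axis i 1) - (s * t) *\<^sub>R pderiv_at j ?g x" for s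
    have "norm (G t - G 0) \<le> (e * t) * t"
    proof (rule differentiable_bound_interval)
      fix s assume s: "0 \<le> s" "s \<le> t"
      let ?u = "x + ?a + s *\<^sub>R axis i 1" and ?v = "x + s *\<^sub>R axis i 1"
      show "(G has_vector_derivative (?g ?u - ?g ?v - t *\<^sub>R pderiv_at j ?g x)) (at s)"
        unfolding G_def
        by (auto intro!: derivative_eq_intros has_vector_derivative_line[OF f])
      have nu: "norm (?u - x) \<le> 2 * t"
      proof -
        have "norm (?u - x) \<le> norm ?a + norm (s *\<^sub>R axis i (1::real) :: 'd rvec)"
          by (metis add.assoc add_diff_cancel_left' norm_triangle_ineq)
        then show ?thesis using t s by simp
      qed
      have nv: "norm (?v - x) \<le> t"
        using s by simp
      have 1: "norm (?g ?u - ?g x - D (?u - x)) \<le> e / 4 * norm (?u - x)"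
        by (rule \<delta>) (use nu t in linarith)
      have 2: "norm (?g ?v - ?g x - D (?v - x)) \<le> e / 4 * norm (?v - x)"
        by (rule \<delta>) (use nv t in linarith)
      have "D (?u - x) - D (?v - x) = t *\<^sub>R pderiv_at j ?g x"
        unfolding D.diff[symmetric] using Dj by (simp add: D.scaleR)
      then have "?g ?u - ?g ?v - t *\<^sub>R pderiv_at j ?g x =
          (?g ?u - ?g x - D (?u - x)) - (?g ?v - ?g x - D (?v - x))"
        by (simp add: algebra_simps)
      also have "norm \<dots> \<le> e / 4 * norm (?u - x) + e / 4 * norm (?v - x)"
        using 1 2 norm_triangle_ineq4 by (meson add_mono order_trans)
      also have "\<dots> \<le> e / 4 * (2 * t) + e / 4 * t"
        using nu nv \<open>e > 0\<close> by (intro add_mono mult_left_mono) auto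
      also have "\<dots> \<le> e * t"
        using \<open>e > 0\<close> t by simp
      finally show "norm (?g ?u - ?g ?v - t *\<^sub>R pderiv_at j ?g x) \<le> e * t" .
    qed (use t in auto)
    then show ?thesis
      by (simp add: G_def power2_eq_square algebra_simps)
  qed
  show ?thesis
    using * \<open>\<delta> > 0\<close> by (intro exI[of _ "\<delta> / 2"]) auto
qed

text \<open>The second difference is symmetric in i and j, so both mixed derivatives approximate the
  same quantity. With a quarter of their distance as tolerance, the two errors cover only half of
  that distance.\<close>

lemma pderiv_at_commute:
  fixes f :: "'d::finite rvec \<Rightarrow> 'b::real_normed_vector"
  assumes f: "f differentiable_on UNIV" and df: "\<And>i. pderiv_at i f differentiable_on UNIV"
  shows "pderiv_at i (pderiv_at j f) = pderiv_at j (pderiv_at i f)"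
proof
  fix x
  show "pderiv_at i (pderiv_at j f) x = pderiv_at j (pderiv_at i f) x" (is "?A = ?B")
  proof (rule ccontr)
    assume "?A \<noteq> ?B"
    then have e: "norm (?A - ?B) / 4 > 0" (is "?e > 0") by simp
    let ?\<Delta> = "\<lambda>t. f (x + t *\<^sub>R axis j 1 + t *\<^sub>R axis i 1) - f (x + t *\<^sub>R axis i 1) - f (x + t *\<^sub>R axis j 1) + f x"
    obtain \<delta>1 where 1: "\<delta>1 > 0" "\<And>t. 0 < t \<Longrightarrow> t < \<delta>1 \<Longrightarrow> norm (?\<Delta> t - t\<^sup>2 *\<^sub>R ?B) \<le> ?e * t\<^sup>2"
      using second_difference_bound[OF f df e, where i = i and j = j and x = x] by blast
    obtain \<delta>2 where 2: "\<delta>2 > 0" "\<And>t. 0 < t \<Longrightarrow> t < \<delta>2 \<Longrightarrow> norm (?\<Delta> t - t\<^sup>2 *\<^sub>R ?A) \<le> ?e * t\<^sup>2"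
      using second_difference_bound[OF f df e, where i = j and j = i and x = x] by (auto simp: algebra_simps)
    define t where "t = min \<delta>1 \<delta>2 / 2"
    have t: "0 < t" "t < \<delta>1" "t < \<delta>2" using 1(1) 2(1) by (auto simp: t_def)
    have "t\<^sup>2 * norm (?A - ?B) = norm ((?\<Delta> t - t\<^sup>2 *\<^sub>R ?B) - (?\<Delta> t - t\<^sup>2 *\<^sub>R ?A))"
      by (simp flip: scaleR_diff_right)
    also have "\<dots> \<le> ?e * t\<^sup>2 + ?e * t\<^sup>2"
      using 1(2) 2(2) t norm_triangle_ineq4 by (meson add_mono order_trans)
    finally show False using e t by (simp add: field_simps)
  qed
qed

section \<open>Smooth functions and multi-index derivatives\<close>

lemma Ck_SucD: "Ck (Suc k) f \<Longrightarrow> Ck k f"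
proof (induction k arbitrary: f)
  case 0
  then show ?case by (simp add: differentiable_imp_continuous_on)
next
  case (Suc k)
  then show ?case by simp
qed

lemma Ck_const: "Ck k (\<lambda>x. c)"
  by (induction k arbitrary: c) auto

lemma Ck_add: "Ck k f \<Longrightarrow> Ck k g \<Longrightarrow> Ck k (\<lambda>x. f x + g x)"
  by (induction k arbitrary: f g) (auto simp: pderiv_at_add intro: continuous_intros)

lemma Ck_sum: "finite A \<Longrightarrow> (\<And>a. a \<in> A \<Longrightarrow> Ck k (f a)) \<Longrightarrow> Ck k (\<lambda>x. \<Sum>a\<in>A. f a x)"
  by (induction A rule: finite_induct) (simp_all add: Ck_const Ck_add)

lemma Ck_linear_compose: "bounded_linear h \<Longrightarrow> Ck k f \<Longrightarrow> Ck k (\<lambda>x. h (f x))"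
proof (induction k arbitrary: f)
  case 0
  then show ?case using bounded_linear.continuous_on by auto
next
  case (Suc k)
  have "(\<lambda>x. h (f x)) differentiable_on UNIV"
    using Suc.prems differentiable_on_compose[of f UNIV h] bounded_linear_imp_differentiable_on
    by auto
  then show ?case using Suc by (simp add: pderiv_at_linear_compose)
qed

lemma Ck_linear: "bounded_linear h \<Longrightarrow> Ck k h"
  by (cases k) (auto simp: pderiv_at_linear Ck_const bounded_linear_imp_differentiable_on
      linear_continuous_on)

lemma (in bounded_bilinear) Ck: "Ck k f \<Longrightarrow> Ck k g \<Longrightarrow> Ck k (\<lambda>x. prod (f x) (g x))"
proof (induction k arbitrary: f g)
  case 0
  then show ?case using continuous_on by auto
next
  case (Suc k)
  then have "Ck k f" "Ck k g" using Ck_SucD by blast+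
  then show ?case
    using Suc by (simp add: differentiable_on_UNIV pderiv_at Ck_add)
qed

text \<open>By the chain rule a partial derivative of the composition is a sum of products of a
  partial derivative of \<theta> with some \<open>pderiv_at j f\<close> composed with \<theta>. The
  latter falls under the induction hypothesis, with \<theta> demoted to the lower class.\<close>

lemma Ck_compose: "Ck k f \<Longrightarrow> Ck k \<theta> \<Longrightarrow> Ck k (\<lambda>x. f (\<theta> x))"
proof (induction k arbitrary: f)
  case 0
  then show ?case using continuous_on_compose2[of UNIV f UNIV \<theta>] by auto
next
  case (Suc k)
  have d: "f differentiable_on UNIV" "\<theta> differentiable_on UNIV"
    using Suc.prems by auto
  have "(\<lambda>x. f (\<theta> x)) differentiable_on UNIV"
    using d differentiable_on_compose[of \<theta> UNIV f] differentiable_on_subset by blast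
  moreover have "Ck k (pderiv_at i (\<lambda>x. f (\<theta> x)))" for i
    unfolding pderiv_at_compose[OF d] pderiv_at_linear_compose[OF bounded_linear_vec_nth d(2)]
    using Suc Ck_SucD[OF Suc.prems(2)]
    by (intro Ck_sum bounded_bilinear.Ck[OF bounded_bilinear_scaleR]
        Ck_linear_compose[OF bounded_linear_vec_nth]) auto
  ultimately show ?case by simp
qed

lemma Cinf_differentiable: "Cinf f \<Longrightarrow> f differentiable_on UNIV"
  unfolding Cinf_def by (metis Ck.simps(2))

lemma Cinf_pderiv_at: "Cinf f \<Longrightarrow> Cinf (pderiv_at i f)"
  unfolding Cinf_def by (metis Ck.simps(2))

lemma Cinf_const: "Cinf (\<lambda>x. c)"
  by (simp add: Cinf_def Ck_const)

lemma Cinf_add: "Cinf f \<Longrightarrow> Cinf g \<Longrightarrow> Cinf (\<lambda>x. f x + g x)"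
  by (simp add: Cinf_def Ck_add)

lemma Cinf_sum: "finite A \<Longrightarrow> (\<And>a. a \<in> A \<Longrightarrow> Cinf (f a)) \<Longrightarrow> Cinf (\<lambda>x. \<Sum>a\<in>A. f a x)"
  by (simp add: Cinf_def Ck_sum)

lemma Cinf_linear: "bounded_linear h \<Longrightarrow> Cinf h"
  by (simp add: Cinf_def Ck_linear)

lemma Cinf_linear_compose: "bounded_linear h \<Longrightarrow> Cinf f \<Longrightarrow> Cinf (\<lambda>x. h (f x))"
  by (simp add: Cinf_def Ck_linear_compose)

lemma (in bounded_bilinear) Cinf: "Cinf f \<Longrightarrow> Cinf g \<Longrightarrow> Cinf (\<lambda>x. prod (f x) (g x))"
  by (simp add: Cinf_def Ck)

lemmas Cinf_mult = bounded_bilinear.Cinf[OF bounded_bilinear_mult]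
lemmas Cinf_nth = Cinf_linear_compose[OF bounded_linear_vec_nth]

lemma Cinf_diff: "Cinf f \<Longrightarrow> Cinf g \<Longrightarrow> Cinf (\<lambda>x. f x - g x)"
  using Cinf_add[of f "\<lambda>x. - g x"] Cinf_linear_compose[OF bounded_linear_minus[OF bounded_linear_ident]]
  by auto

lemma Cinf_prod:
  fixes f :: "'a \<Rightarrow> 'd::finite rvec \<Rightarrow> 'b::{real_normed_algebra,comm_ring_1}"
  assumes "finite A" "\<And>a. a \<in> A \<Longrightarrow> Cinf (f a)"
  shows "Cinf (\<lambda>x. \<Prod>a\<in>A. f a x)"
  using assms by (induction A rule: finite_induct) (simp_all add: Cinf_const Cinf_mult)

lemma Cinf_compose: "Cinf f \<Longrightarrow> Cinf \<theta> \<Longrightarrow> Cinf (\<lambda>x. f (\<theta> x))"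
  by (simp add: Cinf_def Ck_compose)

lemma Cinf_pderiv_at_pow: "Cinf f \<Longrightarrow> Cinf ((pderiv_at i ^^ n) f)"
  by (induction n) (simp_all add: Cinf_pderiv_at)

lemma Cinf_pderiv_at_commute:
  "Cinf f \<Longrightarrow> pderiv_at i (pderiv_at j f) = pderiv_at j (pderiv_at i f)"
  by (simp add: pderiv_at_commute Cinf_differentiable Cinf_pderiv_at)

lemma pderiv_at_pow_commute:
  "Cinf f \<Longrightarrow> pderiv_at i ((pderiv_at j ^^ n) f) = (pderiv_at j ^^ n) (pderiv_at i f)"
proof (induction n)
  case (Suc n)
  have "Cinf ((pderiv_at j ^^ n) f)" using Suc.prems by (rule Cinf_pderiv_at_pow)
  from Cinf_pderiv_at_commute[OF this, of i j] show ?case using Suc by simp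
qed simp

lemma Cinf_foldr_pderiv_at: "Cinf f \<Longrightarrow> Cinf (foldr (\<lambda>i. pderiv_at i ^^ a i) xs f)"
  by (induction xs) (simp_all add: Cinf_pderiv_at_pow)

lemma Cinf_mderiv: "Cinf f \<Longrightarrow> Cinf (mderiv \<alpha> f)"
  by (simp add: mderiv_def Cinf_foldr_pderiv_at)

lemma foldr_pderiv_at_commute:
  "Cinf f \<Longrightarrow> foldr (\<lambda>j. pderiv_at j ^^ a j) xs (pderiv_at i f) =
     pderiv_at i (foldr (\<lambda>j. pderiv_at j ^^ a j) xs f)"
  by (induction xs) (simp_all add: pderiv_at_pow_commute Cinf_foldr_pderiv_at)

section \<open>Multi-indices and the recursion for \<open>mderiv\<close>\<close>

definition mi_unit :: "'d::finite \<Rightarrow> 'd mindex" where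
  "mi_unit i = axis i 1"

lemma mi_unit_nth: "mi_unit i $ j = (if j = i then 1 else 0)"
  by (simp add: mi_unit_def axis_def)

text \<open>The additional derivative enters the fold at the position of i and commutes out to the
  front; distinctness of the list lets it enter only once.\<close>

lemma foldr_pderiv_at_Suc:
  assumes "Cinf f"
  shows "distinct xs \<Longrightarrow> foldr (\<lambda>j. pderiv_at j ^^ (\<alpha> + mi_unit i) $ j) xs f =
     (if i \<in> set xs then pderiv_at i (foldr (\<lambda>j. pderiv_at j ^^ \<alpha> $ j) xs f)
      else foldr (\<lambda>j. pderiv_at j ^^ \<alpha> $ j) xs f)"
proof (induction xs)
  case (Cons j xs)
  then show ?case
    by (auto simp: mi_unit_nth pderiv_at_pow_commute assms Cinf_foldr_pderiv_at)
qed simp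

lemma mderiv_0 [simp]: "mderiv 0 f = f"
proof -
  have "foldr (\<lambda>i. pderiv_at i ^^ 0) xs f = f" for xs by (induction xs) auto
  then show ?thesis by (simp add: mderiv_def)
qed

lemma mderiv_Suc: "Cinf f \<Longrightarrow> mderiv (\<alpha> + mi_unit i) f = pderiv_at i (mderiv \<alpha> f)"
  using foldr_pderiv_at_Suc[of f "sorted_list_of_set UNIV" \<alpha> i] by (simp add: mderiv_def)

text \<open>The form for inductions in which the function itself changes, as in the Leibniz rule and
  for flat compositions.\<close>

lemma mderiv_Suc': "Cinf f \<Longrightarrow> mderiv (\<alpha> + mi_unit i) f = mderiv \<alpha> (pderiv_at i f)"
  using mderiv_Suc[of f \<alpha> i] by (simp add: mderiv_def foldr_pderiv_at_commute)

lemma mi_abs_0 [simp]: "mi_abs 0 = 0"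
  by (simp add: mi_abs_def)

lemma mi_abs_add: "mi_abs (\<alpha> + \<beta>) = mi_abs \<alpha> + mi_abs \<beta>"
  by (simp add: mi_abs_def sum.distrib)

lemma mi_abs_unit [simp]: "mi_abs (mi_unit i) = 1"
  by (simp add: mi_abs_def mi_unit_nth)

lemma mi_abs_eq_0_iff [simp]: "mi_abs \<alpha> = 0 \<longleftrightarrow> \<alpha> = 0"
  by (auto simp: mi_abs_def vec_eq_iff)

lemma mindex_split_unit:
  fixes \<alpha> :: "'d::finite mindex"
  assumes "\<alpha> $ i > 0"
  shows "\<alpha> - mi_unit i + mi_unit i = \<alpha>"
  using assms by (auto simp: vec_eq_iff mi_unit_nth)

text \<open>Induction on |\<alpha>|. The step adds a unit in any coordinate, which is the shape of
  the recursion for \<open>mderiv\<close>.\<close>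

lemma mindex_induct [case_names 0 Suc]:
  fixes \<alpha> :: "'d::finite mindex"
  assumes "P 0" "\<And>\<alpha> i. P \<alpha> \<Longrightarrow> P (\<alpha> + mi_unit i)"
  shows "P \<alpha>"
proof (induction "mi_abs \<alpha>" arbitrary: \<alpha>)
  case 0
  then show ?case using assms(1) by simp
next
  case (Suc n)
  then obtain i where "\<alpha> $ i > 0" by (metis mi_abs_eq_0_iff nat.distinct(1) neq0_conv vec_eq_iff zero_index)
  then have e: "\<alpha> - mi_unit i + mi_unit i = \<alpha>" by (rule mindex_split_unit)
  then have "mi_abs (\<alpha> - mi_unit i) + 1 = Suc n" by (metis Suc.hyps(2) mi_abs_add mi_abs_unit)
  then show ?case using assms(2) Suc.hyps(1) e by (metis Suc_eq_plus1 Suc_inject)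
qed

lemma mderiv_linear_compose:
  assumes "bounded_linear h"
  shows "Cinf f \<Longrightarrow> mderiv \<alpha> (\<lambda>x. h (f x)) = (\<lambda>x. h (mderiv \<alpha> f x))"
proof (induction \<alpha> rule: mindex_induct)
  case (Suc \<alpha> i)
  then show ?case
    by (simp add: mderiv_Suc Cinf_linear_compose assms pderiv_at_linear_compose Cinf_mderiv
        Cinf_differentiable)
qed simp

lemma mderiv_const: "mderiv \<alpha> (\<lambda>x. c) = (\<lambda>x. if \<alpha> = 0 then c else 0)"
proof (induction \<alpha> rule: mindex_induct)
  case (Suc \<alpha> i)
  have "\<alpha> + mi_unit i \<noteq> 0"
    by (metis add_is_0 mi_abs_0 mi_abs_add mi_abs_unit zero_neq_one)
  then show ?case using Suc by (simp add: mderiv_Suc Cinf_const)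
qed simp

lemma mderiv_add:
  "Cinf f \<Longrightarrow> Cinf g \<Longrightarrow> mderiv \<alpha> (\<lambda>x. f x + g x) = (\<lambda>x. mderiv \<alpha> f x + mderiv \<alpha> g x)"
proof (induction \<alpha> rule: mindex_induct)
  case (Suc \<alpha> i)
  then show ?case
    by (simp add: mderiv_Suc Cinf_add pderiv_at_add Cinf_mderiv Cinf_differentiable)
qed simp

lemma mderiv_sum:
  assumes "finite A" "\<And>a. a \<in> A \<Longrightarrow> Cinf (f a)"
  shows "mderiv \<alpha> (\<lambda>x. \<Sum>a\<in>A. f a x) = (\<lambda>x. \<Sum>a\<in>A. mderiv \<alpha> (f a) x)"
  using assms
proof (induction A rule: finite_induct)
  case empty
  then show ?case by (simp add: mderiv_const)
next
  case (insert a A)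
  then have "Cinf (\<lambda>x. \<Sum>a\<in>A. f a x)" by (simp add: Cinf_sum)
  then show ?case using insert by (simp add: mderiv_add)
qed

lemma mderiv_diff:
  assumes "Cinf f" "Cinf g"
  shows "mderiv \<alpha> (\<lambda>x. f x - g x) = (\<lambda>x. mderiv \<alpha> f x - mderiv \<alpha> g x)"
proof -
  have m: "bounded_linear (\<lambda>x. - x :: 'b)"
    using bounded_linear_minus[OF bounded_linear_ident] .
  show ?thesis
    using mderiv_add[of f "\<lambda>x. - g x" \<alpha>] assms Cinf_linear_compose[OF m, of g]
      mderiv_linear_compose[OF m, of g \<alpha>]
    by auto
qed

lemma mderiv_translate: "mderiv \<alpha> (\<lambda>x. f (x + a)) = (\<lambda>x. mderiv \<alpha> f (x + a))"
proof -
  have pow: "(pderiv_at i ^^ n) (\<lambda>x. f (x + a)) = (\<lambda>x. (pderiv_at i ^^ n) f (x + a))" for i n f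
    by (induction n) (simp_all add: pderiv_at_translate)
  have "foldr (\<lambda>i. pderiv_at i ^^ \<alpha> $ i) xs (\<lambda>x. f (x + a)) =
      (\<lambda>x. foldr (\<lambda>i. pderiv_at i ^^ \<alpha> $ i) xs f (x + a))" for xs
    by (induction xs) (simp_all add: pow)
  then show ?thesis by (simp add: mderiv_def)
qed

section \<open>The Leibniz rule\<close>

lemma finite_mindex_le: "finite {\<beta>. \<beta> \<le> (\<alpha> :: 'd::finite mindex)}"
proof (rule finite_subset)
  show "{\<beta>. \<beta> \<le> \<alpha>} \<subseteq> vec_lambda ` (PiE UNIV (\<lambda>i. {..\<alpha> $ i}))"
  proof
    fix \<beta> assume "\<beta> \<in> {\<beta>. \<beta> \<le> \<alpha>}"
    then have "vec_nth \<beta> \<in> PiE UNIV (\<lambda>i. {..\<alpha> $ i})" "\<beta> = vec_lambda (vec_nth \<beta>)"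
      by (auto simp: less_eq_vec_def)
    then show "\<beta> \<in> vec_lambda ` (PiE UNIV (\<lambda>i. {..\<alpha> $ i}))" by blast
  qed
qed (intro finite_imageI finite_PiE, auto)

lemma finite_mi_abs_le: "finite {\<beta> :: 'd::finite mindex. mi_abs \<beta> \<le> n}"
proof (rule finite_subset)
  show "{\<beta> :: 'd mindex. mi_abs \<beta> \<le> n} \<subseteq> {\<beta>. \<beta> \<le> (\<chi> i. n)}"
  proof
    fix \<beta> :: "'d mindex" assume "\<beta> \<in> {\<beta>. mi_abs \<beta> \<le> n}"
    moreover have "\<beta> $ i \<le> mi_abs \<beta>" for i
      unfolding mi_abs_def by (rule member_le_sum) auto
    ultimately show "\<beta> \<in> {\<beta>. \<beta> \<le> (\<chi> i. n)}"
      by (auto simp: less_eq_vec_def intro: order_trans)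
  qed
qed (rule finite_mindex_le)

lemma mi_binom_eq_0: "\<not> \<beta> \<le> \<alpha> \<Longrightarrow> mi_binom \<alpha> \<beta> = 0"
  by (auto simp: mi_binom_def less_eq_vec_def not_le intro!: prod_zero)

text \<open>Pascal's rule in the i-th factor. If \<beta> vanishes at i, the subtraction truncates
  and \<open>\<beta> - mi_unit i\<close> is \<beta> itself, hence the case distinction.\<close>

lemma mi_binom_Suc:
  fixes \<alpha> \<beta> :: "'d::finite mindex"
  shows "mi_binom (\<alpha> + mi_unit i) \<beta> =
     mi_binom \<alpha> \<beta> + (if \<beta> $ i = 0 then 0 else mi_binom \<alpha> (\<beta> - mi_unit i))"
proof -
  have split: "(\<Prod>j\<in>UNIV. h j) = h i * (\<Prod>j\<in>UNIV - {i}. h j)" for h :: "'d \<Rightarrow> nat"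
    by (simp add: prod.remove)
  have 1: "(\<Prod>j\<in>UNIV - {i}. (\<alpha> + mi_unit i) $ j choose \<beta> $ j) = (\<Prod>j\<in>UNIV - {i}. \<alpha> $ j choose \<beta> $ j)"
    by (rule prod.cong) (auto simp: mi_unit_nth)
  have 2: "(\<Prod>j\<in>UNIV - {i}. \<alpha> $ j choose (\<beta> - mi_unit i) $ j) = (\<Prod>j\<in>UNIV - {i}. \<alpha> $ j choose \<beta> $ j)"
    by (rule prod.cong) (auto simp: mi_unit_nth)
  show ?thesis
    unfolding mi_binom_def split[of "\<lambda>j. _ $ j choose _ $ j"] 1 2
    by (cases "\<beta> $ i") (auto simp: algebra_simps mi_unit_nth)
qed

text \<open>One derivative is moved inside and split by the product rule. The two resulting Leibniz
  sums are brought to the common index set below \<open>\<alpha> + mi_unit i\<close>, where Pascal's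
  rule adds their coefficients.\<close>

lemma (in bounded_bilinear) mderiv:
  fixes f :: "'d::{finite,linorder} rvec \<Rightarrow> 'a"
  assumes "Cinf f" "Cinf g"
  shows "mderiv \<alpha> (\<lambda>x. prod (f x) (g x)) =
    (\<lambda>x. \<Sum>\<beta> | \<beta> \<le> \<alpha>. real (mi_binom \<alpha> \<beta>) *\<^sub>R prod (mderiv \<beta> f x) (mderiv (\<alpha> - \<beta>) g x))"
  using assms
proof (induction \<alpha> arbitrary: f g rule: mindex_induct)
  case 0
  have "{\<beta>. \<beta> \<le> (0 :: 'd mindex)} = {0}"
    by (auto simp: less_eq_vec_def vec_eq_iff)
  then show ?case by (simp add: mi_binom_def)
next
  case (Suc \<alpha> i)
  let ?e = "mi_unit i "
  define T where "T \<beta> x = prod (mderiv \<beta> f x) (mderiv (\<alpha> + ?e - \<beta>) g x)" for \<beta> x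
  have df: "Cinf (pderiv_at i f)" "Cinf (pderiv_at i g)"
    using Suc.prems by (simp_all add: Cinf_pderiv_at)
  show ?case
  proof
    fix x
    let ?b = "\<lambda>\<beta>. real (mi_binom \<alpha> \<beta>)"
    have up: "\<gamma> + ?e \<le> \<alpha> + ?e \<longleftrightarrow> \<gamma> \<le> \<alpha>" for \<gamma>
      by (auto simp: less_eq_vec_def)
    have "mderiv (\<alpha> + ?e) (\<lambda>x. prod (f x) (g x)) x =
        mderiv \<alpha> (\<lambda>x. prod (pderiv_at i f x) (g x) + prod (f x) (pderiv_at i g x)) x"
      using Suc.prems by (simp add: mderiv_Suc' Cinf pderiv_at Cinf_differentiable)
    also have "\<dots> = (\<Sum>\<beta> | \<beta> \<le> \<alpha>. ?b \<beta> *\<^sub>R prod (mderiv \<beta> (pderiv_at i f) x) (mderiv (\<alpha> - \<beta>) g x))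
        + (\<Sum>\<beta> | \<beta> \<le> \<alpha>. ?b \<beta> *\<^sub>R prod (mderiv \<beta> f x) (mderiv (\<alpha> - \<beta>) (pderiv_at i g) x))"
      using Suc df by (simp add: mderiv_add Cinf)
    also have "(\<Sum>\<beta> | \<beta> \<le> \<alpha>. ?b \<beta> *\<^sub>R prod (mderiv \<beta> f x) (mderiv (\<alpha> - \<beta>) (pderiv_at i g) x)) =
        (\<Sum>\<beta> | \<beta> \<le> \<alpha>. ?b \<beta> *\<^sub>R T \<beta> x)"
    proof (rule sum.cong)
      fix \<beta> assume "\<beta> \<in> {\<beta>. \<beta> \<le> \<alpha>}"
      then have "\<alpha> + ?e - \<beta> = \<alpha> - \<beta> + ?e"
        by (auto simp: vec_eq_iff less_eq_vec_def)
      then show "?b \<beta> *\<^sub>R prod (mderiv \<beta> f x) (mderiv (\<alpha> - \<beta>) (pderiv_at i g) x) = ?b \<beta> *\<^sub>R T \<beta> x"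
        using Suc.prems by (simp add: T_def mderiv_Suc')
    qed simp
    \<comment> \<open>Enlarging the index set costs nothing, since the binomial coefficient vanishes
      unless \<beta> \<le> \<alpha>.\<close>
    also have "\<dots> = (\<Sum>\<beta> | \<beta> \<le> \<alpha> + ?e. ?b \<beta> *\<^sub>R T \<beta> x)"
    proof (rule sum.mono_neutral_left)
      show "{\<beta>. \<beta> \<le> \<alpha>} \<subseteq> {\<beta>. \<beta> \<le> \<alpha> + ?e}"
        by (auto simp: less_eq_vec_def intro: trans_le_add1)
    qed (auto simp: finite_mindex_le mi_binom_eq_0)
    \<comment> \<open>The shift of \<beta> by one unit is a bijection only onto the indices that are
      positive at i; elsewhere truncated subtraction would create spurious terms.\<close>
    also have "(\<Sum>\<beta> | \<beta> \<le> \<alpha>. ?b \<beta> *\<^sub>R prod (mderiv \<beta> (pderiv_at i f) x) (mderiv (\<alpha> - \<beta>) g x)) =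
        (\<Sum>\<beta> | \<beta> \<le> \<alpha> + ?e \<and> \<beta> $ i \<noteq> 0. ?b (\<beta> - ?e) *\<^sub>R T \<beta> x)"
    proof (rule sum.reindex_bij_witness[where i = "\<lambda>\<beta>. \<beta> - ?e" and j = "\<lambda>\<beta>. \<beta> + ?e"])
      fix \<beta> assume "\<beta> \<in> {\<beta>. \<beta> \<le> \<alpha> + ?e \<and> \<beta> $ i \<noteq> 0}"
      then have \<beta>: "\<beta> \<le> \<alpha> + ?e" "\<beta> - ?e + ?e = \<beta>"
        using mindex_split_unit[of \<beta> i] by auto
      then show "\<beta> - ?e + ?e = \<beta>" "\<beta> - ?e \<in> {\<beta>. \<beta> \<le> \<alpha>}"
        using up[of "\<beta> - ?e"] by auto
    next
      fix \<beta> assume \<beta>: "\<beta> \<in> {\<beta>. \<beta> \<le> \<alpha>}"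
      show "\<beta> + ?e - ?e = \<beta>" by (simp add: vec_eq_iff)
      show "\<beta> + ?e \<in> {\<beta>. \<beta> \<le> \<alpha> + ?e \<and> \<beta> $ i \<noteq> 0}"
        using \<beta> up by (simp add: mi_unit_nth)
      have "\<alpha> + ?e - (\<beta> + ?e) = \<alpha> - \<beta>" "\<beta> + ?e - ?e = \<beta>" by (simp_all add: vec_eq_iff)
      then show "?b (\<beta> + ?e - ?e) *\<^sub>R T (\<beta> + ?e) x =
          ?b \<beta> *\<^sub>R prod (mderiv \<beta> (pderiv_at i f) x) (mderiv (\<alpha> - \<beta>) g x)"
        using Suc.prems by (simp add: T_def mderiv_Suc')
    qed
    also have "\<dots> = (\<Sum>\<beta> | \<beta> \<le> \<alpha> + ?e. (if \<beta> $ i = 0 then 0 else ?b (\<beta> - ?e)) *\<^sub>R T \<beta> x)"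
      by (rule sum.mono_neutral_cong_left) (auto simp: finite_mindex_le)
    also have "\<dots> + (\<Sum>\<beta> | \<beta> \<le> \<alpha> + ?e. ?b \<beta> *\<^sub>R T \<beta> x) =
        (\<Sum>\<beta> | \<beta> \<le> \<alpha> + ?e. real (mi_binom (\<alpha> + ?e) \<beta>) *\<^sub>R T \<beta> x)"
      by (simp add: mi_binom_Suc flip: sum.distrib scaleR_left_distrib) (rule sum.cong; simp add: algebra_simps)
    finally show "mderiv (\<alpha> + ?e) (\<lambda>x. prod (f x) (g x)) x =
        (\<Sum>\<beta> | \<beta> \<le> \<alpha> + ?e. real (mi_binom (\<alpha> + ?e) \<beta>) *\<^sub>R
          prod (mderiv \<beta> f x) (mderiv (\<alpha> + ?e - \<beta>) g x))"
      by (simp add: T_def)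
  qed
qed

section \<open>The combinatorial sums over \<open>p(\<beta>, \<mu>)\<close>\<close>

lemma mi_abs_sum: "mi_abs (\<Sum>a\<in>A. f a) = (\<Sum>a\<in>A. mi_abs (f a))"
  by (induction A rule: infinite_finite_induct) (simp_all add: mi_abs_add)

lemma mi_abs_smult: "mi_abs (c *s v) = c * mi_abs v"
  by (simp add: mi_abs_def sum_distrib_left)

lemma mindex_smult_Suc: "Suc a *s (v :: 'd::finite mindex) = v + a *s v"
  by (simp add: vec_eq_iff)

lemma member_le_sum_mindex:
  fixes f :: "'a \<Rightarrow> 'd::finite mindex"
  assumes "finite A" "a \<in> A"
  shows "f a \<le> (\<Sum>a\<in>A. f a)"
  using assms by (auto simp: less_eq_vec_def intro!: member_le_sum)

text \<open>A point of \<open>p(\<beta>, \<mu>)\<close> only lists, in increasing order, the nonzero values of a family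
  \<open>\<kappa>\<close> with \<open>\<kappa> (\<ell>\<^sub>j) = k\<^sub>j\<close>. The index set \<open>L\<close> is kept fixed while \<open>\<beta>\<close> and \<open>\<mu>\<close> vary, which
  makes the recursion for the sums over these families uniform.\<close>

definition fdb_families :: "'d::finite mindex set \<Rightarrow> 'd mindex \<Rightarrow> 'd mindex \<Rightarrow> ('d mindex \<Rightarrow> 'd mindex) set" where
  "fdb_families L \<beta> \<mu> =
     {\<kappa>. (\<forall>l. l \<notin> L \<longrightarrow> \<kappa> l = 0) \<and> (\<Sum>l\<in>L. \<kappa> l) = \<mu> \<and> (\<Sum>l\<in>L. mi_abs (\<kappa> l) *s l) = \<beta>}"

text \<open>With \<open>a l i\<close> = \<theta>_i^(l)(x) / l! this is the product over j in
  \<open>Ffun\<close>: the factors (l!)^|k| are absorbed into \<open>a\<close>.\<close>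

definition fdb_weight ::
    "('d::finite mindex \<Rightarrow> 'd \<Rightarrow> real) \<Rightarrow> 'd mindex set \<Rightarrow> ('d mindex \<Rightarrow> 'd mindex) \<Rightarrow> real" where
  "fdb_weight a L \<kappa> = (\<Prod>l\<in>L. \<Prod>i\<in>UNIV. a l i ^ (\<kappa> l $ i) / fact (\<kappa> l $ i))"

definition fdb_sum ::
    "('d::finite mindex \<Rightarrow> 'd \<Rightarrow> real) \<Rightarrow> 'd mindex set \<Rightarrow> 'd mindex \<Rightarrow> 'd mindex \<Rightarrow> real" where
  "fdb_sum a L \<beta> \<mu> = (\<Sum>\<kappa>\<in>fdb_families L \<beta> \<mu>. fdb_weight a L \<kappa>)"

lemma finite_fdb_families:
  assumes "finite L"
  shows "finite (fdb_families L \<beta> \<mu>)"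
proof (rule finite_subset)
  show "fdb_families L \<beta> \<mu> \<subseteq> {\<kappa>. \<forall>l. (l \<in> L \<longrightarrow> \<kappa> l \<in> {\<gamma>. \<gamma> \<le> \<mu>}) \<and> (l \<notin> L \<longrightarrow> \<kappa> l = 0)}"
    using member_le_sum_mindex[OF assms] by (auto simp: fdb_families_def)
  show "finite {\<kappa>. \<forall>l. (l \<in> L \<longrightarrow> \<kappa> l \<in> {\<gamma>. \<gamma> \<le> \<mu>}) \<and> (l \<notin> L \<longrightarrow> \<kappa> l = 0)}"
    using assms finite_mindex_le by (rule finite_set_of_finite_funs)
qed

text \<open>Every l in L has |l| \<ge> 1, so the summands |\<kappa> l| |l| of |\<beta>| dominate the
  summands |\<kappa> l| of |\<mu>|. Hence the restriction |\<mu>| \<le> |\<beta>| in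
  \<open>Ffun\<close> only omits zero terms.\<close>

lemma mi_abs_fdb_families:
  assumes "finite L" "0 \<notin> L" "\<kappa> \<in> fdb_families L \<beta> \<mu>"
  shows "mi_abs \<mu> \<le> mi_abs \<beta>"
proof -
  have "mi_abs \<mu> = (\<Sum>l\<in>L. mi_abs (\<kappa> l))"
    using assms(3) by (auto simp: fdb_families_def mi_abs_sum)
  also have "\<dots> \<le> (\<Sum>l\<in>L. mi_abs (\<kappa> l) * mi_abs l)"
  proof (rule sum_mono)
    fix l assume "l \<in> L"
    then have "mi_abs l > 0" using assms(2) by (metis mi_abs_eq_0_iff neq0_conv)
    then show "mi_abs (\<kappa> l) \<le> mi_abs (\<kappa> l) * mi_abs l" by simp
  qed
  also have "\<dots> = mi_abs \<beta>"
    using assms(3) by (auto simp: fdb_families_def mi_abs_sum mi_abs_smult)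
  finally show ?thesis .
qed

lemma fdb_sum_eq_0:
  "finite L \<Longrightarrow> 0 \<notin> L \<Longrightarrow> mi_abs \<beta> < mi_abs \<mu> \<Longrightarrow> fdb_sum a L \<beta> \<mu> = 0"
  unfolding fdb_sum_def using mi_abs_fdb_families
  by (metis (no_types, lifting) equals0I linorder_not_le sum.empty)

lemma fdb_sum_base:
  fixes \<beta> :: "'d::finite mindex"
  assumes "finite L"
  shows "fdb_sum a L \<beta> 0 = (if \<beta> = 0 then 1 else 0)"
proof -
  have "(\<Sum>l\<in>L. \<kappa> l) = 0 \<Longrightarrow> l \<in> L \<Longrightarrow> \<kappa> l = 0" for \<kappa> :: "'d mindex \<Rightarrow> 'd mindex" and l
    using member_le_sum_mindex[OF assms, of l \<kappa>] by (auto simp: vec_eq_iff less_eq_vec_def)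
  then have "\<kappa> = (\<lambda>_. 0)" if "\<kappa> \<in> fdb_families L \<beta> 0" for \<kappa>
    using that by (force simp: fdb_families_def)
  moreover have "(\<lambda>_. 0) \<in> fdb_families L \<beta> 0 \<longleftrightarrow> \<beta> = 0"
    by (auto simp: fdb_families_def)
  ultimately have "fdb_families L \<beta> 0 = (if \<beta> = 0 then {\<lambda>_. 0} else {})"
    by auto
  then show ?thesis by (simp add: fdb_sum_def fdb_weight_def)
qed

text \<open>The sums are the coefficients of z^\<mu> w^\<beta> in exp of the sum of all a l i * z_i
  * w^l; the recursion is its derivative with respect to z_j. Combinatorially, \<mu>_j is the sum of
  the entries \<kappa> l j, and taking one unit from \<kappa> l lowers \<mu> by e_j and \<beta> by
  l.\<close>

lemma fdb_sum_rec:
  fixes \<mu> :: "'d::finite mindex"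
  assumes L: "finite L" and j: "\<mu> $ j > 0"
  shows "real (\<mu> $ j) * fdb_sum a L \<beta> \<mu> =
    (\<Sum>l | l \<in> L \<and> l \<le> \<beta>. a l j * fdb_sum a L (\<beta> - l) (\<mu> - mi_unit j))"
proof -
  define inc where "inc l \<kappa> = \<kappa>(l := \<kappa> l + mi_unit j)" for l and \<kappa> :: "'d mindex \<Rightarrow> 'd mindex"
  have inc_other: "inc l \<kappa> l' = \<kappa> l'" if "l' \<in> L - {l}" for l l' \<kappa>
    using that by (simp add: inc_def)
  have sum1: "(\<Sum>l'\<in>L. inc l \<kappa> l') = (\<Sum>l'\<in>L. \<kappa> l') + mi_unit j" if "l \<in> L" for l \<kappa>
    unfolding sum.remove[OF L that] using inc_other[of _ l \<kappa>] by (simp add: inc_def add_ac)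
  have sum2: "(\<Sum>l'\<in>L. mi_abs (inc l \<kappa> l') *s l') = (\<Sum>l'\<in>L. mi_abs (\<kappa> l') *s l') + l" if "l \<in> L" for l \<kappa>
    unfolding sum.remove[OF L that] using inc_other[of _ l \<kappa>]
    by (simp add: inc_def add_ac mi_abs_add mindex_smult_Suc)
  \<comment> \<open>Multiplying by the increased entry cancels the new factor of its factorial and
    leaves the extra power of \<open>a l j\<close>.\<close>
  have weight: "real (inc l \<kappa> l $ j) * fdb_weight a L (inc l \<kappa>) = a l j * fdb_weight a L \<kappa>"
    if "l \<in> L" for l \<kappa>
  proof -
    let ?w = "\<lambda>\<kappa> i. a l i ^ (\<kappa> l $ i) / fact (\<kappa> l $ i) :: real"
    have "real (inc l \<kappa> l $ j) * (\<Prod>i\<in>UNIV. ?w (inc l \<kappa>) i) = a l j * (\<Prod>i\<in>UNIV. ?w \<kappa> i)"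
    proof -
      have "(\<Prod>i\<in>UNIV - {j}. ?w (inc l \<kappa>) i) = (\<Prod>i\<in>UNIV - {j}. ?w \<kappa> i)"
        by (rule prod.cong) (auto simp: inc_def mi_unit_nth)
      moreover have "real (inc l \<kappa> l $ j) * ?w (inc l \<kappa>) j = a l j * ?w \<kappa> j"
        by (simp add: inc_def mi_unit_nth del: of_nat_Suc)
      ultimately show ?thesis
        by (simp only: prod.remove[OF finite UNIV_I[of j]] mult.assoc[symmetric])
    qed
    moreover have "(\<Prod>l'\<in>L - {l}. \<Prod>i\<in>UNIV. a l' i ^ (inc l \<kappa> l' $ i) / fact (inc l \<kappa> l' $ i)) =
        (\<Prod>l'\<in>L - {l}. \<Prod>i\<in>UNIV. a l' i ^ (\<kappa> l' $ i) / fact (\<kappa> l' $ i))"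
      using inc_other[of _ l \<kappa>] by simp
    ultimately show ?thesis
      unfolding fdb_weight_def prod.remove[OF L that] mult.assoc[symmetric] by (simp only:)
  qed
  have part: "(\<Sum>\<kappa>\<in>fdb_families L \<beta> \<mu>. real (\<kappa> l $ j) * fdb_weight a L \<kappa>) =
      (if l \<le> \<beta> then a l j * fdb_sum a L (\<beta> - l) (\<mu> - mi_unit j) else 0)" if l: "l \<in> L" for l
  proof (cases "l \<le> \<beta>")
    \<comment> \<open>No family can use such an l, because \<open>mi_abs (\<kappa> l) *s l\<close>
      is one of the summands of \<beta>. The case is separate since \<open>\<beta> - l\<close>
      truncates.\<close>
    case False
    have "\<kappa> l $ j = 0" if \<kappa>: "\<kappa> \<in> fdb_families L \<beta> \<mu>" for \<kappa>
    proof (rule ccontr)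
      assume "\<kappa> l $ j \<noteq> 0"
      then have "mi_abs (\<kappa> l) > 0" by (metis mi_abs_eq_0_iff neq0_conv zero_index)
      then have "l \<le> mi_abs (\<kappa> l) *s l" by (auto simp: less_eq_vec_def)
      also have "\<dots> \<le> \<beta>"
        using \<kappa> member_le_sum_mindex[OF L l, of "\<lambda>l. mi_abs (\<kappa> l) *s l"] by (simp add: fdb_families_def)
      finally show False using False by simp
    qed
    then show ?thesis using False by simp
  next
    case True
    then have e: "\<beta> - l + l = \<beta>" "\<mu> - mi_unit j + mi_unit j = \<mu>"
      using j mindex_split_unit by (auto simp: less_eq_vec_def vec_eq_iff)
    have mem: "inc l \<kappa> \<in> fdb_families L \<beta> \<mu> \<longleftrightarrow> \<kappa> \<in> fdb_families L (\<beta> - l) (\<mu> - mi_unit j)" for \<kappa>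
    proof -
      have supp: "(\<forall>l'. l' \<notin> L \<longrightarrow> inc l \<kappa> l' = 0) \<longleftrightarrow> (\<forall>l'. l' \<notin> L \<longrightarrow> \<kappa> l' = 0)"
        using l unfolding inc_def by (metis fun_upd_other)
      have "inc l \<kappa> \<in> fdb_families L (\<beta> - l + l) (\<mu> - mi_unit j + mi_unit j) \<longleftrightarrow>
          \<kappa> \<in> fdb_families L (\<beta> - l) (\<mu> - mi_unit j)"
        unfolding fdb_families_def mem_Collect_eq sum1[OF l] sum2[OF l] supp by simp
      then show ?thesis by (simp only: e)
    qed
    have "(\<Sum>\<kappa>\<in>fdb_families L \<beta> \<mu>. real (\<kappa> l $ j) * fdb_weight a L \<kappa>) =
        (\<Sum>\<kappa> | \<kappa> \<in> fdb_families L \<beta> \<mu> \<and> \<kappa> l $ j \<noteq> 0. real (\<kappa> l $ j) * fdb_weight a L \<kappa>)"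
      by (rule sum.mono_neutral_right) (auto simp: finite_fdb_families[OF L])
    also have "\<dots> = (\<Sum>\<kappa>\<in>fdb_families L (\<beta> - l) (\<mu> - mi_unit j). a l j * fdb_weight a L \<kappa>)"
    proof (rule sum.reindex_bij_witness[where i = "inc l" and j = "\<lambda>\<kappa>. \<kappa>(l := \<kappa> l - mi_unit j)"])
      fix \<kappa> assume \<kappa>: "\<kappa> \<in> {\<kappa> \<in> fdb_families L \<beta> \<mu>. \<kappa> l $ j \<noteq> 0}"
      let ?\<kappa> = "\<kappa>(l := \<kappa> l - mi_unit j)"
      show inv: "inc l ?\<kappa> = \<kappa>"
        using \<kappa> mindex_split_unit[of "\<kappa> l" j] by (simp add: inc_def)
      show "?\<kappa> \<in> fdb_families L (\<beta> - l) (\<mu> - mi_unit j)"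
        using \<kappa> mem[of ?\<kappa>] inv by simp
      show "a l j * fdb_weight a L ?\<kappa> = real (\<kappa> l $ j) * fdb_weight a L \<kappa>"
        using weight[OF l, of ?\<kappa>] inv by simp
    next
      fix \<kappa> assume "\<kappa> \<in> fdb_families L (\<beta> - l) (\<mu> - mi_unit j)"
      then show "inc l \<kappa> \<in> {\<kappa> \<in> fdb_families L \<beta> \<mu>. \<kappa> l $ j \<noteq> 0}"
        using mem[of \<kappa>] by (simp add: inc_def mi_unit_nth)
      show "(inc l \<kappa>)(l := inc l \<kappa> l - mi_unit j) = \<kappa>"
        by (auto simp: inc_def vec_eq_iff)
    qed
    finally show ?thesis using True by (simp add: fdb_sum_def sum_distrib_left)
  qed
  have "real (\<mu> $ j) * fdb_sum a L \<beta> \<mu> =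
      (\<Sum>\<kappa>\<in>fdb_families L \<beta> \<mu>. \<Sum>l\<in>L. real (\<kappa> l $ j) * fdb_weight a L \<kappa>)"
    unfolding fdb_sum_def sum_distrib_left
  proof (rule sum.cong)
    fix \<kappa> assume "\<kappa> \<in> fdb_families L \<beta> \<mu>"
    then have "\<mu> $ j = (\<Sum>l\<in>L. \<kappa> l $ j)" by (auto simp: fdb_families_def)
    then show "real (\<mu> $ j) * fdb_weight a L \<kappa> = (\<Sum>l\<in>L. real (\<kappa> l $ j) * fdb_weight a L \<kappa>)"
      by (simp add: sum_distrib_right)
  qed simp
  also have "\<dots> = (\<Sum>l\<in>L. \<Sum>\<kappa>\<in>fdb_families L \<beta> \<mu>. real (\<kappa> l $ j) * fdb_weight a L \<kappa>)"
    by (rule sum.swap)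
  also have "\<dots> = (\<Sum>l\<in>L. if l \<le> \<beta> then a l j * fdb_sum a L (\<beta> - l) (\<mu> - mi_unit j) else 0)"
    by (simp add: part)
  also have "\<dots> = (\<Sum>l | l \<in> L \<and> l \<le> \<beta>. a l j * fdb_sum a L (\<beta> - l) (\<mu> - mi_unit j))"
    using L by (simp add: sum.If_cases Int_def)
  finally show ?thesis .
qed

section \<open>Passing from families to ordered lists\<close>

text \<open>On \<open>mindex\<close> the symbol \<le> already means the componentwise order, so the
  graded lexicographic order is given as a \<open>class.linorder\<close> predicate, which makes
  \<open>sorted_list_of_set\<close> available for it. Totality comes from the least coordinate at
  which two multi-indices differ.\<close>

lemma mi_prec_linorder:
  "class.linorder (\<lambda>\<alpha> \<beta> :: 'd::{finite,linorder} mindex. \<alpha> = \<beta> \<or> mi_prec \<alpha> \<beta>) mi_prec"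
proof -
  define lex where "lex \<alpha> \<beta> \<longleftrightarrow> (\<exists>i. (\<forall>j<i. \<alpha> $ j = \<beta> $ j) \<and> \<alpha> $ i < \<beta> $ i)" for \<alpha> \<beta> :: "'d mindex"
  have prec: "mi_prec \<alpha> \<beta> \<longleftrightarrow> mi_abs \<alpha> < mi_abs \<beta> \<or> mi_abs \<alpha> = mi_abs \<beta> \<and> lex \<alpha> \<beta>" for \<alpha> \<beta> :: "'d mindex"
    by (simp add: mi_prec_def lex_def)
  have lex_trans: "lex \<alpha> \<gamma>" if "lex \<alpha> \<beta>" "lex \<beta> \<gamma>" for \<alpha> \<beta> \<gamma>
  proof -
    obtain i j where i: "\<forall>k<i. \<alpha> $ k = \<beta> $ k" "\<alpha> $ i < \<beta> $ i"
      and j: "\<forall>k<j. \<beta> $ k = \<gamma> $ k" "\<beta> $ j < \<gamma> $ j"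
      using \<open>lex \<alpha> \<beta>\<close> \<open>lex \<beta> \<gamma>\<close> unfolding lex_def by blast
    have "\<forall>k<min i j. \<alpha> $ k = \<gamma> $ k" using i(1) j(1) by simp
    moreover have "\<alpha> $ (min i j) < \<gamma> $ (min i j)"
      using i j by (cases i j rule: linorder_cases) (simp_all add: min_def not_le)
    ultimately show ?thesis unfolding lex_def by blast
  qed
  have lex_irrefl: "\<not> lex \<alpha> \<alpha>" for \<alpha>
    by (simp add: lex_def)
  have lex_total: "lex \<alpha> \<beta> \<or> lex \<beta> \<alpha>" if "\<alpha> \<noteq> \<beta>" for \<alpha> \<beta>
  proof -
    let ?D = "{i. \<alpha> $ i \<noteq> \<beta> $ i}"
    have D: "finite ?D" "?D \<noteq> {}" using that by (simp_all add: vec_eq_iff)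
    have "\<alpha> $ Min ?D \<noteq> \<beta> $ Min ?D" using Min_in[OF D] by simp
    moreover have "\<alpha> $ k = \<beta> $ k" if "k < Min ?D" for k
      using Min_le[OF D(1), of k] that by (metis (mono_tags, lifting) leD mem_Collect_eq)
    moreover have "\<beta> $ k = \<alpha> $ k" if "k < Min ?D" for k
      using calculation(2)[OF that] by (rule sym)
    ultimately show ?thesis unfolding lex_def by (meson linorder_neqE_nat)
  qed
  have trans: "mi_prec \<alpha> \<gamma>" if "mi_prec \<alpha> \<beta>" "mi_prec \<beta> \<gamma>" for \<alpha> \<beta> \<gamma> :: "'d mindex"
    using that lex_trans[of \<alpha> \<beta> \<gamma>] unfolding prec by auto
  have irrefl: "\<not> mi_prec \<alpha> \<alpha>" for \<alpha> :: "'d mindex"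
    using lex_irrefl unfolding prec by simp
  have total: "mi_prec \<alpha> \<beta> \<or> mi_prec \<beta> \<alpha>" if "\<alpha> \<noteq> \<beta>" for \<alpha> \<beta> :: "'d mindex"
    using lex_total[OF that] unfolding prec by linarith
  show ?thesis
    by unfold_locales (use irrefl trans total in blast)+
qed

lemma mi_prec_0_iff: "mi_prec 0 \<alpha> \<longleftrightarrow> \<alpha> \<noteq> 0"
proof -
  have "mi_prec 0 \<alpha>" if "\<alpha> \<noteq> 0"
    using that by (metis mi_abs_0 mi_abs_eq_0_iff mi_prec_def neq0_conv)
  moreover have "\<not> mi_prec 0 (0 :: 'a mindex)" by (simp add: mi_prec_def)
  ultimately show ?thesis by blast
qed

text \<open>Padding positions and points outside the support both contribute the neutral element.
  Working in \<open>comm_monoid_set\<close> serves the two sum conditions of \<open>fdb_set\<close>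
  and the product of the weights at once.\<close>

lemma (in comm_monoid_set) enumerate_support:
  fixes h :: "'d::finite mindex \<Rightarrow> 'd mindex \<Rightarrow> 'a" and s m :: nat
  assumes "finite L" "s \<le> m" "bij_betw l {m-s+1..m} {v\<in>L. \<kappa> v \<noteq> 0}"
    and "\<And>j. j \<in> {m-s+1..m} \<Longrightarrow> k j = \<kappa> (l j)" "\<And>j. j \<in> {1..m-s} \<Longrightarrow> k j = 0"
    and h: "\<And>v. h 0 v = \<^bold>1"
  shows "F (\<lambda>j. h (k j) (l j)) {1..m} = F (\<lambda>v. h (\<kappa> v) v) L"
proof -
  have "F (\<lambda>j. h (k j) (l j)) {1..m} = F (\<lambda>j. h (k j) (l j)) {m-s+1..m}"
  proof (rule mono_neutral_right)
    have "{1..m} - {m-s+1..m} \<subseteq> {1..m-s}" by auto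
    then show "\<forall>j\<in>{1..m} - {m-s+1..m}. h (k j) (l j) = \<^bold>1"
      using assms(5) h by (metis subsetD)
  qed auto
  also have "\<dots> = F (\<lambda>j. h (\<kappa> (l j)) (l j)) {m-s+1..m}"
    using assms(4) by (intro cong) auto
  also have "\<dots> = F (\<lambda>v. h (\<kappa> v) v) {v\<in>L. \<kappa> v \<noteq> 0}"
    by (rule reindex_bij_betw[OF assms(3), of "\<lambda>v. h (\<kappa> v) v"])
  also have "\<dots> = F (\<lambda>v. h (\<kappa> v) v) L"
    using assms(1) h by (intro mono_neutral_left) auto
  finally show ?thesis .
qed

text \<open>The support is listed increasingly at the end of 1..m, with zeros in front;
  \<open>undefined\<close> outside 1..m matches the extensional functions in \<open>fdb_set\<close>.
  The subtraction giving n is exact on the families of interest, whose support has at most m =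
  |\<beta>| elements.\<close>

definition fdb_enum ::
    "nat \<Rightarrow> ('d::{finite,linorder} mindex \<Rightarrow> 'd mindex) \<Rightarrow> (nat \<Rightarrow> 'd mindex) \<times> (nat \<Rightarrow> 'd mindex)" where
  "fdb_enum m \<kappa> =
     (let xs = linorder.sorted_list_of_set (\<lambda>\<alpha> \<beta>. \<alpha> = \<beta> \<or> mi_prec \<alpha> \<beta>) {v. \<kappa> v \<noteq> 0};
          n = m - length xs;
          l = (\<lambda>j. if j \<in> {1..n} then 0 else if j \<in> {n+1..m} then xs ! (j - (n+1)) else undefined)
      in ((\<lambda>j. if j \<in> {1..n} then 0 else if j \<in> {n+1..m} then \<kappa> (l j) else undefined), l))"

text \<open>Conversely, \<kappa> is read off from the part of the lists after the padding. The
  second claim carries over any product whose factors are 1 at k = 0.\<close>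

lemma fdb_set_reindex:
  fixes \<beta> \<mu> :: "'d::{finite,linorder} mindex"
  assumes "\<beta> \<noteq> 0" and L: "L = {l. l \<noteq> 0 \<and> l \<le> \<beta>}"
  shows "bij_betw (fdb_enum (mi_abs \<beta>)) (fdb_families L \<beta> \<mu>) (fdb_set \<beta> \<mu>)"
    and "\<kappa> \<in> fdb_families L \<beta> \<mu> \<Longrightarrow> fdb_enum (mi_abs \<beta>) \<kappa> = (k, l) \<Longrightarrow> (\<And>v. W 0 v = (1::real)) \<Longrightarrow>
      (\<Prod>j\<in>{1..mi_abs \<beta>}. W (k j) (l j)) = (\<Prod>v\<in>L. W (\<kappa> v) v)"
proof -
  define m where "m = mi_abs \<beta>"
  have fL: "finite L" using finite_mindex_le[of \<beta>] by (auto simp: L elim: rev_finite_subset)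
  interpret ord: linorder "\<lambda>\<alpha> \<beta> :: 'd mindex. \<alpha> = \<beta> \<or> mi_prec \<alpha> \<beta>" mi_prec
    by (rule mi_prec_linorder)
  have transp: "transp (mi_prec :: 'd mindex \<Rightarrow> _)" using ord.less_trans by (rule transpI)
  define xs where "xs \<kappa> = ord.sorted_list_of_set {v. \<kappa> v \<noteq> 0}" for \<kappa> :: "'d mindex \<Rightarrow> 'd mindex"
  have enum_eq: "fdb_enum m \<kappa> =
      ((\<lambda>j. if j \<in> {1..m - length (xs \<kappa>)} then 0 else if j \<in> {m - length (xs \<kappa>) + 1..m}
            then \<kappa> (xs \<kappa> ! (j - (m - length (xs \<kappa>) + 1))) else undefined),
       (\<lambda>j. if j \<in> {1..m - length (xs \<kappa>)} then 0 else if j \<in> {m - length (xs \<kappa>) + 1..m}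
            then xs \<kappa> ! (j - (m - length (xs \<kappa>) + 1)) else undefined))" for \<kappa>
    by (auto simp: fdb_enum_def Let_def xs_def)
  have enum: "\<exists>s. s \<in> {1..m} \<and> bij_betw l {m-s+1..m} {v\<in>L. \<kappa> v \<noteq> 0} \<and>
      (\<forall>j\<in>{1..m-s}. k j = 0 \<and> l j = 0) \<and> (\<forall>j\<in>{m-s+1..m}. k j = \<kappa> (l j)) \<and>
      (\<forall>j\<in>{m-s+1..<m}. mi_prec (l j) (l (j+1))) \<and> k \<in> extensional {1..m} \<and> l \<in> extensional {1..m}"
    if \<kappa>: "\<kappa> \<in> fdb_families L \<beta> \<mu>" and kl: "fdb_enum m \<kappa> = (k, l)" for \<kappa> k l
  proof -
    define S where "S = {v\<in>L. \<kappa> v \<noteq> 0}"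
    have S: "{v. \<kappa> v \<noteq> 0} = S" "finite S"
      using \<kappa> fL by (auto simp: S_def fdb_families_def)
    define s where "s = length (xs \<kappa>)"
    have xs: "sorted_wrt mi_prec (xs \<kappa>)" "set (xs \<kappa>) = S" "distinct (xs \<kappa>)"
      using ord.strict_sorted_list_of_set[of S] ord.set_sorted_list_of_set[of S]
        ord.distinct_sorted_list_of_set[of S] S by (simp_all add: xs_def)
    then have card: "s = card S" by (simp add: s_def distinct_card flip: xs(2))
    have s1: "s \<noteq> 0"
    proof
      assume "s = 0"
      then have "\<forall>v\<in>L. \<kappa> v = 0" using card S by (auto simp: S_def)
      then show False using \<kappa> \<open>\<beta> \<noteq> 0\<close> by (auto simp: fdb_families_def)
    qed
    \<comment> \<open>Each l in the support contributes at least 1 to |\<beta>|, so there is room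
      for all of them.\<close>
    have sm: "s \<le> m"
    proof -
      have "1 \<le> mi_abs (\<kappa> v) * mi_abs v" if "v \<in> S" for v
        using that by (simp add: S_def L Suc_le_eq neq0_conv[symmetric] del: neq0_conv)
      then have "s \<le> (\<Sum>v\<in>S. mi_abs (\<kappa> v) * mi_abs v)"
        unfolding card using sum_mono[of S "\<lambda>_. 1" "\<lambda>v. mi_abs (\<kappa> v) * mi_abs v"] by simp
      also have "\<dots> \<le> (\<Sum>v\<in>L. mi_abs (\<kappa> v) * mi_abs v)"
        by (rule sum_mono2) (auto simp: fL S_def)
      also have "\<dots> = m"
        using \<kappa> by (auto simp: m_def fdb_families_def mi_abs_sum mi_abs_smult)
      finally show ?thesis .
    qed
    have k: "k = (\<lambda>j. if j \<in> {1..m-s} then 0 else if j \<in> {m-s+1..m}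
        then \<kappa> (xs \<kappa> ! (j - (m-s+1))) else undefined)"
      and l: "l = (\<lambda>j. if j \<in> {1..m-s} then 0 else if j \<in> {m-s+1..m}
        then xs \<kappa> ! (j - (m-s+1)) else undefined)"
      using kl[unfolded enum_eq] by (auto simp: s_def)
    have "bij_betw (\<lambda>j. j - (m-s+1)) {m-s+1..m} {..<s}"
      by (rule bij_betw_byWitness[where f' = "\<lambda>i. i + (m-s+1)"]) (use sm in auto)
    moreover have "bij_betw ((!) (xs \<kappa>)) {..<s} S"
      using xs by (intro bij_betw_nth) (auto simp: s_def)
    ultimately have "bij_betw ((!) (xs \<kappa>) \<circ> (\<lambda>j. j - (m-s+1))) {m-s+1..m} S"
      by (rule bij_betw_trans)
    then have "bij_betw l {m-s+1..m} S"
      by (rule bij_betw_cong[THEN iffD1, rotated]) (auto simp: l)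
    moreover have "\<forall>j\<in>{m-s+1..<m}. mi_prec (l j) (l (j+1))"
    proof
      fix j assume j: "j \<in> {m-s+1..<m}"
      then have "mi_prec (xs \<kappa> ! (j - (m-s+1))) (xs \<kappa> ! (j + 1 - (m-s+1)))"
        using sm xs(1) by (intro sorted_wrt_nth_less[of mi_prec]) (auto simp: s_def[symmetric])
      then show "mi_prec (l j) (l (j+1))" using j by (simp add: l)
    qed
    moreover have "k \<in> extensional {1..m}" "l \<in> extensional {1..m}"
      by (auto simp: k l extensional_def)
    ultimately show ?thesis
      using s1 sm unfolding S_def[symmetric] by (intro exI[of _ s]) (auto simp: k l)
  qed
  show "(\<Prod>j\<in>{1..mi_abs \<beta>}. W (k j) (l j)) = (\<Prod>v\<in>L. W (\<kappa> v) v)"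
    if \<kappa>: "\<kappa> \<in> fdb_families L \<beta> \<mu>" and kl: "fdb_enum (mi_abs \<beta>) \<kappa> = (k, l)" and W: "\<And>v. W 0 v = (1::real)"
  proof -
    obtain s where "s \<in> {1..m}" "bij_betw l {m-s+1..m} {v\<in>L. \<kappa> v \<noteq> 0}"
      "\<forall>j\<in>{1..m-s}. k j = 0 \<and> l j = 0" "\<forall>j\<in>{m-s+1..m}. k j = \<kappa> (l j)"
      using enum[OF \<kappa> kl[folded m_def]] by blast
    then show ?thesis
      unfolding m_def[symmetric] using fL W
      by (intro prod.enumerate_support[where s = s]) auto
  qed
  show "bij_betw (fdb_enum (mi_abs \<beta>)) (fdb_families L \<beta> \<mu>) (fdb_set \<beta> \<mu>)"
    unfolding m_def[symmetric] bij_betw_def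
  proof (intro conjI inj_onI subset_antisym subsetI)
    fix \<kappa> \<kappa>' assume \<kappa>: "\<kappa> \<in> fdb_families L \<beta> \<mu>" "\<kappa>' \<in> fdb_families L \<beta> \<mu>"
      and eq: "fdb_enum m \<kappa> = fdb_enum m \<kappa>'"
    obtain k l where kl: "fdb_enum m \<kappa> = (k, l)" by (rule prod.exhaust)
    \<comment> \<open>The support sizes s and s' are not known to agree. But
      \<open>k j \<noteq> 0\<close> already shows that j lies beyond the padding of the second
      family too, so both values at v are \<open>k j\<close>.\<close>
    have sub: "\<kappa>2 v = \<kappa>1 v" if \<kappa>12: "\<kappa>1 \<in> fdb_families L \<beta> \<mu>" "\<kappa>2 \<in> fdb_families L \<beta> \<mu>"
      "fdb_enum m \<kappa>1 = (k, l)" "fdb_enum m \<kappa>2 = (k, l)" and v: "\<kappa>1 v \<noteq> 0" for \<kappa>1 \<kappa>2 v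
    proof -
      obtain s where s: "bij_betw l {m-s+1..m} {v\<in>L. \<kappa>1 v \<noteq> 0}" "\<forall>j\<in>{m-s+1..m}. k j = \<kappa>1 (l j)"
        using enum[OF \<kappa>12(1,3)] by blast
      obtain s' where s': "\<forall>j\<in>{1..m-s'}. k j = 0" "\<forall>j\<in>{m-s'+1..m}. k j = \<kappa>2 (l j)"
        using enum[OF \<kappa>12(2,4)] by blast
      have "v \<in> L" using v \<kappa>12(1) by (auto simp: fdb_families_def)
      then obtain j where j: "j \<in> {m-s+1..m}" "v = l j"
        using s(1) v unfolding bij_betw_def by blast
      then have "k j \<noteq> 0" using s(2) v by auto
      then have "j \<in> {m-s'+1..m}" using s'(1) j(1) by (cases "j \<le> m - s'") auto
      then show ?thesis using s'(2) s(2) j by metis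
    qed
    have "\<kappa> v = \<kappa>' v" for v
      using sub[OF \<kappa> kl kl[unfolded eq], of v] sub[OF \<kappa>(2,1) kl[unfolded eq] kl, of v] by metis
    then show "\<kappa> = \<kappa>'" by blast
  next
    fix z assume "z \<in> fdb_enum m ` fdb_families L \<beta> \<mu>"
    then obtain \<kappa> where \<kappa>: "\<kappa> \<in> fdb_families L \<beta> \<mu>" and z: "z = fdb_enum m \<kappa>" by blast
    obtain k l where kl: "fdb_enum m \<kappa> = (k, l)" by (rule prod.exhaust)
    obtain s where s: "s \<in> {1..m}" "bij_betw l {m-s+1..m} {v\<in>L. \<kappa> v \<noteq> 0}"
      "\<forall>j\<in>{1..m-s}. k j = 0 \<and> l j = 0" "\<forall>j\<in>{m-s+1..m}. k j = \<kappa> (l j)"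
      "\<forall>j\<in>{m-s+1..<m}. mi_prec (l j) (l (j+1))" "k \<in> extensional {1..m}" "l \<in> extensional {1..m}"
      using enum[OF \<kappa> kl] by blast
    have mem: "l j \<in> L" "\<kappa> (l j) \<noteq> 0" if "j \<in> {m-s+1..m}" for j
      using bij_betwE[OF s(2)] that by auto
    have "(\<Sum>j\<in>{1..m}. k j) = \<mu>"
      using sum.enumerate_support[OF fL _ s(2), of k "\<lambda>a b. a"] s \<kappa> by (auto simp: fdb_families_def)
    moreover have "(\<Sum>j\<in>{1..m}. mi_abs (k j) *s l j) = \<beta>"
      using sum.enumerate_support[OF fL _ s(2), of k "\<lambda>a b. mi_abs a *s b"] s \<kappa>
      by (auto simp: fdb_families_def)
    moreover have "\<forall>j\<in>{m-s+1..m}. mi_abs (k j) > 0"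
      using s(4) mem by (metis mi_abs_eq_0_iff neq0_conv)
    moreover have "m-s+1 \<in> {m-s+1..m}" using s(1) by auto
    then have "mi_prec 0 (l (m-s+1))"
      using mem(1) by (auto simp: mi_prec_0_iff L)
    ultimately show "z \<in> fdb_set \<beta> \<mu>"
      using s \<open>\<beta> \<noteq> 0\<close> unfolding z kl fdb_set_def Let_def m_def[symmetric] by auto
  next
    fix z assume z: "z \<in> fdb_set \<beta> \<mu>"
    obtain k l where kl: "z = (k, l)" by (rule prod.exhaust)
    obtain s where ext: "k \<in> extensional {1..m}" "l \<in> extensional {1..m}" and s: "s \<in> {1..m}"
      and low: "\<And>j. j \<in> {1..m-s} \<Longrightarrow> k j = 0 \<and> l j = 0"
      and pos: "\<And>j. j \<in> {m-s+1..m} \<Longrightarrow> mi_abs (k j) > 0"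
      and first: "mi_prec 0 (l (m-s+1))"
      and chain: "\<And>j. j \<in> {m-s+1..<m} \<Longrightarrow> mi_prec (l j) (l (j+1))"
      and sum\<mu>: "(\<Sum>j\<in>{1..m}. k j) = \<mu>" and sum\<beta>: "(\<Sum>j\<in>{1..m}. mi_abs (k j) *s l j) = \<beta>"
      using z \<open>\<beta> \<noteq> 0\<close> unfolding kl fdb_set_def Let_def m_def[symmetric] by (auto split: if_splits)
    \<comment> \<open>A strictly increasing list is the sorted list of its own set; once
      \<open>set ys\<close> is the support of \<kappa>, \<open>fdb_enum\<close> returns the given
      lists.\<close>
    define ys where "ys = map l [m-s+1..<m+1]"
    have len: "length ys = s" using s by (auto simp: ys_def)
    have nth: "ys ! i = l (m-s+1+i)" if "i < s" for i
      using that s by (auto simp: ys_def simp del: upt_Suc)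
    have "sorted_wrt mi_prec ys"
    proof (subst sorted_wrt_iff_nth_Suc_transp[OF transp], intro allI impI)
      fix i assume "Suc i < length ys"
      then show "mi_prec (ys ! i) (ys ! Suc i)"
        using chain[of "m-s+1+i"] s len by (simp add: nth)
    qed
    then have sorted: "ord.sorted_list_of_set (set ys) = ys" and dist: "distinct ys"
      using ord.strict_sorted_equal[of "ord.sorted_list_of_set (set ys)" ys]
        ord.strict_sorted_list_of_set[of "set ys"] ord.set_sorted_list_of_set[of "set ys"]
        ord.strict_sorted_iff by auto
    have l_ys: "l j = ys ! (j - (m-s+1))" if "j \<in> {m-s+1..m}" for j
      using that s nth[of "j - (m-s+1)"] by auto
    have bij: "bij_betw l {m-s+1..m} (set ys)"
    proof -
      have "inj_on l (set [m-s+1..<m+1])" "set ys = l ` set [m-s+1..<m+1]"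
        using dist by (simp_all only: ys_def distinct_map set_map)
      moreover have "set [m-s+1..<m+1] = {m-s+1..m}" by auto
      ultimately show ?thesis by (simp only: bij_betw_def)
    qed
    have ne0: "l j \<noteq> 0" if j: "j \<in> {m-s+1..m}" for j
    proof (cases "j = m-s+1")
      case False
      then have "mi_prec (ys ! 0) (ys ! (j - (m-s+1)))"
        using \<open>sorted_wrt mi_prec ys\<close> j len s by (intro sorted_wrt_nth_less[of mi_prec ys]) auto
      then have "mi_prec (l (m-s+1)) (l j)"
        using l_ys[OF j] nth[of 0] s by simp
      then show ?thesis using first ord.less_trans mi_prec_0_iff by blast
    qed (use first in \<open>simp add: mi_prec_0_iff\<close>)
    have inL: "l j \<in> L" if j: "j \<in> {m-s+1..m}" for j
    proof -
      have "l j \<le> mi_abs (k j) *s l j" using pos[OF j] by (auto simp: less_eq_vec_def)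
      also have "\<dots> \<le> \<beta>"
        unfolding sum\<beta>[symmetric] using j by (intro member_le_sum_mindex[of _ j "\<lambda>j. mi_abs (k j) *s l j"]) auto
      finally show ?thesis using ne0[OF j] by (simp add: L)
    qed
    \<comment> \<open>The entries of l after the padding are distinct, so inverting l there assigns
      to each of them its own k_j.\<close>
    define \<kappa> where "\<kappa> v = (if v \<in> set ys then k (inv_into {m-s+1..m} l v) else 0)" for v
    have \<kappa>l: "\<kappa> (l j) = k j" if j: "j \<in> {m-s+1..m}" for j
      using bij_betw_apply[OF bij j] bij_betw_inv_into_left[OF bij j] by (simp add: \<kappa>_def)
    have supp: "{v. \<kappa> v \<noteq> 0} = set ys"
    proof -
      have "\<kappa> v \<noteq> 0" if "v \<in> set ys" for v
      proof -
        have "v \<in> l ` {m-s+1..m}" using that bij_betw_imp_surj_on[OF bij] by simp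
        then obtain j where j: "j \<in> {m-s+1..m}" "v = l j" by (rule imageE)
        then show ?thesis using \<kappa>l[OF j(1)] pos[OF j(1)] by auto
      qed
      then show ?thesis by (auto simp: \<kappa>_def)
    qed
    have ysL: "set ys \<subseteq> L"
      unfolding bij_betw_imp_surj_on[OF bij, symmetric] using inL by (rule image_subsetI)
    then have supp': "{v\<in>L. \<kappa> v \<noteq> 0} = set ys"
      using supp by (metis (mono_tags, lifting) Collect_cong mem_Collect_eq subsetD)
    have "(\<Sum>v\<in>L. \<kappa> v) = \<mu>"
      unfolding sum\<mu>[symmetric]
      by (rule sum.enumerate_support[OF fL _ bij[folded supp'], of k "\<lambda>a b. a", symmetric])
        (use s low \<kappa>l in auto)
    moreover have "(\<Sum>v\<in>L. mi_abs (\<kappa> v) *s v) = \<beta>"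
      unfolding sum\<beta>[symmetric]
      by (rule sum.enumerate_support[OF fL _ bij[folded supp'], of k "\<lambda>a b. mi_abs a *s b", symmetric])
        (use s low \<kappa>l in auto)
    moreover have "\<forall>v. v \<notin> L \<longrightarrow> \<kappa> v = 0" using supp ysL by auto
    ultimately have \<kappa>: "\<kappa> \<in> fdb_families L \<beta> \<mu>" by (simp add: fdb_families_def)
    have xs: "xs \<kappa> = ys" unfolding xs_def supp sorted ..
    have out: "k j = undefined \<and> l j = undefined" if "j \<notin> {1..m-s}" "j \<notin> {m-s+1..m}" for j
      using ext that s by (auto simp: extensional_def)
    have "(\<lambda>j. if j \<in> {1..m-s} then 0 else if j \<in> {m-s+1..m} then \<kappa> (ys ! (j - (m-s+1))) else undefined) = k"
    proof
      show "(if j \<in> {1..m-s} then 0 else if j \<in> {m-s+1..m} then \<kappa> (ys ! (j - (m-s+1))) else undefined) = k j" for j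
        using low[of j] \<kappa>l[of j] l_ys[of j] out[of j] by metis
    qed
    moreover have "(\<lambda>j. if j \<in> {1..m-s} then 0 else if j \<in> {m-s+1..m} then ys ! (j - (m-s+1)) else undefined) = l"
    proof
      show "(if j \<in> {1..m-s} then 0 else if j \<in> {m-s+1..m} then ys ! (j - (m-s+1)) else undefined) = l j" for j
        using low[of j] l_ys[of j] out[of j] by metis
    qed
    ultimately have "fdb_enum m \<kappa> = (k, l)"
      unfolding enum_eq xs len by simp
    then show "z \<in> fdb_enum m ` fdb_families L \<beta> \<mu>" using \<kappa> unfolding kl by (metis imageI)
  qed
qed

section \<open>The formula of Faa di Bruno\<close>

context
  fixes G :: "'d::{finite,linorder} \<Rightarrow> nat \<Rightarrow> real \<Rightarrow> real"
  assumes G: "\<And>i n t. (G i n has_real_derivative G i (Suc n) t) (at t)"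
begin

text \<open>\<open>G i n\<close> plays the n-th derivative of a function of the i-th coordinate, so
  a partial derivative of the product merely raises one index. Taylor monomials and the
  polynomial-Gaussian test functions both have this form.\<close>

lemma has_derivative_separable:
  "((\<lambda>z. \<Prod>i\<in>UNIV. G i (n $ i) (z $ i)) has_derivative
     (\<lambda>h. \<Sum>i\<in>UNIV. h $ i * G i (Suc (n $ i)) (z $ i) * (\<Prod>j\<in>UNIV - {i}. G j (n $ j) (z $ j)))) (at z)"
proof (rule has_derivative_prod)
  fix i
  have "(G i (n $ i) has_derivative (\<lambda>h. h * G i (Suc (n $ i)) (z $ i))) (at (z $ i))"
    using G[of i "n $ i" "z $ i"] by (simp add: has_field_derivative_def mult_commute_abs)
  moreover have "((\<lambda>z. z $ i) has_derivative (\<lambda>h. h $ i)) (at z)"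
    using bounded_linear_imp_has_derivative[OF bounded_linear_vec_nth] .
  ultimately show "((\<lambda>z. G i (n $ i) (z $ i)) has_derivative (\<lambda>h. h $ i * G i (Suc (n $ i)) (z $ i))) (at z)"
    using has_derivative_compose by blast
qed

lemma pderiv_at_separable:
  "pderiv_at j (\<lambda>z. \<Prod>i\<in>UNIV. G i (n $ i) (z $ i)) = (\<lambda>z. \<Prod>i\<in>UNIV. G i ((n + mi_unit j) $ i) (z $ i))"
proof
  fix z :: "'d rvec"
  have "pderiv_at j (\<lambda>z. \<Prod>i\<in>UNIV. G i (n $ i) (z $ i)) z =
      (\<Sum>i\<in>UNIV. axis j (1::real) $ i *\<^sub>R (G i (Suc (n $ i)) (z $ i) * (\<Prod>j\<in>UNIV - {i}. G j (n $ j) (z $ j))))"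
    unfolding pderiv_at_eq[OF has_derivative_separable] by (simp add: mult.assoc)
  also have "\<dots> = G j (Suc (n $ j)) (z $ j) * (\<Prod>i\<in>UNIV - {j}. G i (n $ i) (z $ i))"
    by (rule sum_axis_scaleR)
  also have "(\<Prod>i\<in>UNIV - {j}. G i (n $ i) (z $ i)) = (\<Prod>i\<in>UNIV - {j}. G i ((n + mi_unit j) $ i) (z $ i))"
    by (rule prod.cong) (auto simp: mi_unit_nth)
  finally show "pderiv_at j (\<lambda>z. \<Prod>i\<in>UNIV. G i (n $ i) (z $ i)) z =
      (\<Prod>i\<in>UNIV. G i ((n + mi_unit j) $ i) (z $ i))"
    by (simp add: prod.remove[of UNIV j] mi_unit_nth)
qed

lemma Cinf_separable: "Cinf (\<lambda>z. \<Prod>i\<in>UNIV. G i (n $ i) (z $ i))"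
proof -
  have d: "(\<lambda>z. \<Prod>i\<in>UNIV. G i (n $ i) (z $ i)) differentiable_on UNIV" for n
    using has_derivative_separable by (intro differentiable_on_UNIV_I exI)
  have "Ck k (\<lambda>z. \<Prod>i\<in>UNIV. G i (n $ i) (z $ i))" for k
    by (induction k arbitrary: n)
       (simp_all only: Ck.simps pderiv_at_separable d differentiable_imp_continuous_on[OF d] simp_thms)
  then show ?thesis by (simp add: Cinf_def)
qed

lemma mderiv_separable:
  "mderiv \<nu> (\<lambda>z. \<Prod>i\<in>UNIV. G i (n $ i) (z $ i)) = (\<lambda>z. \<Prod>i\<in>UNIV. G i ((n + \<nu>) $ i) (z $ i))"
proof (induction \<nu> rule: mindex_induct)
  case (Suc \<nu> j)
  then show ?case
    by (simp only: mderiv_Suc[OF Cinf_separable] pderiv_at_separable add.assoc)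
qed simp

end

definition monomial_at :: "'d::finite rvec \<Rightarrow> 'd mindex \<Rightarrow> 'd rvec \<Rightarrow> real" where
  "monomial_at y \<mu> z = (\<Prod>i\<in>UNIV. (z $ i - y $ i) ^ (\<mu> $ i) / fact (\<mu> $ i))"

lemma
  fixes y :: "'d::{finite,linorder} rvec"
  shows Cinf_monomial_at: "Cinf (monomial_at y \<mu>)"
    and mderiv_monomial_at: "mderiv \<nu> (monomial_at y \<mu>) y = (if \<nu> = \<mu> then 1 else 0)"
proof -
  \<comment> \<open>Without the case distinction the truncated exponent would leave the constant 1
    after more than \<mu>_i derivatives instead of 0.\<close>
  define G where "G i n t = (if n \<le> \<mu> $ i then (t - y $ i) ^ (\<mu> $ i - n) / fact (\<mu> $ i - n) else 0)" for i n t
  have G: "(G i n has_real_derivative G i (Suc n) t) (at t)" for i n t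
  proof -
    consider "n > \<mu> $ i" | "n = \<mu> $ i" | m where "\<mu> $ i - n = Suc m" "\<mu> $ i - Suc n = m" "n < \<mu> $ i"
      by (metis Suc_diff_Suc linorder_neqE_nat)
    then show ?thesis
    proof cases
      case 3
      have "((\<lambda>t. t - y $ i) has_real_derivative 1) (at t)"
        by (auto intro!: derivative_eq_intros)
      from DERIV_cdivide[OF DERIV_power[OF this, of "Suc m"], of "fact (Suc m)"]
      have "((\<lambda>t. (t - y $ i) ^ Suc m / fact (Suc m)) has_real_derivative
          real (Suc m) * (t - y $ i) ^ m / fact (Suc m)) (at t)"
        by (simp del: of_nat_Suc fact_Suc power_Suc)
      then show ?thesis using 3 by (simp add: G_def[abs_def] fact_Suc del: of_nat_Suc)
    qed (auto simp: G_def[abs_def])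
  qed
  have eq: "monomial_at y \<mu> = (\<lambda>z. \<Prod>i\<in>UNIV. G i (0 $ i) (z $ i))"
    by (simp add: G_def monomial_at_def fun_eq_iff)
  show "Cinf (monomial_at y \<mu>)"
    unfolding eq by (rule Cinf_separable[of G]) (rule G)
  have "mderiv \<nu> (monomial_at y \<mu>) y = (\<Prod>i\<in>UNIV. G i ((0 + \<nu>) $ i) (y $ i))"
    unfolding eq using mderiv_separable[of G, OF G] by metis
  also have "\<dots> = (\<Prod>i\<in>UNIV. if \<nu> $ i = \<mu> $ i then 1 else 0)"
    by (rule prod.cong) (auto simp: G_def)
  also have "\<dots> = (if \<nu> = \<mu> then 1 else 0)"
    by (auto simp: vec_eq_iff intro!: prod_zero)
  finally show "mderiv \<nu> (monomial_at y \<mu>) y = (if \<nu> = \<mu> then 1 else 0)" .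
qed

lemma monomial_at_self:
  fixes y :: "'d::{finite,linorder} rvec"
  shows "monomial_at y \<mu> y = (if \<mu> = 0 then 1 else 0)"
  using mderiv_monomial_at[of 0 y \<mu>] by (cases "\<mu> = 0") auto

lemma mi_fact_binom:
  assumes "\<beta> \<le> \<alpha>"
  shows "mi_binom \<alpha> \<beta> * mi_fact \<beta> * mi_fact (\<alpha> - \<beta>) = mi_fact \<alpha>"
proof -
  have "mi_binom \<alpha> \<beta> * mi_fact \<beta> * mi_fact (\<alpha> - \<beta>) =
      (\<Prod>i\<in>UNIV. fact (\<beta> $ i) * fact (\<alpha> $ i - \<beta> $ i) * (\<alpha> $ i choose \<beta> $ i))"
    by (simp add: mi_binom_def mi_fact_def prod.distrib mult_ac)
  also have "\<dots> = mi_fact \<alpha>"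
    unfolding mi_fact_def using assms binomial_fact_lemma
    by (intro prod.cong) (auto simp: less_eq_vec_def)
  finally show ?thesis .
qed

lemma mi_fact_pos: "mi_fact \<alpha> > 0"
  by (simp add: mi_fact_def prod_pos)

text \<open>A monomial of index \<mu> + e_j is, up to the factor \<mu>_j + 1, the function
  \<theta>_j - \<theta>_j(x) times the monomial of index \<mu>. The Leibniz rule for this product is
  \<open>fdb_sum_rec\<close>. The condition on L passes from \<beta> to \<beta> - l, which allows a
  single L throughout the induction.\<close>

lemma mderiv_monomial_compose:
  fixes \<theta> :: "'d::{finite,linorder} rvec \<Rightarrow> 'd rvec"
  assumes \<theta>: "Cinf \<theta>" and L: "finite L" "0 \<notin> L" "{l. l \<noteq> 0 \<and> l \<le> \<beta>} \<subseteq> L"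
  shows "mderiv \<beta> (\<lambda>x'. monomial_at (\<theta> x) \<mu> (\<theta> x')) x =
    real (mi_fact \<beta>) * fdb_sum (\<lambda>l j. mderiv l (\<lambda>y. \<theta> y $ j) x / real (mi_fact l)) L \<beta> \<mu>"
  using L(3)
proof (induction \<mu> arbitrary: \<beta> rule: mindex_induct)
  case 0
  have "(\<lambda>x'. monomial_at (\<theta> x) 0 (\<theta> x')) = (\<lambda>x'. 1)"
    by (simp add: monomial_at_def)
  moreover have "mi_fact (0 :: 'd mindex) = 1" by (simp add: mi_fact_def)
  ultimately show ?case using L(1) by (simp add: mderiv_const fdb_sum_base)
next
  case (Suc \<mu> j)
  let ?a = "\<lambda>l j. mderiv l (\<lambda>y. \<theta> y $ j) x / real (mi_fact l)"
  let ?M = "\<lambda>\<mu> x'. monomial_at (\<theta> x) \<mu> (\<theta> x')"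
  let ?u = "\<lambda>x'. \<theta> x' $ j - \<theta> x $ j"
  let ?\<mu> = "\<mu> + mi_unit j"
  have \<mu>j: "?\<mu> $ j = Suc (\<mu> $ j)" by (simp add: mi_unit_nth)
  have CM: "Cinf (?M \<mu>)" for \<mu> using Cinf_compose[OF Cinf_monomial_at \<theta>] .
  have Cu: "Cinf ?u" using Cinf_diff[OF Cinf_nth[OF \<theta>] Cinf_const] .
  have rec: "real (?\<mu> $ j) * ?M ?\<mu> x' = ?u x' * ?M \<mu> x'" for x'
  proof -
    let ?t = "\<lambda>\<mu> i. (\<theta> x' $ i - \<theta> x $ i) ^ (\<mu> $ i) / fact (\<mu> $ i) :: real"
    have "(\<Prod>i\<in>UNIV - {j}. ?t ?\<mu> i) = (\<Prod>i\<in>UNIV - {j}. ?t \<mu> i)"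
      by (rule prod.cong) (auto simp: mi_unit_nth)
    moreover have "real (?\<mu> $ j) * ?t ?\<mu> j = ?u x' * ?t \<mu> j"
      unfolding \<mu>j by (simp del: of_nat_Suc)
    ultimately show ?thesis
      unfolding monomial_at_def
      by (simp only: prod.remove[OF finite UNIV_I[of j]] mult.assoc[symmetric])
  qed
  have du: "mderiv l ?u x = (if l = 0 then 0 else mderiv l (\<lambda>y. \<theta> y $ j) x)" for l
    unfolding mderiv_diff[OF Cinf_nth[OF \<theta>] Cinf_const] by (simp add: mderiv_const)
  have "real (?\<mu> $ j) * mderiv \<beta> (?M ?\<mu>) x = mderiv \<beta> (\<lambda>x'. ?u x' * ?M \<mu> x') x"
    using mderiv_linear_compose[OF bounded_linear_mult_right[of "real (?\<mu> $ j)"] CM[of ?\<mu>], of \<beta>]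
    unfolding rec by metis
  also have "\<dots> = (\<Sum>l | l \<le> \<beta>. real (mi_binom \<beta> l) *\<^sub>R (mderiv l ?u x * mderiv (\<beta> - l) (?M \<mu>) x))"
    using bounded_bilinear.mderiv[OF bounded_bilinear_mult Cu CM[of \<mu>], of \<beta>] by metis
  \<comment> \<open>The term l = 0 disappears because \<theta>_j - \<theta>_j(x) vanishes at x. This
    is where freezing the centre pays off.\<close>
  also have "\<dots> = (\<Sum>l | l \<in> L \<and> l \<le> \<beta>. real (mi_binom \<beta> l) *\<^sub>R (mderiv l ?u x * mderiv (\<beta> - l) (?M \<mu>) x))"
    using Suc.prems by (intro sum.mono_neutral_right) (auto simp: finite_mindex_le du)
  also have "\<dots> = (\<Sum>l | l \<in> L \<and> l \<le> \<beta>. real (mi_fact \<beta>) * (?a l j * fdb_sum ?a L (\<beta> - l) \<mu>))"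
  proof (rule sum.cong)
    fix l assume l: "l \<in> {l. l \<in> L \<and> l \<le> \<beta>}"
    then have "l \<noteq> 0" using L(2) by auto
    have "\<beta> - l \<le> \<beta>" by (simp add: less_eq_vec_def)
    then have "{l'. l' \<noteq> 0 \<and> l' \<le> \<beta> - l} \<subseteq> L"
      using Suc.prems order_trans by blast
    then have IH: "mderiv (\<beta> - l) (?M \<mu>) x = real (mi_fact (\<beta> - l)) * fdb_sum ?a L (\<beta> - l) \<mu>"
      by (rule Suc.IH)
    \<comment> \<open>The binomial coefficient is traded for factorials: \<beta>! goes in front,
      1/l! into \<open>?a\<close>, and (\<beta> - l)! cancels against the induction
      hypothesis.\<close>
    have "real (mi_fact \<beta>) = real (mi_binom \<beta> l) * real (mi_fact l) * real (mi_fact (\<beta> - l))"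
      using mi_fact_binom[of l \<beta>] l by (simp flip: of_nat_mult)
    then show "real (mi_binom \<beta> l) *\<^sub>R (mderiv l ?u x * mderiv (\<beta> - l) (?M \<mu>) x) =
        real (mi_fact \<beta>) * (?a l j * fdb_sum ?a L (\<beta> - l) \<mu>)"
      using mi_fact_pos[of l] \<open>l \<noteq> 0\<close> by (simp add: IH du)
  qed simp
  also have "\<dots> = real (mi_fact \<beta>) * (real (?\<mu> $ j) * fdb_sum ?a L \<beta> ?\<mu>)"
  proof -
    have \<mu>: "?\<mu> - mi_unit j = \<mu>" by (simp add: vec_eq_iff)
    have "?\<mu> $ j > 0" using \<mu>j by simp
    from fdb_sum_rec[OF L(1) this, of ?a \<beta>] show ?thesis
      by (simp only: \<mu> sum_distrib_left)
  qed
  finally show ?case using \<mu>j by simp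
qed

lemma sum_fdb_set:
  fixes \<theta> :: "'d::{finite,linorder} rvec \<Rightarrow> 'd rvec"
  assumes \<theta>: "Cinf \<theta>"
  shows "(\<Sum>(k, l)\<in>fdb_set \<beta> \<mu>. real (mi_fact \<beta>) * (\<Prod>j\<in>{1..mi_abs \<beta>}.
      mderiv_pow \<theta> (l j) (k j) x / (real (mi_fact (k j)) * real (mi_fact (l j)) ^ mi_abs (k j)))) =
    mderiv \<beta> (\<lambda>x'. monomial_at (\<theta> x) \<mu> (\<theta> x')) x"
proof (cases "\<beta> = 0")
  case True
  have "fdb_set (0 :: 'd mindex) \<mu> = (if \<mu> = 0 then {(\<lambda>_. undefined, \<lambda>_. undefined)} else {})"
    by (auto simp: fdb_set_def Let_def extensional_def)
  then show ?thesis using True by (simp add: monomial_at_self mi_fact_def)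
next
  case False
  define W where "W k v = mderiv_pow \<theta> v k x / (real (mi_fact k) * real (mi_fact v) ^ mi_abs k)" for k v
  define L where "L = {l. l \<noteq> 0 \<and> l \<le> \<beta>}"
  define a where "a = (\<lambda>l j. mderiv l (\<lambda>y. \<theta> y $ j) x / real (mi_fact l))"
  have L: "finite L" "0 \<notin> L" "{l. l \<noteq> 0 \<and> l \<le> \<beta>} \<subseteq> L"
    using finite_mindex_le[of \<beta>] by (auto simp: L_def elim: rev_finite_subset)
  have W0: "W 0 v = 1" for v by (simp add: W_def mderiv_pow_def mi_fact_def)
  \<comment> \<open>Since |k| is the sum of the k_i, the power (v!)^|k| splits over the coordinates
    and each part joins its factor of \<open>mderiv_pow\<close>.\<close>
  have W: "W k v = (\<Prod>i\<in>UNIV. a v i ^ (k $ i) / fact (k $ i))" for k v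
    by (simp add: W_def a_def mderiv_pow_def mi_fact_def mi_abs_def power_sum prod_dividef
        power_divide prod.distrib mult.commute)
  let ?H = "\<lambda>(k, l). real (mi_fact \<beta>) * (\<Prod>j\<in>{1..mi_abs \<beta>}. W (k j) (l j))"
  have "sum ?H (fdb_set \<beta> \<mu>) = (\<Sum>\<kappa>\<in>fdb_families L \<beta> \<mu>. ?H (fdb_enum (mi_abs \<beta>) \<kappa>))"
    using sum.reindex_bij_betw[OF fdb_set_reindex(1)[OF False L_def], of ?H \<mu>] by simp
  also have "\<dots> = (\<Sum>\<kappa>\<in>fdb_families L \<beta> \<mu>. real (mi_fact \<beta>) * fdb_weight a L \<kappa>)"
  proof (rule sum.cong)
    fix \<kappa> assume \<kappa>: "\<kappa> \<in> fdb_families L \<beta> \<mu>"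
    obtain k l where kl: "fdb_enum (mi_abs \<beta>) \<kappa> = (k, l)" by (rule prod.exhaust)
    show "?H (fdb_enum (mi_abs \<beta>) \<kappa>) = real (mi_fact \<beta>) * fdb_weight a L \<kappa>"
      using fdb_set_reindex(2)[OF False L_def \<kappa> kl, of W, OF W0] by (simp add: kl fdb_weight_def W)
  qed simp
  also have "\<dots> = mderiv \<beta> (\<lambda>x'. monomial_at (\<theta> x) \<mu> (\<theta> x')) x"
    unfolding mderiv_monomial_compose[OF \<theta> L] by (simp add: fdb_sum_def sum_distrib_left a_def)
  finally show ?thesis by (simp add: W_def)
qed

text \<open>The Leibniz rule read backwards, once the indices with |\<beta>| < |\<mu>| have been put
  back; their terms are zero.\<close>

lemma Ffun_eq_mderiv:
  fixes \<theta> :: "'d::{finite,linorder} rvec \<Rightarrow> 'd rvec"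
  assumes \<theta>: "Cinf \<theta>" and \<eta>: "Cinf \<eta>"
  shows "Ffun \<alpha> \<mu> \<theta> \<eta> x = mderiv \<alpha> (\<lambda>x'. of_real (monomial_at (\<theta> x) \<mu> (\<theta> x')) * \<eta> x') x"
proof -
  let ?M = "\<lambda>x'. monomial_at (\<theta> x) \<mu> (\<theta> x')"
  have C: "Cinf ?M" using Cinf_compose[OF Cinf_monomial_at \<theta>] .
  have zero: "mderiv \<beta> ?M x = 0" if "mi_abs \<beta> < mi_abs \<mu>" for \<beta>
  proof -
    let ?L = "{l. l \<noteq> 0 \<and> l \<le> \<beta>}"
    have L: "finite ?L" "0 \<notin> ?L" "?L \<subseteq> ?L"
      using finite_mindex_le[of \<beta>] by (auto elim: rev_finite_subset)
    show ?thesis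
      unfolding mderiv_monomial_compose[OF \<theta> L] using fdb_sum_eq_0[OF L(1,2) that] by simp
  qed
  have "Ffun \<alpha> \<mu> \<theta> \<eta> x = (\<Sum>\<beta>\<in>{\<beta>. \<beta> \<le> \<alpha> \<and> mi_abs \<mu> \<le> mi_abs \<beta>}.
      of_nat (mi_binom \<alpha> \<beta>) * mderiv (\<alpha> - \<beta>) \<eta> x * of_real (mderiv \<beta> ?M x))"
    unfolding Ffun_def sum_fdb_set[OF \<theta>] ..
  also have "\<dots> = (\<Sum>\<beta> | \<beta> \<le> \<alpha>. of_nat (mi_binom \<alpha> \<beta>) * mderiv (\<alpha> - \<beta>) \<eta> x * of_real (mderiv \<beta> ?M x))"
  proof (rule sum.mono_neutral_left)
    show "\<forall>\<beta>\<in>{\<beta>. \<beta> \<le> \<alpha>} - {\<beta>. \<beta> \<le> \<alpha> \<and> mi_abs \<mu> \<le> mi_abs \<beta>}.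
        of_nat (mi_binom \<alpha> \<beta>) * mderiv (\<alpha> - \<beta>) \<eta> x * of_real (mderiv \<beta> ?M x) = 0"
      using zero by (simp add: not_le)
  qed (auto simp: finite_mindex_le)
  also have "\<dots> = (\<Sum>\<beta> | \<beta> \<le> \<alpha>. real (mi_binom \<alpha> \<beta>) *\<^sub>R
      (mderiv \<beta> (\<lambda>x'. of_real (?M x')) x * mderiv (\<alpha> - \<beta>) \<eta> x))"
    by (simp add: mderiv_linear_compose[OF bounded_linear_of_real C] scaleR_conv_of_real mult_ac)
  also have "\<dots> = mderiv \<alpha> (\<lambda>x'. of_real (?M x') * \<eta> x') x"
    by (simp add: bounded_bilinear.mderiv[OF bounded_bilinear_mult]
        Cinf_linear_compose[OF bounded_linear_of_real C] \<eta>)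
  finally show ?thesis .
qed

text \<open>A derivative falls either on \<eta>, or on f and thereby costs one order of flatness
  while the weight becomes \<eta> times a partial derivative of \<theta>. Both f and \<eta>
  therefore vary in the induction.\<close>

lemma mderiv_flat_compose:
  fixes \<theta> :: "'d::{finite,linorder} rvec \<Rightarrow> 'd rvec" and \<eta> f :: "'d rvec \<Rightarrow> complex"
  assumes "Cinf \<theta>" "Cinf \<eta>" "Cinf f" "\<And>\<mu>. mi_abs \<mu> \<le> mi_abs \<alpha> \<Longrightarrow> mderiv \<mu> f (\<theta> x) = 0"
  shows "mderiv \<alpha> (\<lambda>x'. f (\<theta> x') * \<eta> x') x = 0"
  using assms(2-)
proof (induction \<alpha> arbitrary: \<eta> f rule: mindex_induct)
  case 0
  then show ?case using "0.prems"(3)[of 0] by simp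
next
  case (Suc \<alpha> i)
  let ?g = "\<lambda>j x'. pderiv_at j f (\<theta> x') * (pderiv_at i (\<lambda>y. \<theta> y $ j) x' *\<^sub>R \<eta> x')"
  have C\<theta>: "Cinf (pderiv_at i (\<lambda>y. \<theta> y $ j))" for j
    using Cinf_pderiv_at[OF Cinf_nth[OF assms(1)]] .
  have C\<eta>: "Cinf (\<lambda>x'. pderiv_at i (\<lambda>y. \<theta> y $ j) x' *\<^sub>R \<eta> x')" for j
    using bounded_bilinear.Cinf[OF bounded_bilinear_scaleR C\<theta> Suc.prems(1)] .
  have Cg: "Cinf (?g j)" for j
    using Cinf_mult[OF Cinf_compose[OF Cinf_pderiv_at[OF Suc.prems(2)] assms(1)] C\<eta>] .
  have Cs: "Cinf (\<lambda>x'. \<Sum>j\<in>UNIV. ?g j x')" using Cg by (intro Cinf_sum) auto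
  have dS: "mderiv \<alpha> (\<lambda>x'. \<Sum>j\<in>UNIV. ?g j x') = (\<lambda>x'. \<Sum>j\<in>UNIV. mderiv \<alpha> (?g j) x')"
    by (rule mderiv_sum[OF finite Cg])
  have Cf: "Cinf (\<lambda>x'. f (\<theta> x'))" using Cinf_compose[OF Suc.prems(2) assms(1)] .
  have Ch: "Cinf (\<lambda>x'. f (\<theta> x') * pderiv_at i \<eta> x')"
    using Cinf_mult[OF Cf Cinf_pderiv_at[OF Suc.prems(1)]] .
  have "pderiv_at i (\<lambda>x'. f (\<theta> x') * \<eta> x') =
      (\<lambda>x'. (\<Sum>j\<in>UNIV. ?g j x') + f (\<theta> x') * pderiv_at i \<eta> x')"
    using Suc.prems assms(1) Cf
    by (simp add: bounded_bilinear.pderiv_at[OF bounded_bilinear_mult] pderiv_at_compose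
        Cinf_differentiable sum_distrib_left mult_ac add_ac)
  then have "mderiv (\<alpha> + mi_unit i) (\<lambda>x'. f (\<theta> x') * \<eta> x') x =
      (\<Sum>j\<in>UNIV. mderiv \<alpha> (?g j) x) + mderiv \<alpha> (\<lambda>x'. f (\<theta> x') * pderiv_at i \<eta> x') x"
    using mderiv_Suc'[OF Cinf_mult[OF Cf Suc.prems(1)], of \<alpha> i]
      mderiv_add[OF Cs Ch, of \<alpha>]
      dS
    by simp
  moreover have "mderiv \<alpha> (?g j) x = 0" for j
  proof (rule Suc.IH[OF C\<eta> Cinf_pderiv_at[OF Suc.prems(2)]])
    fix \<mu> :: "'d mindex" assume "mi_abs \<mu> \<le> mi_abs \<alpha>"
    then show "mderiv \<mu> (pderiv_at j f) (\<theta> x) = 0"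
      using Suc.prems(3)[of "\<mu> + mi_unit j"] by (simp add: mi_abs_add mderiv_Suc'[OF Suc.prems(2)])
  qed
  moreover have "mderiv \<alpha> (\<lambda>x'. f (\<theta> x') * pderiv_at i \<eta> x') x = 0"
    by (rule Suc.IH[OF Cinf_pderiv_at[OF Suc.prems(1)] Suc.prems(2)])
       (simp add: Suc.prems(3) mi_abs_add)
  ultimately show ?case by simp
qed

lemma faa_di_bruno:
  fixes \<theta> :: "'d::{finite,linorder} rvec \<Rightarrow> 'd rvec" and \<eta> f :: "'d rvec \<Rightarrow> complex"
  assumes \<theta>: "Cinf \<theta>" and \<eta>: "Cinf \<eta>" and f: "Cinf f"
  shows "mderiv \<alpha> (\<lambda>x'. \<eta> x' * f (\<theta> x')) x =
    (\<Sum>\<mu> | mi_abs \<mu> \<le> mi_abs \<alpha>. mderiv \<mu> f (\<theta> x) * Ffun \<alpha> \<mu> \<theta> \<eta> x)"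
proof -
  let ?I = "{\<mu> :: 'd mindex. mi_abs \<mu> \<le> mi_abs \<alpha>}"
  let ?P = "\<lambda>\<mu> z. complex_of_real (monomial_at (\<theta> x) \<mu> z)"
  let ?c = "\<lambda>\<mu>. mderiv \<mu> f (\<theta> x)"
  \<comment> \<open>The Taylor polynomial of f of degree |\<alpha>| at \<theta>(x).\<close>
  define T where "T = (\<lambda>z. \<Sum>\<mu>\<in>?I. ?c \<mu> * ?P \<mu> z)"
  have CP: "Cinf (?P \<mu>)" for \<mu>
    using Cinf_linear_compose[OF bounded_linear_of_real Cinf_monomial_at] .
  have CcP: "Cinf (\<lambda>z. ?c \<mu> * ?P \<mu> z)" for \<mu>
    using Cinf_linear_compose[OF bounded_linear_mult_right CP] .
  have CT: "Cinf T" unfolding T_def using CcP by (intro Cinf_sum finite_mi_abs_le)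
  have dP: "mderiv \<nu> (\<lambda>z. ?c \<mu> * ?P \<mu> z) (\<theta> x) = (if \<nu> = \<mu> then ?c \<mu> else 0)" for \<mu> \<nu>
    unfolding mderiv_linear_compose[OF bounded_linear_mult_right CP]
      mderiv_linear_compose[OF bounded_linear_of_real Cinf_monomial_at]
    by (simp add: mderiv_monomial_at)
  have dT: "mderiv \<nu> T (\<theta> x) = ?c \<nu>" if "\<nu> \<in> ?I" for \<nu>
    unfolding T_def mderiv_sum[OF finite_mi_abs_le CcP] dP
    using that by (simp add: finite_mi_abs_le)
  \<comment> \<open>R is \<eta> times the Taylor polynomial composed with \<theta>, expanded so that
    the \<alpha>-derivative of each summand at x is a multiple of some \<open>Ffun\<close>.\<close>
  define R where "R = (\<lambda>x'. \<Sum>\<mu>\<in>?I. ?c \<mu> * (?P \<mu> (\<theta> x') * \<eta> x'))"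
  have C1: "Cinf (\<lambda>x'. \<eta> x' * f (\<theta> x'))"
    using Cinf_mult[OF \<eta> Cinf_compose[OF f \<theta>]] .
  have C2: "Cinf (\<lambda>x'. ?P \<mu> (\<theta> x') * \<eta> x')" for \<mu>
    using Cinf_mult[OF Cinf_compose[OF CP \<theta>] \<eta>] .
  have C3: "Cinf (\<lambda>x'. ?c \<mu> * (?P \<mu> (\<theta> x') * \<eta> x'))" for \<mu>
    using Cinf_linear_compose[OF bounded_linear_mult_right C2] .
  have CR: "Cinf R" unfolding R_def using C3 by (intro Cinf_sum finite_mi_abs_le)
  have "mderiv \<alpha> (\<lambda>x'. (f (\<theta> x') - T (\<theta> x')) * \<eta> x') x = 0"
  proof (rule mderiv_flat_compose[OF \<theta> \<eta> Cinf_diff[OF f CT]])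
    fix \<mu> :: "'d mindex" assume "mi_abs \<mu> \<le> mi_abs \<alpha>"
    then show "mderiv \<mu> (\<lambda>x. f x - T x) (\<theta> x) = 0"
      using dT[of \<mu>] by (simp add: mderiv_diff[OF f CT])
  qed
  moreover have "(\<lambda>x'. (f (\<theta> x') - T (\<theta> x')) * \<eta> x') = (\<lambda>x'. \<eta> x' * f (\<theta> x') - R x')"
    by (simp add: T_def R_def fun_eq_iff algebra_simps sum_distrib_left)
  ultimately have "mderiv \<alpha> (\<lambda>x'. \<eta> x' * f (\<theta> x')) x = mderiv \<alpha> R x"
    using mderiv_diff[OF C1 CR, of \<alpha>] by simp
  also have "\<dots> = (\<Sum>\<mu>\<in>?I. ?c \<mu> * Ffun \<alpha> \<mu> \<theta> \<eta> x)"
    unfolding R_def mderiv_sum[OF finite_mi_abs_le C3] mderiv_linear_compose[OF bounded_linear_mult_right C2]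
      Ffun_eq_mderiv[OF \<theta> \<eta>] ..
  finally show ?thesis .
qed

section \<open>The Schwartz topology\<close>

lemma schwartz_norm_le_iff:
  "schwartz_norm p \<alpha> f \<le> ereal C \<longleftrightarrow> (\<forall>x. (1 + norm x) powr p * cmod (mderiv \<alpha> f x) \<le> C)"
  by (simp add: schwartz_norm_def SUP_le_iff)

lemma schwartz_norm_upper: "ereal ((1 + norm x) powr p * cmod (mderiv \<alpha> f x)) \<le> schwartz_norm p \<alpha> f"
  unfolding schwartz_norm_def by (rule SUP_upper) simp

lemma schwartz_norm_nonneg: "0 \<le> schwartz_norm p \<alpha> f"
  by (rule order_trans[OF _ schwartz_norm_upper[of 0]]) simp

lemma schwartz_norm_zero: "schwartz_norm p \<alpha> (\<lambda>x. 0) = 0"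
  by (simp add: schwartz_norm_def mderiv_const zero_ereal_def[symmetric])

lemma schwartz_norm_finite:
  assumes "f \<in> schwartz" "p > 0"
  shows "\<exists>C. schwartz_norm p \<alpha> f = ereal C"
proof (cases "schwartz_norm p \<alpha> f")
  case MInf
  then show ?thesis using schwartz_norm_nonneg[of p \<alpha> f] by simp
qed (use assms in \<open>auto simp: schwartz_def\<close>)

lemma schwartz_Cinf: "f \<in> schwartz \<Longrightarrow> Cinf f"
  by (simp add: schwartz_def)

lemma schwartzI:
  assumes "Cinf f" "\<And>p \<alpha>. p > 0 \<Longrightarrow> \<exists>C. schwartz_norm p \<alpha> f \<le> ereal C"
  shows "f \<in> schwartz"
proof -
  have "schwartz_norm p \<alpha> f < \<infinity>" if "p > 0" for p \<alpha>
    using assms(2)[OF that, of \<alpha>] by (metis le_less_trans less_ereal.simps(4))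
  then show ?thesis using assms(1) by (simp add: schwartz_def)
qed

lemma schwartz_norm_add:
  assumes "Cinf f" "Cinf g" "schwartz_norm p \<alpha> f \<le> ereal A" "schwartz_norm p \<alpha> g \<le> ereal B"
  shows "schwartz_norm p \<alpha> (\<lambda>x. f x + g x) \<le> ereal (A + B)"
  unfolding schwartz_norm_le_iff mderiv_add[OF assms(1,2)]
proof
  fix x
  have "(1 + norm x) powr p * cmod (mderiv \<alpha> f x + mderiv \<alpha> g x) \<le>
      (1 + norm x) powr p * (cmod (mderiv \<alpha> f x) + cmod (mderiv \<alpha> g x))"
    by (intro mult_left_mono norm_triangle_ineq) simp
  also have "\<dots> \<le> A + B"
    using assms(3,4) unfolding schwartz_norm_le_iff by (simp add: distrib_left add_mono)
  finally show "(1 + norm x) powr p * cmod (mderiv \<alpha> f x + mderiv \<alpha> g x) \<le> A + B" .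
qed

lemma schwartz_norm_mult_const:
  assumes "Cinf f" "schwartz_norm p \<alpha> f \<le> ereal A"
  shows "schwartz_norm p \<alpha> (\<lambda>x. c * f x) \<le> ereal (cmod c * A)"
  using assms(2) mult_left_mono[of _ A "cmod c"]
  unfolding schwartz_norm_le_iff mderiv_linear_compose[OF bounded_linear_mult_right assms(1)]
  by (simp add: norm_mult mult.left_commute)

lemma Cinf_mult_const: "Cinf f \<Longrightarrow> Cinf (\<lambda>x. c * (f x :: complex))"
  by (rule Cinf_mult[OF Cinf_const])

lemma schwartz_add: "f \<in> schwartz \<Longrightarrow> g \<in> schwartz \<Longrightarrow> (\<lambda>x. f x + g x) \<in> schwartz"
proof (rule schwartzI)
  fix p :: real and \<alpha> :: "'a mindex" assume *: "f \<in> schwartz" "g \<in> schwartz" "p > 0"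
  obtain A B where A: "schwartz_norm p \<alpha> f = ereal A" and B: "schwartz_norm p \<alpha> g = ereal B"
    using schwartz_norm_finite[OF *(1,3)] schwartz_norm_finite[OF *(2,3)] by blast
  have "schwartz_norm p \<alpha> (\<lambda>x. f x + g x) \<le> ereal (A + B)"
    using A B by (intro schwartz_norm_add schwartz_Cinf *) simp_all
  then show "\<exists>C. schwartz_norm p \<alpha> (\<lambda>x. f x + g x) \<le> ereal C" by blast
qed (simp add: Cinf_add schwartz_Cinf)

lemma schwartz_mult_const: "f \<in> schwartz \<Longrightarrow> (\<lambda>x. c * f x) \<in> schwartz"
proof (rule schwartzI)
  fix p :: real and \<alpha> :: "'a mindex" assume *: "f \<in> schwartz" "p > 0"
  obtain A where A: "schwartz_norm p \<alpha> f = ereal A"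
    using schwartz_norm_finite[OF *] by blast
  have "schwartz_norm p \<alpha> (\<lambda>x. c * f x) \<le> ereal (cmod c * A)"
    using A by (intro schwartz_norm_mult_const schwartz_Cinf *) simp
  then show "\<exists>C. schwartz_norm p \<alpha> (\<lambda>x. c * f x) \<le> ereal C" by blast
qed (simp add: Cinf_mult_const schwartz_Cinf)

lemma schwartz_diff: "f \<in> schwartz \<Longrightarrow> g \<in> schwartz \<Longrightarrow> (\<lambda>x. f x - g x) \<in> schwartz"
  using schwartz_add[of f "\<lambda>x. -1 * g x"] schwartz_mult_const[of g "-1"] by simp

lemma schwartz_zero: "(\<lambda>x. 0) \<in> schwartz"
  by (simp add: schwartz_def Cinf_const schwartz_norm_zero)

text \<open>For finite J with positive exponents these are basic neighbourhoods of f; singletons J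
  give the generators of the topology.\<close>

definition schwartz_ball ::
    "('d::{finite,linorder} rvec \<Rightarrow> complex) \<Rightarrow> (real \<times> 'd mindex) set \<Rightarrow> real \<Rightarrow> ('d rvec \<Rightarrow> complex) set" where
  "schwartz_ball f J \<epsilon> = {g \<in> schwartz. \<forall>(p, \<alpha>)\<in>J. schwartz_norm p \<alpha> (\<lambda>x. g x - f x) < ereal \<epsilon>}"

lemma schwartz_ball_subbasis: "schwartz_ball f {(p, \<alpha>)} \<epsilon> =
    {g \<in> schwartz. schwartz_norm p \<alpha> (\<lambda>x. g x - f x) < ereal \<epsilon>}"
  by (simp add: schwartz_ball_def)

lemma schwartz_topology_eq:
  "schwartz_topology = topology_generated_by
     {schwartz_ball f {(p, \<alpha>)} \<epsilon> | f p \<alpha> \<epsilon>. f \<in> schwartz \<and> p > 0 \<and> \<epsilon> > 0}"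
  unfolding schwartz_topology_def schwartz_ball_subbasis ..

lemma schwartz_ball_mono:
  assumes "J' \<subseteq> J" "\<epsilon> \<le> \<epsilon>'"
  shows "schwartz_ball f J \<epsilon> \<subseteq> schwartz_ball f J' \<epsilon>'"
proof
  fix g assume g: "g \<in> schwartz_ball f J \<epsilon>"
  have "schwartz_norm p \<alpha> (\<lambda>x. g x - f x) < ereal \<epsilon>'" if "(p, \<alpha>) \<in> J'" for p \<alpha>
  proof -
    have "schwartz_norm p \<alpha> (\<lambda>x. g x - f x) < ereal \<epsilon>"
      using g that assms(1) by (auto simp: schwartz_ball_def)
    also have "\<dots> \<le> ereal \<epsilon>'" using assms(2) by simp
    finally show ?thesis .
  qed
  then show "g \<in> schwartz_ball f J' \<epsilon>'" using g by (auto simp: schwartz_ball_def)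
qed

lemma schwartz_ball_center:
  "f \<in> schwartz \<Longrightarrow> \<epsilon> > 0 \<Longrightarrow> f \<in> schwartz_ball f J \<epsilon>"
  by (auto simp: schwartz_ball_def schwartz_norm_zero)

lemma topspace_schwartz [simp]: "topspace schwartz_topology = schwartz"
  unfolding schwartz_topology_eq topology_generated_by_topspace
proof (intro subset_antisym subsetI)
  fix f :: "'a rvec \<Rightarrow> complex" assume f: "f \<in> schwartz"
  have "f \<in> schwartz_ball f {(1, 0)} 1" by (rule schwartz_ball_center[OF f]) simp
  then show "f \<in> \<Union> {schwartz_ball f {(p, \<alpha>)} \<epsilon> | f p \<alpha> \<epsilon>. f \<in> schwartz \<and> p > 0 \<and> \<epsilon> > 0}"
    using f zero_less_one by blast
next
  fix f :: "'a rvec \<Rightarrow> complex"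
  assume "f \<in> \<Union> {schwartz_ball f {(p, \<alpha>)} \<epsilon> | f p \<alpha> \<epsilon>. f \<in> schwartz \<and> p > 0 \<and> \<epsilon> > 0}"
  then obtain h J \<epsilon> where "f \<in> schwartz_ball h J \<epsilon>" by blast
  then show "f \<in> schwartz" by (simp add: schwartz_ball_def)
qed

lemma openin_schwartz_ball:
  assumes "finite J" "f \<in> schwartz" "\<forall>(p, \<alpha>)\<in>J. p > 0" "\<epsilon> > 0"
  shows "openin schwartz_topology (schwartz_ball f J \<epsilon>)"
  using assms(1,3)
proof (induction J rule: finite_induct)
  case empty
  then show ?case
    using openin_topspace[of schwartz_topology] by (simp only: schwartz_ball_def topspace_schwartz) simp
next
  case (insert j J)
  obtain p \<alpha> where j: "j = (p, \<alpha>)" by (rule prod.exhaust)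
  have "schwartz_ball f (insert j J) \<epsilon> = schwartz_ball f {(p, \<alpha>)} \<epsilon> \<inter> schwartz_ball f J \<epsilon>"
    by (auto simp: schwartz_ball_def j)
  moreover have "openin schwartz_topology (schwartz_ball f {(p, \<alpha>)} \<epsilon>)"
    unfolding schwartz_topology_eq
  proof (rule topology_generated_by_Basis)
    have "p > 0" using insert.prems j by simp
    then show "schwartz_ball f {(p, \<alpha>)} \<epsilon> \<in>
        {schwartz_ball f {(p, \<alpha>)} \<epsilon> | f p \<alpha> \<epsilon>. f \<in> schwartz \<and> p > 0 \<and> \<epsilon> > 0}"
      using assms(2,4) by blast
  qed
  ultimately show ?case using insert by (simp add: openin_Int)
qed

text \<open>The generating sets have arbitrary centres. By the triangle inequality, radius
  \<epsilon> minus the distance of the centres is admissible.\<close>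

lemma schwartz_ball_recenter:
  assumes "f \<in> schwartz" "g \<in> schwartz_ball f {(p, \<alpha>)} \<epsilon>" "p > 0"
  obtains \<delta> where "\<delta> > 0" "schwartz_ball g {(p, \<alpha>)} \<delta> \<subseteq> schwartz_ball f {(p, \<alpha>)} \<epsilon>"
proof -
  have g: "g \<in> schwartz" "schwartz_norm p \<alpha> (\<lambda>x. g x - f x) < ereal \<epsilon>"
    using assms(2) by (auto simp: schwartz_ball_def)
  obtain r where r: "schwartz_norm p \<alpha> (\<lambda>x. g x - f x) = ereal r"
    using schwartz_norm_finite[OF schwartz_diff[OF g(1) assms(1)] assms(3)] by blast
  show ?thesis
  proof (rule that[of "\<epsilon> - r"])
    show "\<epsilon> - r > 0" using g(2) r by simp
    show "schwartz_ball g {(p, \<alpha>)} (\<epsilon> - r) \<subseteq> schwartz_ball f {(p, \<alpha>)} \<epsilon>"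
    proof
      fix h assume "h \<in> schwartz_ball g {(p, \<alpha>)} (\<epsilon> - r)"
      then have h: "h \<in> schwartz" "schwartz_norm p \<alpha> (\<lambda>x. h x - g x) < ereal (\<epsilon> - r)"
        by (auto simp: schwartz_ball_def)
      obtain s where s: "schwartz_norm p \<alpha> (\<lambda>x. h x - g x) = ereal s"
        using schwartz_norm_finite[OF schwartz_diff[OF h(1) g(1)] assms(3)] by blast
      have "schwartz_norm p \<alpha> (\<lambda>x. (h x - g x) + (g x - f x)) \<le> ereal (s + r)"
        using schwartz_diff[OF h(1) g(1)] schwartz_diff[OF g(1) assms(1)] r s
        by (intro schwartz_norm_add) (auto simp: schwartz_Cinf)
      also have "\<dots> < ereal \<epsilon>" using h(2) s by simp
      finally show "h \<in> schwartz_ball f {(p, \<alpha>)} \<epsilon>" using h(1) by (simp add: schwartz_ball_def)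
    qed
  qed
qed

text \<open>Induction over the generation of open sets. Finite intersections unite the sets of norms
  and take the smaller radius; generators are handled by recentring.\<close>

lemma openin_schwartz_contains_ball:
  assumes "openin schwartz_topology U" "f \<in> U"
  shows "\<exists>J \<epsilon>. finite J \<and> (\<forall>(p, \<alpha>)\<in>J. p > 0) \<and> \<epsilon> > 0 \<and> schwartz_ball f J \<epsilon> \<subseteq> U"
  using openin_topology_generated_by[OF assms(1)[unfolded schwartz_topology_eq]] assms(2)
proof (induction rule: generate_topology_on.induct)
  case Empty
  then show ?case by simp
next
  case (Int a b)
  obtain J \<epsilon> where J: "finite J" "\<forall>(p, \<alpha>)\<in>J. p > 0" "\<epsilon> > 0" "schwartz_ball f J \<epsilon> \<subseteq> a"
    using Int by blast
  obtain K \<delta> where K: "finite K" "\<forall>(p, \<alpha>)\<in>K. p > 0" "\<delta> > 0" "schwartz_ball f K \<delta> \<subseteq> b"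
    using Int by blast
  have "schwartz_ball f (J \<union> K) (min \<epsilon> \<delta>) \<subseteq> schwartz_ball f J \<epsilon>"
    "schwartz_ball f (J \<union> K) (min \<epsilon> \<delta>) \<subseteq> schwartz_ball f K \<delta>"
    by (simp_all add: schwartz_ball_mono)
  then have "schwartz_ball f (J \<union> K) (min \<epsilon> \<delta>) \<subseteq> a \<inter> b" using J K by blast
  moreover have "finite (J \<union> K)" "\<forall>(p, \<alpha>)\<in>J \<union> K. p > 0" "min \<epsilon> \<delta> > 0" using J K by auto
  ultimately show ?case by blast
next
  case (UN K)
  then obtain k where "k \<in> K" "f \<in> k" by blast
  with UN.IH[OF this] show ?case by (meson Union_upper order_trans)
next
  case (Basis s)
  then obtain h p \<alpha> e where s: "s = schwartz_ball h {(p, \<alpha>)} e" and h: "h \<in> schwartz" "p > 0"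
    by blast
  obtain \<delta> where "\<delta> > 0" "schwartz_ball f {(p, \<alpha>)} \<delta> \<subseteq> s"
    using schwartz_ball_recenter[OF h(1) Basis.prems[unfolded s] h(2)] s by metis
  then show ?case
    using h(2) by (intro exI[of _ "{(p, \<alpha>)}"] exI[of _ \<delta>]) auto
qed

section \<open>Equicontinuity as a uniform estimate of norms\<close>

text \<open>M is any common bound for the norms in K. It replaces their maximum, so that neither an
  empty K nor extended real values need special care.\<close>

definition schwartz_dominated ::
    "(('d::{finite,linorder} rvec \<Rightarrow> complex) \<Rightarrow> ('d rvec \<Rightarrow> complex)) set \<Rightarrow>
     (real \<times> 'd mindex) set \<Rightarrow> real \<Rightarrow> (real \<times> 'd mindex) set \<Rightarrow> bool" where
  "schwartz_dominated H K C J \<longleftrightarrow>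
     (\<forall>T\<in>H. \<forall>f\<in>schwartz. \<forall>M>0. (\<forall>(q, \<nu>)\<in>K. schwartz_norm q \<nu> f \<le> ereal M) \<longrightarrow>
        (\<forall>(p, \<alpha>)\<in>J. schwartz_norm p \<alpha> (T f) \<le> ereal (C * M)))"

definition schwartz_bounded ::
    "(('d::{finite,linorder} rvec \<Rightarrow> complex) \<Rightarrow> ('d rvec \<Rightarrow> complex)) set \<Rightarrow> bool" where
  "schwartz_bounded H \<longleftrightarrow> (\<forall>p>0. \<forall>\<alpha>. \<exists>K C. finite K \<and> (\<forall>(q, \<nu>)\<in>K. q > 0) \<and> C > 0 \<and>
     schwartz_dominated H K C {(p, \<alpha>)})"

lemma schwartz_dominatedD:
  assumes "schwartz_dominated H K C J" "T \<in> H" "f \<in> schwartz" "M > 0"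
    "\<And>q \<nu>. (q, \<nu>) \<in> K \<Longrightarrow> schwartz_norm q \<nu> f \<le> ereal M" "(p, \<alpha>) \<in> J"
  shows "schwartz_norm p \<alpha> (T f) \<le> ereal (C * M)"
proof -
  have "\<forall>(q, \<nu>)\<in>K. schwartz_norm q \<nu> f \<le> ereal M" using assms(5) by auto
  then have "\<forall>(p, \<alpha>)\<in>J. schwartz_norm p \<alpha> (T f) \<le> ereal (C * M)"
    using assms(1-4) unfolding schwartz_dominated_def by blast
  then show ?thesis using assms(6) by blast
qed

lemma schwartz_dominatedI:
  assumes "\<And>T f M p \<alpha>. T \<in> H \<Longrightarrow> f \<in> schwartz \<Longrightarrow> M > 0 \<Longrightarrow>
    (\<And>q \<nu>. (q, \<nu>) \<in> K \<Longrightarrow> schwartz_norm q \<nu> f \<le> ereal M) \<Longrightarrow> (p, \<alpha>) \<in> J \<Longrightarrow>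
    schwartz_norm p \<alpha> (T f) \<le> ereal (C * M)"
  shows "schwartz_dominated H K C J"
  unfolding schwartz_dominated_def
proof (intro ballI allI impI, clarify)
  fix T f M p \<alpha>
  assume "T \<in> H" "f \<in> schwartz" "(0::real) < M" "\<forall>(q, \<nu>)\<in>K. schwartz_norm q \<nu> f \<le> ereal M" "(p, \<alpha>) \<in> J"
  then show "schwartz_norm p \<alpha> (T f) \<le> ereal (C * M)" by (intro assms) auto
qed

lemma schwartz_dominated_insert:
  assumes "schwartz_dominated H K C J" "schwartz_dominated H K' C' {j}" "C \<ge> 0" "C' \<ge> 0"
  shows "schwartz_dominated H (K \<union> K') (C + C') (insert j J)"
proof (rule schwartz_dominatedI)
  fix T f M p \<alpha>
  assume *: "T \<in> H" "f \<in> schwartz" "(0::real) < M"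
    "\<And>q \<nu>. (q, \<nu>) \<in> K \<union> K' \<Longrightarrow> schwartz_norm q \<nu> f \<le> ereal M" "(p, \<alpha>) \<in> insert j J"
  have "schwartz_norm p \<alpha> (T f) \<le> ereal (C * M) \<or> schwartz_norm p \<alpha> (T f) \<le> ereal (C' * M)"
  proof (cases "(p, \<alpha>) = j")
    case True
    then have "schwartz_norm p \<alpha> (T f) \<le> ereal (C' * M)"
      using *(4) by (intro schwartz_dominatedD[OF assms(2) *(1-3)]) auto
    then show ?thesis ..
  next
    case False
    then have "schwartz_norm p \<alpha> (T f) \<le> ereal (C * M)"
      using *(4,5) by (intro schwartz_dominatedD[OF assms(1) *(1-3)]) auto
    then show ?thesis ..
  qed
  moreover have "ereal (C * M) \<le> ereal ((C + C') * M)" "ereal (C' * M) \<le> ereal ((C + C') * M)"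
    using assms(3,4) *(3) by auto
  ultimately show "schwartz_norm p \<alpha> (T f) \<le> ereal ((C + C') * M)"
    by (elim disjE) (erule (1) order_trans)+
qed

lemma schwartz_bounded_finite:
  assumes "schwartz_bounded H" "finite J" "\<forall>(p, \<alpha>)\<in>J. p > 0"
  shows "\<exists>K C. finite K \<and> (\<forall>(q, \<nu>)\<in>K. q > 0) \<and> C > 0 \<and> schwartz_dominated H K C J"
  using assms(2,3)
proof (induction J rule: finite_induct)
  case empty
  have "schwartz_dominated H {} 1 {}" by (rule schwartz_dominatedI) simp
  then show ?case by (intro exI[of _ "{}"] exI[of _ 1]) simp
next
  case (insert j J)
  obtain p \<alpha> where j: "j = (p, \<alpha>)" by (rule prod.exhaust)
  have p: "p > 0" using insert.prems j by simp
  obtain K C where K: "finite K" "\<forall>(q, \<nu>)\<in>K. q > 0" "C > 0" "schwartz_dominated H K C J"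
    using insert.IH insert.prems by auto
  obtain K' C' where K': "finite K'" "\<forall>(q, \<nu>)\<in>K'. q > 0" "C' > 0" "schwartz_dominated H K' C' {j}"
    using assms(1)[unfolded schwartz_bounded_def, rule_format, OF p, of \<alpha>] unfolding j by (elim exE conjE)
  have "schwartz_dominated H (K \<union> K') (C + C') (insert j J)"
    using K K' by (intro schwartz_dominated_insert) auto
  moreover have "finite (K \<union> K')" "\<forall>(q, \<nu>)\<in>K \<union> K'. q > 0" "C + C' > 0" using K K' by auto
  ultimately show ?case by blast
qed

context
  fixes H :: "(('d::{finite,linorder} rvec \<Rightarrow> complex) \<Rightarrow> ('d rvec \<Rightarrow> complex)) set"
  assumes bounded: "schwartz_bounded H"
    and maps: "\<And>T f. T \<in> H \<Longrightarrow> f \<in> schwartz \<Longrightarrow> T f \<in> schwartz"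
    and diff: "\<And>T f g. T \<in> H \<Longrightarrow> f \<in> schwartz \<Longrightarrow> g \<in> schwartz \<Longrightarrow>
      T (\<lambda>x. f x - g x) = (\<lambda>x. T f x - T g x)"
begin

text \<open>By additivity only g - f matters. V is chosen before T, so the same neighbourhood yields
  continuity of each operator and equicontinuity of the family.\<close>

lemma schwartz_bounded_ball:
  assumes J: "finite J" "\<forall>(p, \<alpha>)\<in>J. p > 0" "\<epsilon> > 0" and f: "f \<in> schwartz"
  shows "\<exists>V. openin schwartz_topology V \<and> f \<in> V \<and> (\<forall>T\<in>H. \<forall>g\<in>V. T g \<in> schwartz_ball (T f) J \<epsilon>)"
proof -
  obtain K C where K: "finite K" "\<forall>(q, \<nu>)\<in>K. q > 0" "C > 0" and KT: "schwartz_dominated H K C J"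
    using schwartz_bounded_finite[OF bounded J(1,2)] by blast
  \<comment> \<open>Domination gives a weak inequality while balls are strict; the factor 2 makes
    the difference.\<close>
  define \<delta> where "\<delta> = \<epsilon> / (2 * C)"
  have \<delta>: "\<delta> > 0" "C * \<delta> < \<epsilon>" using K J by (auto simp: \<delta>_def)
  show ?thesis
  proof (intro exI conjI ballI)
    show "openin schwartz_topology (schwartz_ball f K \<delta>)"
      using K \<delta> f by (intro openin_schwartz_ball)
    show "f \<in> schwartz_ball f K \<delta>" using f \<delta> by (simp add: schwartz_ball_center)
    fix T g assume T: "T \<in> H" and g: "g \<in> schwartz_ball f K \<delta>"
    then have gs: "g \<in> schwartz" by (simp add: schwartz_ball_def)
    have "schwartz_norm q \<nu> (\<lambda>x. g x - f x) \<le> ereal \<delta>" if "(q, \<nu>) \<in> K" for q \<nu>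
      using g that by (auto simp: schwartz_ball_def intro: less_imp_le)
    then have "schwartz_norm p \<alpha> (\<lambda>x. T g x - T f x) \<le> ereal (C * \<delta>)" if "(p, \<alpha>) \<in> J" for p \<alpha>
      using schwartz_dominatedD[OF KT T schwartz_diff[OF gs f] \<delta>(1) _ that] unfolding diff[OF T gs f]
      by blast
    moreover have "ereal (C * \<delta>) < ereal \<epsilon>" using \<delta>(2) by simp
    ultimately have "schwartz_norm p \<alpha> (\<lambda>x. T g x - T f x) < ereal \<epsilon>" if "(p, \<alpha>) \<in> J" for p \<alpha>
      using that le_less_trans by blast
    then show "T g \<in> schwartz_ball (T f) J \<epsilon>"
      using maps[OF T gs] by (auto simp: schwartz_ball_def)
  qed
qed

lemma continuous_map_schwartz:
  assumes T: "T \<in> H"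
  shows "continuous_map schwartz_topology schwartz_topology T"
  unfolding continuous_map_def
proof (intro conjI allI impI)
  show "T \<in> topspace schwartz_topology \<rightarrow> topspace schwartz_topology"
    using maps[OF T] by simp
  fix U :: "('d rvec \<Rightarrow> complex) set" assume U: "openin schwartz_topology U"
  show "openin schwartz_topology {f \<in> topspace schwartz_topology. T f \<in> U}"
  proof (subst openin_subopen, intro ballI)
    fix f assume "f \<in> {f \<in> topspace schwartz_topology. T f \<in> U}"
    then have f: "f \<in> schwartz" "T f \<in> U" by auto
    obtain J \<epsilon> where J: "finite J" "\<forall>(p, \<alpha>)\<in>J. p > 0" "\<epsilon> > 0" "schwartz_ball (T f) J \<epsilon> \<subseteq> U"
      using openin_schwartz_contains_ball[OF U f(2)] by blast
    obtain V where V: "openin schwartz_topology V" "f \<in> V"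
        "\<forall>T\<in>H. \<forall>g\<in>V. T g \<in> schwartz_ball (T f) J \<epsilon>"
      using schwartz_bounded_ball[OF J(1-3) f(1)] by blast
    have "V \<subseteq> schwartz" using openin_subset[OF V(1)] by simp
    then have "V \<subseteq> {f \<in> topspace schwartz_topology. T f \<in> U}"
      using V(3) T J(4) by auto
    then show "\<exists>V. openin schwartz_topology V \<and> f \<in> V \<and> V \<subseteq> {f \<in> topspace schwartz_topology. T f \<in> U}"
      using V(1,2) by blast
  qed
qed

lemma equicontinuous_schwartz: "equicontinuous schwartz_topology H"
  unfolding equicontinuous_def
proof (intro ballI allI impI)
  fix f :: "'d rvec \<Rightarrow> complex" and U :: "('d rvec \<Rightarrow> complex) set"
  assume "f \<in> topspace schwartz_topology" and U: "openin schwartz_topology U \<and> (\<lambda>_. 0) \<in> U"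
  then have f: "f \<in> schwartz" by simp
  obtain J \<epsilon> where J: "finite J" "\<forall>(p, \<alpha>)\<in>J. p > 0" "\<epsilon> > 0" "schwartz_ball (\<lambda>_. 0) J \<epsilon> \<subseteq> U"
    using openin_schwartz_contains_ball[OF U[THEN conjunct1] U[THEN conjunct2]] by blast
  obtain V where V: "openin schwartz_topology V" "f \<in> V"
      "\<forall>T\<in>H. \<forall>g\<in>V. T g \<in> schwartz_ball (T f) J \<epsilon>"
    using schwartz_bounded_ball[OF J(1-3) f] by blast
  have "(\<lambda>x. T g x - T f x) \<in> U" if T: "T \<in> H" and g: "g \<in> V" for T g
  proof -
    have "T g \<in> schwartz_ball (T f) J \<epsilon>" using V(3) T g by blast
    then have "(\<lambda>x. T g x - T f x) \<in> schwartz_ball (\<lambda>_. 0) J \<epsilon>"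
      using schwartz_diff[of "T g" "T f"] maps[OF T f] by (simp add: schwartz_ball_def)
    then show ?thesis using J(4) by blast
  qed
  then show "\<exists>V. openin schwartz_topology V \<and> f \<in> V \<and> (\<forall>T\<in>H. \<forall>g\<in>V. (\<lambda>x. T g x - T f x) \<in> U)"
    using V by blast
qed

end

text \<open>Equicontinuity at 0, tested on the unit ball of one norm, gives finitely many norms and
  a radius; homogeneity then rescales an arbitrary f into that neighbourhood.\<close>

lemma equicontinuous_imp_schwartz_bounded:
  fixes H :: "(('d::{finite,linorder} rvec \<Rightarrow> complex) \<Rightarrow> ('d rvec \<Rightarrow> complex)) set"
  assumes "equicontinuous schwartz_topology H"
    and hom: "\<And>T f c. T \<in> H \<Longrightarrow> f \<in> schwartz \<Longrightarrow> T (\<lambda>x. c * f x) = (\<lambda>x. c * T f x)"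
    and smooth: "\<And>T f. T \<in> H \<Longrightarrow> f \<in> schwartz \<Longrightarrow> Cinf (T f)"
  shows "schwartz_bounded H"
  unfolding schwartz_bounded_def
proof (intro allI impI)
  fix p :: real and \<alpha> :: "'d mindex" assume p: "p > 0"
  let ?U = "schwartz_ball (\<lambda>_. 0) {(p, \<alpha>)} 1"
  have "openin schwartz_topology ?U" "(\<lambda>_. 0) \<in> ?U"
    using p by (auto intro!: openin_schwartz_ball schwartz_ball_center schwartz_zero)
  then obtain V where V: "openin schwartz_topology V" "(\<lambda>_. 0) \<in> V"
    "\<forall>T\<in>H. \<forall>g\<in>V. (\<lambda>x. T g x - T (\<lambda>_. 0) x) \<in> ?U"
    using assms(1)[unfolded equicontinuous_def topspace_schwartz, rule_format, OF schwartz_zero, of ?U]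
    by (elim meta_impE exE conjE) (erule (1) conjI, blast)
  obtain K \<delta> where K: "finite K" "\<forall>(p, \<alpha>)\<in>K. p > 0" "\<delta> > 0" "schwartz_ball (\<lambda>_. 0) K \<delta> \<subseteq> V"
    using openin_schwartz_contains_ball[OF V(1,2)] by blast
  have "schwartz_dominated H K (2 / \<delta>) {(p, \<alpha>)}"
  proof (rule schwartz_dominatedI)
    fix T f p' \<alpha>' and M :: real
    assume T: "T \<in> H" and f: "f \<in> schwartz" and M: "M > 0"
      and KM: "\<And>q \<nu>. (q, \<nu>) \<in> K \<Longrightarrow> schwartz_norm q \<nu> f \<le> ereal M" and "(p', \<alpha>') \<in> {(p, \<alpha>)}"
    then have eq: "p' = p" "\<alpha>' = \<alpha>" by auto
    \<comment> \<open>The norms of c f in K are at most \<delta>/2, hence strictly below \<delta>.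
      Undoing the scaling multiplies by 2M/\<delta>, which explains the constant 2/\<delta>.\<close>
    define c where "c = complex_of_real (\<delta> / (2 * M))"
    have cM: "ereal (cmod c * M) < ereal \<delta>" and c: "c \<noteq> 0"
      using M K(3) by (auto simp: c_def norm_divide norm_mult)
    let ?g = "\<lambda>x. c * f x"
    have "schwartz_norm q \<nu> ?g < ereal \<delta>" if "(q, \<nu>) \<in> K" for q \<nu>
      using schwartz_norm_mult_const[OF schwartz_Cinf[OF f] KM[OF that], of c] cM
      by (rule le_less_trans)
    then have "?g \<in> V"
      using K(4) schwartz_mult_const[OF f, of c] by (auto simp: schwartz_ball_def)
    then have "(\<lambda>x. T ?g x - T (\<lambda>_. 0) x) \<in> ?U" using V(3) T by blast
    moreover have "T (\<lambda>_. 0) = (\<lambda>_. 0)" using hom[OF T schwartz_zero, of 0] by simp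
    ultimately have "schwartz_norm p \<alpha> (\<lambda>x. c * T f x) \<le> ereal 1"
      using hom[OF T f, of c] by (auto simp: schwartz_ball_def intro: less_imp_le)
    moreover have "Cinf (\<lambda>x. c * T f x)" using smooth[OF T f] by (rule Cinf_mult_const)
    ultimately have "schwartz_norm p \<alpha> (\<lambda>x. (1 / c) * (c * T f x)) \<le> ereal (cmod (1 / c) * 1)"
      by (intro schwartz_norm_mult_const)
    moreover have "cmod (1 / c) * 1 = 2 / \<delta> * M"
      using M K(3) by (simp add: c_def norm_divide norm_mult)
    ultimately show "schwartz_norm p' \<alpha>' (T f) \<le> ereal (2 / \<delta> * M)" using c by (simp add: eq)
  qed
  then show "\<exists>K C. finite K \<and> (\<forall>(q, \<nu>)\<in>K. q > 0) \<and> C > 0 \<and> schwartz_dominated H K C {(p, \<alpha>)}"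
    using K(1-3) by (metis divide_pos_pos zero_less_numeral)
qed

section \<open>Schwartz functions with prescribed jets\<close>

text \<open>The action of d/dt on p(t) exp(-t^2), expressed on the polynomial factor.\<close>

definition gauss_deriv :: "real poly \<Rightarrow> real poly" where
  "gauss_deriv p = pderiv p - [:0, 2:] * p"

lemma DERIV_poly_gauss:
  "((\<lambda>t. poly p t * exp (- t\<^sup>2)) has_real_derivative poly (gauss_deriv p) t * exp (- t\<^sup>2)) (at t)"
  unfolding gauss_deriv_def
  by (auto intro!: derivative_eq_intros simp: algebra_simps)

lemma gauss_deriv_pow_add: "(gauss_deriv ^^ m) (p + q) = (gauss_deriv ^^ m) p + (gauss_deriv ^^ m) q"
  by (induction m) (simp_all add: gauss_deriv_def pderiv_add smult_add_right algebra_simps)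

lemma gauss_deriv_pow_smult: "(gauss_deriv ^^ m) (smult c p) = smult c ((gauss_deriv ^^ m) p)"
  by (induction m) (simp_all add: gauss_deriv_def pderiv_smult smult_diff_right mult.commute)

lemma gauss_deriv_pow_0: "(gauss_deriv ^^ m) 0 = 0"
  by (induction m) (simp_all add: gauss_deriv_def)

text \<open>Each application lowers the order of vanishing at 0 by exactly one, as multiplication by
  t only raises it. So X^k exp(-t^2) has vanishing derivatives below order k at 0 and a nonzero one
  at order k.\<close>

lemma gauss_deriv_pow_X:
  "m \<le> k \<Longrightarrow> \<exists>c r. c \<noteq> 0 \<and> (gauss_deriv ^^ m) ([:0, 1:] ^ k) = [:0, 1:] ^ (k - m) * pCons c r"
proof (induction m)
  case 0
  show ?case by (rule exI[of _ 1], rule exI[of _ 0]) simp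
next
  case (Suc m)
  then obtain c r where c: "c \<noteq> 0" and
    IH: "(gauss_deriv ^^ m) ([:0, 1:] ^ k) = [:0, 1:] ^ (k - m) * pCons c r" by auto
  define i where "i = k - Suc m"
  have i: "k - m = Suc i" using Suc.prems by (simp add: i_def)
  let ?X = "[:0, 1:] :: real poly" and ?q = "pCons c r"
  have X: "pderiv ?X = 1" by (simp add: pderiv_pCons)
  have "(gauss_deriv ^^ Suc m) (?X ^ k) = gauss_deriv (?X ^ Suc i * ?q)"
    using IH i by simp
  also have "\<dots> = ?X ^ i * (smult (real (Suc i)) ?q + ?X * (pderiv ?q - [:0, 2:] * ?q))"
  proof -
    have "Y ^ Suc i * q' + q * (smult b (Y ^ i) * 1) - z * (Y ^ Suc i * q) =
        Y ^ i * (smult b q + Y * (q' - z * q))" for Y q q' z :: "real poly" and b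
      by (simp add: algebra_simps)
    then show ?thesis
      unfolding gauss_deriv_def pderiv_mult pderiv_power_Suc X by blast
  qed
  also have "smult (real (Suc i)) ?q + ?X * (pderiv ?q - [:0, 2:] * ?q) =
      pCons (real (Suc i) * c) (smult (real (Suc i)) r + (pderiv ?q - [:0, 2:] * ?q))"
    by simp
  finally have "(gauss_deriv ^^ Suc m) (?X ^ k) = ?X ^ i *
      pCons (real (Suc i) * c) (smult (real (Suc i)) r + (pderiv ?q - [:0, 2:] * ?q))" .
  moreover have "real (Suc i) * c \<noteq> 0" using c by simp
  ultimately show ?case unfolding i_def by blast
qed

text \<open>A triangular system solved from low to high order: a multiple of X^k corrects the k-th
  value and leaves the lower ones untouched. The induction counts the orders still to be
  treated.\<close>

lemma gauss_jet: "\<exists>p. \<forall>m\<le>N. poly ((gauss_deriv ^^ m) p) 0 = a m"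
proof -
  have "\<exists>p. \<forall>m\<le>N. poly ((gauss_deriv ^^ m) p) 0 = a m" if "\<forall>m<k. a m = 0" "j = Suc N - k" for a :: "nat \<Rightarrow> real" and j k
    using that
  proof (induction j arbitrary: k a)
    case 0
    then show ?case by (intro exI[of _ 0]) (simp add: gauss_deriv_pow_0)
  next
    case (Suc j)
    let ?X = "[:0, 1:] :: real poly"
    have vanish: "poly ((gauss_deriv ^^ m) (?X ^ k)) 0 = 0" if "m < k" for m
      using gauss_deriv_pow_X[of m k] that by auto
    obtain c where c: "c \<noteq> 0" "poly ((gauss_deriv ^^ k) (?X ^ k)) 0 = c"
      using gauss_deriv_pow_X[of k k] by auto
    define p1 where "p1 = smult (a k / c) (?X ^ k)"
    define b where "b m = a m - poly ((gauss_deriv ^^ m) p1) 0" for m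
    have "\<forall>m<Suc k. b m = 0"
      using Suc.prems(1) vanish c by (auto simp: b_def p1_def gauss_deriv_pow_smult less_Suc_eq)
    moreover have "j = Suc N - Suc k" using Suc.prems(2) by simp
    ultimately obtain p2 where "\<forall>m\<le>N. poly ((gauss_deriv ^^ m) p2) 0 = b m"
      using Suc.IH by blast
    then have "\<forall>m\<le>N. poly ((gauss_deriv ^^ m) (p1 + p2)) 0 = a m"
      by (simp add: gauss_deriv_pow_add b_def)
    then show ?case by blast
  qed
  from this[of 0 a "Suc N"] show ?thesis by simp
qed

lemma poly_growth: "\<exists>C\<ge>0. \<exists>m. \<forall>t. \<bar>poly q t\<bar> \<le> C * (1 + \<bar>t :: real\<bar>) ^ m"
proof (induction q)
  case 0
  show ?case by (rule exI[of _ 0]) simp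
next
  case (pCons a q)
  then obtain C m where C: "C \<ge> 0" "\<And>t. \<bar>poly q t\<bar> \<le> C * (1 + \<bar>t\<bar>) ^ m" by blast
  have "\<bar>poly (pCons a q) t\<bar> \<le> (\<bar>a\<bar> + C) * (1 + \<bar>t\<bar>) ^ Suc m" for t
  proof -
    have "\<bar>poly (pCons a q) t\<bar> \<le> \<bar>a\<bar> + \<bar>t\<bar> * \<bar>poly q t\<bar>"
      by (simp flip: abs_mult)
    also have "\<dots> \<le> \<bar>a\<bar> * (1 + \<bar>t\<bar>) ^ Suc m + (1 + \<bar>t\<bar>) * (C * (1 + \<bar>t\<bar>) ^ m)"
    proof (rule add_mono)
      show "\<bar>a\<bar> \<le> \<bar>a\<bar> * (1 + \<bar>t\<bar>) ^ Suc m"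
        using one_le_power[of "1 + \<bar>t\<bar>" "Suc m"] mult_left_mono[of 1 "(1 + \<bar>t\<bar>) ^ Suc m" "\<bar>a\<bar>"] by simp
      show "\<bar>t\<bar> * \<bar>poly q t\<bar> \<le> (1 + \<bar>t\<bar>) * (C * (1 + \<bar>t\<bar>) ^ m)"
        using C by (intro mult_mono) auto
    qed
    finally show ?thesis by (simp add: algebra_simps)
  qed
  then show ?case using C(1) by (intro exI[of _ "\<bar>a\<bar> + C"] conjI exI[of _ "Suc m"]) auto
qed

lemma gauss_decay:
  fixes q :: "real poly"
  shows "\<exists>B\<ge>0. \<forall>t. (1 + \<bar>t\<bar>) powr p * \<bar>poly q t * exp (- t\<^sup>2)\<bar> \<le> B"
proof -
  obtain C m where C: "C \<ge> 0" "\<And>t. \<bar>poly q t\<bar> \<le> C * (1 + \<bar>t\<bar>) ^ m" using poly_growth[of q] by blast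
  define k where "k = nat \<lceil>p\<rceil>"
  \<comment> \<open>A single term of the exponential series gives (1 + |t|)^(k+m) \<le> (k+m)! exp(1
    + |t|), and 1 + |t| - t^2 \<le> 2 supplies the factor exp 2.\<close>
  define B where "B = C * fact (k + m) * exp 2"
  have "(1 + \<bar>t\<bar>) powr p * \<bar>poly q t * exp (- t\<^sup>2)\<bar> \<le> B" for t
  proof -
    have "(1 + \<bar>t\<bar>) powr p \<le> (1 + \<bar>t\<bar>) powr real k"
      by (rule powr_mono) (simp_all add: k_def of_nat_ceiling)
    also have "\<dots> = (1 + \<bar>t\<bar>) ^ k" by (simp add: powr_realpow)
    finally have k: "(1 + \<bar>t\<bar>) powr p \<le> (1 + \<bar>t\<bar>) ^ k" .
    have "(1 + \<bar>t\<bar>) ^ (k + m) / fact (k + m) \<le> exp (1 + \<bar>t\<bar>)"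
    proof -
      have "(\<Sum>n\<in>{k + m}. (1 + \<bar>t\<bar>) ^ n / fact n) \<le> (\<Sum>n. (1 + \<bar>t\<bar>) ^ n / fact n)"
        using summable_exp_generic[of "1 + \<bar>t\<bar>"] by (intro sum_le_suminf) (auto simp: field_simps)
      then show ?thesis by (simp add: exp_def field_simps)
    qed
    then have f: "(1 + \<bar>t\<bar>) ^ (k + m) \<le> fact (k + m) * exp (1 + \<bar>t\<bar>)" by (simp add: field_simps)
    have "1 + \<bar>t\<bar> - t\<^sup>2 \<le> 2"
      using zero_le_power2[of "\<bar>t\<bar> - 1/2"] by (simp add: power2_eq_square algebra_simps)
    then have e: "exp (1 + \<bar>t\<bar>) * exp (- t\<^sup>2) \<le> exp 2" by (simp flip: exp_add)
    have "(1 + \<bar>t\<bar>) powr p * \<bar>poly q t * exp (- t\<^sup>2)\<bar> \<le> (1 + \<bar>t\<bar>) ^ k * (C * (1 + \<bar>t\<bar>) ^ m * exp (- t\<^sup>2))"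
      unfolding abs_mult abs_exp_cancel using k C by (intro mult_mono) auto
    also have "\<dots> = C * ((1 + \<bar>t\<bar>) ^ (k + m)) * exp (- t\<^sup>2)" by (simp add: power_add)
    also have "\<dots> \<le> C * (fact (k + m) * exp (1 + \<bar>t\<bar>)) * exp (- t\<^sup>2)"
      using C f by (intro mult_right_mono mult_left_mono) auto
    also have "\<dots> = C * fact (k + m) * (exp (1 + \<bar>t\<bar>) * exp (- t\<^sup>2))" by simp
    also have "\<dots> \<le> B"
      unfolding B_def using C e by (intro mult_left_mono) auto
    finally show ?thesis .
  qed
  moreover have "B \<ge> 0" using C by (simp add: B_def)
  ultimately show ?thesis by blast
qed

text \<open>Splits the Schwartz weight over the coordinates, so that decay of a product of
  one-variable functions follows factor by factor.\<close>

lemma one_plus_norm_le_prod: "1 + norm (z :: real ^ 'd) \<le> (\<Prod>i\<in>UNIV. 1 + \<bar>z $ i\<bar>)"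
proof -
  have "1 + (\<Sum>i\<in>A. \<bar>z $ i\<bar>) \<le> (\<Prod>i\<in>A. 1 + \<bar>z $ i\<bar>)" if "finite A" for A
    using that
  proof (induction A rule: finite_induct)
    case (insert a A)
    have "1 \<le> (\<Prod>i\<in>A. 1 + \<bar>z $ i\<bar>)" by (rule prod_ge_1) simp
    then have "\<bar>z $ a\<bar> * 1 \<le> \<bar>z $ a\<bar> * (\<Prod>i\<in>A. 1 + \<bar>z $ i\<bar>)" by (intro mult_left_mono) auto
    then show ?case using insert by (simp add: algebra_simps)
  qed simp
  from this[of UNIV] norm_le_l1_cart[of z] show ?thesis by simp
qed

text \<open>The derivatives at 0 of a product of one-variable functions are products of Kronecker
  deltas. Prescribing each factor up to order N suffices because \<nu>_i \<le> |\<nu>|.\<close>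

lemma schwartz_jet:
  fixes \<mu> :: "'d::{finite,linorder} mindex"
  obtains f where "f \<in> schwartz"
    "\<And>\<nu>. mi_abs \<nu> \<le> N \<Longrightarrow> mderiv \<nu> f 0 = (if \<nu> = \<mu> then 1 else 0)"
proof -
  have "\<exists>P. \<forall>i. \<forall>m\<le>N. poly ((gauss_deriv ^^ m) (P i)) 0 = (if m = \<mu> $ i then 1 else 0)"
    by (intro choice allI gauss_jet)
  then obtain P where P: "\<And>i m. m \<le> N \<Longrightarrow> poly ((gauss_deriv ^^ m) (P i)) 0 = (if m = \<mu> $ i then 1 else 0)"
    by blast
  define G where "G i n t = poly ((gauss_deriv ^^ n) (P i)) t * exp (- t\<^sup>2)" for i n t
  have G: "(G i n has_real_derivative G i (Suc n) t) (at t)" for i n t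
    using DERIV_poly_gauss[of "(gauss_deriv ^^ n) (P i)"] by (simp add: G_def[abs_def])
  define f where "f = (\<lambda>z. complex_of_real (\<Prod>i\<in>UNIV. G i ((0 :: 'd mindex) $ i) (z $ i)))"
  have C: "Cinf f"
    unfolding f_def using Cinf_linear_compose[OF bounded_linear_of_real Cinf_separable[of G, OF G]] .
  have d: "mderiv \<nu> f = (\<lambda>z. complex_of_real (\<Prod>i\<in>UNIV. G i (\<nu> $ i) (z $ i)))" for \<nu>
    unfolding f_def mderiv_linear_compose[OF bounded_linear_of_real Cinf_separable[of G, OF G]]
      mderiv_separable[of G, OF G] by simp
  have "f \<in> schwartz"
  proof (rule schwartzI[OF C])
    fix p :: real and \<nu> :: "'d mindex" assume p: "p > 0"
    have "\<exists>B. \<forall>i. B i \<ge> 0 \<and> (\<forall>t. (1 + \<bar>t\<bar>) powr p * \<bar>G i (\<nu> $ i) t\<bar> \<le> B i)"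
      unfolding G_def using gauss_decay by (intro choice allI) blast
    then obtain B where B: "\<And>i. B i \<ge> 0" "\<And>i t. (1 + \<bar>t\<bar>) powr p * \<bar>G i (\<nu> $ i) t\<bar> \<le> B i" by blast
    have "(1 + norm z) powr p * cmod (mderiv \<nu> f z) \<le> (\<Prod>i\<in>UNIV. B i)" for z
    proof -
      have "(1 + norm z) powr p \<le> (\<Prod>i\<in>UNIV. 1 + \<bar>z $ i\<bar>) powr p"
        using p by (intro powr_mono2 one_plus_norm_le_prod) auto
      also have "\<dots> = (\<Prod>i\<in>UNIV. (1 + \<bar>z $ i\<bar>) powr p)"
        by (rule prod_powr_distrib)
      finally have "(1 + norm z) powr p * cmod (mderiv \<nu> f z) \<le>
          (\<Prod>i\<in>UNIV. (1 + \<bar>z $ i\<bar>) powr p) * cmod (mderiv \<nu> f z)"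
        by (rule mult_right_mono) simp
      also have "\<dots> = (\<Prod>i\<in>UNIV. (1 + \<bar>z $ i\<bar>) powr p * \<bar>G i (\<nu> $ i) (z $ i)\<bar>)"
        by (simp only: d norm_of_real abs_prod prod.distrib)
      also have "\<dots> \<le> (\<Prod>i\<in>UNIV. B i)"
        using B by (intro prod_mono) auto
      finally show ?thesis .
    qed
    then show "\<exists>C. schwartz_norm p \<nu> f \<le> ereal C" unfolding schwartz_norm_le_iff by blast
  qed
  moreover have "mderiv \<nu> f 0 = (if \<nu> = \<mu> then 1 else 0)" if \<nu>: "mi_abs \<nu> \<le> N" for \<nu>
  proof -
    have "\<nu> $ i \<le> N" for i
    proof -
      have "\<nu> $ i \<le> mi_abs \<nu>" unfolding mi_abs_def by (rule member_le_sum) auto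
      then show ?thesis using \<nu> by simp
    qed
    then have "mderiv \<nu> f 0 = complex_of_real (\<Prod>i\<in>UNIV. if \<nu> $ i = \<mu> $ i then 1 else 0)"
      unfolding d by (simp add: G_def P)
    also have "(\<Prod>i\<in>UNIV. if \<nu> $ i = \<mu> $ i then 1 else 0 :: real) = (if \<nu> = \<mu> then 1 else 0)"
      by (auto simp: vec_eq_iff intro!: prod_zero)
    finally show ?thesis by simp
  qed
  ultimately show ?thesis using that by blast
qed

text \<open>Rests on 1 + |z| \<le> (1 + |y|)(1 + |z - y|). The growth factor is the source of the
  denominator in (ii).\<close>

lemma schwartz_norm_translate:
  assumes f: "f \<in> schwartz" and q: "q > 0" and M: "schwartz_norm q \<nu> f \<le> ereal M"
  shows "schwartz_norm q \<nu> (\<lambda>z. f (z + - y)) \<le> ereal ((1 + norm y) powr q * M)"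
  unfolding schwartz_norm_le_iff mderiv_translate
proof
  fix z
  have "norm z \<le> norm y + norm (z + - y)" using norm_triangle_ineq[of y "z + - y"] by simp
  moreover have "0 \<le> norm y * norm (z + - y)" by simp
  ultimately have "1 + norm z \<le> (1 + norm y) * (1 + norm (z + - y))"
    unfolding distrib_left distrib_right by linarith
  then have "(1 + norm z) powr q \<le> ((1 + norm y) * (1 + norm (z + - y))) powr q"
    using q by (intro powr_mono2) auto
  also have "\<dots> = (1 + norm y) powr q * (1 + norm (z + - y)) powr q"
    by (rule powr_mult)
  finally have "(1 + norm z) powr q * cmod (mderiv \<nu> f (z + - y)) \<le>
      (1 + norm y) powr q * (1 + norm (z + - y)) powr q * cmod (mderiv \<nu> f (z + - y))"
    by (rule mult_right_mono) simp
  also have "\<dots> = (1 + norm y) powr q * ((1 + norm (z + - y)) powr q * cmod (mderiv \<nu> f (z + - y)))"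
    by (rule mult.assoc)
  also have "\<dots> \<le> (1 + norm y) powr q * M"
    using M unfolding schwartz_norm_le_iff by (intro mult_left_mono) auto
  finally show "(1 + norm z) powr q * cmod (mderiv \<nu> f (z + - y)) \<le> (1 + norm y) powr q * M" .
qed

lemma schwartz_translate:
  assumes f: "f \<in> schwartz"
  shows "(\<lambda>z. f (z + - y)) \<in> schwartz"
proof (rule schwartzI)
  have "Cinf (\<lambda>z. z + - y)"
    using Cinf_add[OF Cinf_linear[OF bounded_linear_ident] Cinf_const] .
  then show "Cinf (\<lambda>z. f (z + - y))" using Cinf_compose[OF schwartz_Cinf[OF f]] by blast
  fix p :: real and \<nu> :: "'a mindex" assume p: "p > 0"
  obtain M where "schwartz_norm p \<nu> f = ereal M" using schwartz_norm_finite[OF f p] by blast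
  then show "\<exists>C. schwartz_norm p \<nu> (\<lambda>z. f (z + - y)) \<le> ereal C"
    using schwartz_norm_translate[OF f p, of \<nu> M y] by auto
qed

section \<open>Power bounded weighted composition operators\<close>

lemma schwartz_norm_finite_bound:
  assumes "f \<in> schwartz" "finite K" "\<forall>(q, \<nu>)\<in>K. q > 0"
  shows "\<exists>M>0. \<forall>(q, \<nu>)\<in>K. schwartz_norm q \<nu> f \<le> ereal M"
  using assms(2,3)
proof (induction K rule: finite_induct)
  case empty
  show ?case by (rule exI[of _ 1]) simp
next
  case (insert k K)
  obtain q \<nu> where k: "k = (q, \<nu>)" by (rule prod.exhaust)
  have q: "q > 0" using insert.prems k by simp
  obtain M where M: "M > 0" "\<forall>(q, \<nu>)\<in>K. schwartz_norm q \<nu> f \<le> ereal M"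
    using insert.IH insert.prems by auto
  obtain C where C: "schwartz_norm q \<nu> f = ereal C" using schwartz_norm_finite[OF assms(1) q] by blast
  have "schwartz_norm q' \<nu>' f \<le> ereal (max M C)" if "(q', \<nu>') \<in> insert k K" for q' \<nu>'
  proof (cases "(q', \<nu>') = k")
    case True
    then show ?thesis using C k by simp
  next
    case False
    then have "schwartz_norm q' \<nu>' f \<le> ereal M" using that M(2) by auto
    also have "\<dots> \<le> ereal (max M C)" by simp
    finally show ?thesis .
  qed
  then show ?case using M(1) by (intro exI[of _ "max M C"]) auto
qed

lemma wcomp_funpow: "(wcomp \<psi> \<phi> ^^ n) f = wcomp (iter_weight \<psi> \<phi> n) (\<phi> ^^ n) f"
proof (induction n arbitrary: f)
  case 0
  show ?case by (simp add: wcomp_def iter_weight_def)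
next
  case (Suc n)
  \<comment> \<open>Splitting off the operator applied first produces the factor
    \<psi>(\<phi>_n(x)), which is the last factor j = n + 1 of the weight.\<close>
  have "(wcomp \<psi> \<phi> ^^ Suc n) f = (wcomp \<psi> \<phi> ^^ n) (wcomp \<psi> \<phi> f)"
    by (simp only: funpow_Suc_right comp_apply)
  also have "\<dots> = wcomp (iter_weight \<psi> \<phi> (Suc n)) (\<phi> ^^ Suc n) f"
    unfolding Suc.IH by (simp add: wcomp_def iter_weight_def mult.assoc)
  finally show ?case .
qed

lemma Cinf_funpow:
  fixes \<phi> :: "'d::finite rvec \<Rightarrow> 'd rvec"
  assumes "Cinf \<phi>"
  shows "Cinf (\<phi> ^^ n)"
proof (induction n)
  case 0
  have "Cinf (\<lambda>x :: 'd rvec. x)" using Cinf_linear[OF bounded_linear_ident] .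
  then show ?case by (simp add: id_def)
next
  case (Suc n)
  then show ?case using Cinf_compose[OF assms Suc.IH] by (simp add: comp_def)
qed

lemma Cinf_iter_weight:
  assumes "Cinf \<phi>" "Cinf \<psi>"
  shows "Cinf (iter_weight \<psi> \<phi> n)"
  unfolding iter_weight_def[abs_def]
  using Cinf_compose[OF assms(2) Cinf_funpow[OF assms(1)]] by (rule Cinf_prod[OF finite_atLeastAtMost])

text \<open>Nonnegativity excludes the value -\<infinity>, so a supremum below \<infinity> is a real
  number and can serve as C.\<close>

lemma SUP_SUP_ereal_finite_iff:
  fixes h :: "nat \<Rightarrow> 'a \<Rightarrow> real"
  assumes "\<And>n x. h n x \<ge> 0"
  shows "(SUP n\<in>{1..}. SUP x. ereal (h n x)) < \<infinity> \<longleftrightarrow> (\<exists>C. \<forall>n\<ge>1. \<forall>x. h n x \<le> C)"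
proof
  assume fin: "(SUP n\<in>{1..}. SUP x. ereal (h n x)) < \<infinity>" (is "?S < _")
  have up: "ereal (h n x) \<le> ?S" if "n \<ge> 1" for n x
    by (rule SUP_upper2[of n]) (use that in \<open>auto intro: SUP_upper2\<close>)
  have "0 \<le> ereal (h 1 undefined)" using assms by simp
  also have "\<dots> \<le> ?S" by (rule up) simp
  finally have "0 \<le> ?S" .
  then obtain C where "?S = ereal C" using fin by (cases ?S) auto
  then show "\<exists>C. \<forall>n\<ge>1. \<forall>x. h n x \<le> C" using up by auto
next
  assume "\<exists>C. \<forall>n\<ge>1. \<forall>x. h n x \<le> C"
  then obtain C where C: "\<And>n x. n \<ge> 1 \<Longrightarrow> h n x \<le> C" by blast
  have "(SUP n\<in>{1..}. SUP x. ereal (h n x)) \<le> ereal C"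
    using C by (intro SUP_least) auto
  then show "(SUP n\<in>{1..}. SUP x. ereal (h n x)) < \<infinity>"
    by (rule le_less_trans) simp
qed

theorem theorem4p2:
  fixes \<phi> :: "'d::{finite,linorder} rvec \<Rightarrow> 'd rvec"
    and \<psi> :: "'d rvec \<Rightarrow> complex"
  assumes "Cinf \<phi>" and "Cinf \<psi>"
  shows "(acts_on_schwartz (wcomp \<psi> \<phi>) \<and> power_bounded schwartz_topology (wcomp \<psi> \<phi>)) \<longleftrightarrow>
    (\<forall>\<alpha> \<mu>. mi_abs \<mu> \<le> mi_abs \<alpha> \<longrightarrow>
       (\<forall>p>0::real. \<exists>q>0::real.
          (SUP n\<in>{1::nat..}. SUP x.
             ereal ((1 + norm x) powr p / (1 + norm ((\<phi> ^^ n) x)) powr q *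
                    cmod (Ffun \<alpha> \<mu> (\<phi> ^^ n) (iter_weight \<psi> \<phi> n) x))) < \<infinity>))"
proof -
  let ?T = "wcomp \<psi> \<phi>"
  let ?H = "{?T ^^ n | n. n \<ge> 1}"
  define F where "F \<alpha> \<mu> n x = Ffun \<alpha> \<mu> (\<phi> ^^ n) (iter_weight \<psi> \<phi> n) x" for \<alpha> \<mu> n x
  have Cn: "Cinf (\<phi> ^^ n)" "Cinf (iter_weight \<psi> \<phi> n)" for n
    using assms by (simp_all add: Cinf_funpow Cinf_iter_weight)
  have Tn: "(?T ^^ n) f = (\<lambda>x. iter_weight \<psi> \<phi> n x * f ((\<phi> ^^ n) x))" for n f
    unfolding wcomp_funpow wcomp_def ..
  have CT: "Cinf ((?T ^^ n) f)" if "Cinf f" for n f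
    unfolding Tn using Cinf_mult[OF Cn(2) Cinf_compose[OF that Cn(1)]] .
  have fdb: "mderiv \<alpha> ((?T ^^ n) f) x =
      (\<Sum>\<mu> | mi_abs \<mu> \<le> mi_abs \<alpha>. mderiv \<mu> f ((\<phi> ^^ n) x) * F \<alpha> \<mu> n x)" if "Cinf f" for \<alpha> n f x
    unfolding Tn F_def by (rule faa_di_bruno[OF Cn that])
  have bound_iff: "(SUP n\<in>{1::nat..}. SUP x. ereal ((1 + norm x) powr p / (1 + norm ((\<phi> ^^ n) x)) powr q *
        cmod (Ffun \<alpha> \<mu> (\<phi> ^^ n) (iter_weight \<psi> \<phi> n) x))) < \<infinity> \<longleftrightarrow>
      (\<exists>C. \<forall>n\<ge>1. \<forall>x. (1 + norm x) powr p * cmod (F \<alpha> \<mu> n x) \<le> C * (1 + norm ((\<phi> ^^ n) x)) powr q)"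
    for \<alpha> \<mu> p q
  proof -
    have "(1 + norm ((\<phi> ^^ n) x)) powr q > 0" for n x
      using norm_ge_zero[of "(\<phi> ^^ n) x"] by (simp add: add_pos_nonneg less_imp_neq[symmetric])
    then show ?thesis
      by (subst SUP_SUP_ereal_finite_iff) (auto simp: F_def divide_simps)
  qed
  show ?thesis
    unfolding bound_iff
  proof (intro iffI allI impI)
    fix \<alpha> \<mu> :: "'d mindex" and p :: real
    assume pb: "acts_on_schwartz ?T \<and> power_bounded schwartz_topology ?T"
      and \<mu>: "mi_abs \<mu> \<le> mi_abs \<alpha>" and p: "p > 0"
    have "schwartz_bounded ?H"
    proof (rule equicontinuous_imp_schwartz_bounded)
      show "equicontinuous schwartz_topology ?H" using pb by (simp add: power_bounded_def)
    next
      fix T c and f :: "'d rvec \<Rightarrow> complex" assume "T \<in> ?H"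
      then show "T (\<lambda>x. c * f x) = (\<lambda>x. c * T f x)"
        by (auto simp: Tn mult.left_commute)
    next
      fix T and f :: "'d rvec \<Rightarrow> complex" assume "T \<in> ?H" and f: "f \<in> schwartz"
      then show "Cinf (T f)" using CT[OF schwartz_Cinf[OF f]] by auto
    qed
    then obtain K C where K: "finite K" "\<forall>(q, \<nu>)\<in>K. q > 0" "C > 0" and dom: "schwartz_dominated ?H K C {(p, \<alpha>)}"
      using p unfolding schwartz_bounded_def by meson
    obtain f where f: "f \<in> schwartz" and jet: "\<And>\<nu>. mi_abs \<nu> \<le> mi_abs \<alpha> \<Longrightarrow> mderiv \<nu> f 0 = (if \<nu> = \<mu> then 1 else 0)"
      using schwartz_jet[of "mi_abs \<alpha>" \<mu>] by metis
    obtain M where M: "M > 0" "\<forall>(q, \<nu>)\<in>K. schwartz_norm q \<nu> f \<le> ereal M"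
      using schwartz_norm_finite_bound[OF f K(1,2)] by blast
    \<comment> \<open>One exponent for all norms in K: 1 + |y| \<ge> 1 allows exponents to be
      raised. The inserted 1 keeps Q positive and the maximum defined when K is empty.\<close>
    define Q where "Q = Max (insert 1 (fst ` K))"
    have Q: "Q > 0" "\<And>q \<nu>. (q, \<nu>) \<in> K \<Longrightarrow> q \<le> Q"
    proof -
      have "1 \<le> Q" unfolding Q_def using K(1) by (intro Max_ge) auto
      then show "Q > 0" by simp
      show "q \<le> Q" if "(q, \<nu>) \<in> K" for q \<nu>
        unfolding Q_def using K(1) that by (intro Max_ge) force+
    qed
    have "(1 + norm x) powr p * cmod (F \<alpha> \<mu> n x) \<le> C * M * (1 + norm ((\<phi> ^^ n) x)) powr Q"
      if n: "n \<ge> 1" for n x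
    proof -
      let ?y = "(\<phi> ^^ n) x"
      \<comment> \<open>The test function moves with n and x, but f, and with it M, was fixed
        beforehand; the estimate depends on n and x only through |\<phi>_n(x)|.\<close>
      let ?g = "\<lambda>z. f (z + - ?y)"
      have g: "?g \<in> schwartz" by (rule schwartz_translate[OF f])
      have "schwartz_norm q \<nu> ?g \<le> ereal ((1 + norm ?y) powr Q * M)" if "(q, \<nu>) \<in> K" for q \<nu>
      proof -
        have "schwartz_norm q \<nu> ?g \<le> ereal ((1 + norm ?y) powr q * M)"
          using K(2) M(2) that by (intro schwartz_norm_translate f) auto
        also have "(1 + norm ?y) powr q * M \<le> (1 + norm ?y) powr Q * M"
          using Q(2)[OF that] M(1) by (intro mult_right_mono powr_mono) auto
        finally show ?thesis by simp
      qed
      moreover have "(1 + norm ?y) powr Q * M > 0"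
      proof -
        have "1 + norm ?y \<noteq> 0" using norm_ge_zero[of ?y] by linarith
        then show ?thesis using M(1) by simp
      qed
      moreover have "?T ^^ n \<in> ?H" using n by blast
      ultimately have "schwartz_norm p \<alpha> ((?T ^^ n) ?g) \<le> ereal (C * ((1 + norm ?y) powr Q * M))"
        using schwartz_dominatedD[OF dom _ g] by blast
      then have "(1 + norm x) powr p * cmod (mderiv \<alpha> ((?T ^^ n) ?g) x) \<le> C * ((1 + norm ?y) powr Q * M)"
        unfolding schwartz_norm_le_iff by (rule spec)
      \<comment> \<open>At x the formula evaluates the derivatives of \<open>?g\<close> at
        \<open>?y\<close>, that is, those of f at 0, and the jet retains a single term.\<close>
      moreover have "mderiv \<alpha> ((?T ^^ n) ?g) x = F \<alpha> \<mu> n x"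
      proof -
        have "mderiv \<alpha> ((?T ^^ n) ?g) x =
            (\<Sum>\<nu> | mi_abs \<nu> \<le> mi_abs \<alpha>. if \<nu> = \<mu> then F \<alpha> \<nu> n x else 0)"
          unfolding fdb[OF schwartz_Cinf[OF g]] mderiv_translate
          by (rule sum.cong) (auto simp: jet)
        then show ?thesis using \<mu> by (simp add: finite_mi_abs_le)
      qed
      ultimately show ?thesis by (simp only: mult.assoc mult.commute[of M])
    qed
    then show "\<exists>q>0. \<exists>C. \<forall>n\<ge>1. \<forall>x.
        (1 + norm x) powr p * cmod (F \<alpha> \<mu> n x) \<le> C * (1 + norm ((\<phi> ^^ n) x)) powr q"
      using Q(1) by blast
  next
    assume bd: "\<forall>\<alpha> \<mu>. mi_abs \<mu> \<le> mi_abs \<alpha> \<longrightarrow> (\<forall>p>0. \<exists>q>0. \<exists>C. \<forall>n\<ge>1. \<forall>x.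
        (1 + norm x) powr p * cmod (F \<alpha> \<mu> n x) \<le> C * (1 + norm ((\<phi> ^^ n) x)) powr q)"
    have sb: "schwartz_bounded ?H"
      unfolding schwartz_bounded_def
    proof (intro allI impI)
      fix p :: real and \<alpha> :: "'d mindex" assume p: "p > 0"
      let ?I = "{\<mu> :: 'd mindex. mi_abs \<mu> \<le> mi_abs \<alpha>}"
      have "\<exists>q C. \<mu> \<in> ?I \<longrightarrow> q > 0 \<and> (\<forall>n\<ge>1. \<forall>x.
          (1 + norm x) powr p * cmod (F \<alpha> \<mu> n x) \<le> C * (1 + norm ((\<phi> ^^ n) x)) powr q)" for \<mu>
        using bd[rule_format, of \<mu> \<alpha> p] p by blast
      then obtain q C where q: "\<And>\<mu>. \<mu> \<in> ?I \<Longrightarrow> q \<mu> > 0" and C: "\<And>\<mu> n x. \<mu> \<in> ?I \<Longrightarrow> n \<ge> 1 \<Longrightarrow>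
          (1 + norm x) powr p * cmod (F \<alpha> \<mu> n x) \<le> C \<mu> * (1 + norm ((\<phi> ^^ n) x)) powr q \<mu>"
        by metis
      let ?K = "(\<lambda>\<mu>. (q \<mu>, \<mu>)) ` ?I"
      \<comment> \<open>The 1 makes B positive, and the absolute values are there because no sign is
        recorded for \<open>C \<mu>\<close>.\<close>
      define B where "B = 1 + (\<Sum>\<mu>\<in>?I. \<bar>C \<mu>\<bar>)"
      have "schwartz_dominated ?H ?K B {(p, \<alpha>)}"
      proof (rule schwartz_dominatedI)
        fix T f M p' \<alpha>'
        assume "T \<in> ?H" and f: "f \<in> schwartz" and M: "(0::real) < M"
          and K: "\<And>q' \<nu>. (q', \<nu>) \<in> ?K \<Longrightarrow> schwartz_norm q' \<nu> f \<le> ereal M" and "(p', \<alpha>') \<in> {(p, \<alpha>)}"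
        then obtain n where n: "n \<ge> 1" "T = ?T ^^ n" and eq: "p' = p" "\<alpha>' = \<alpha>" by auto
        have "(1 + norm x) powr p * cmod (mderiv \<alpha> (T f) x) \<le> B * M" for x
        proof -
          let ?y = "(\<phi> ^^ n) x"
          have "(1 + norm x) powr p * cmod (mderiv \<alpha> (T f) x) \<le>
              (1 + norm x) powr p * (\<Sum>\<mu>\<in>?I. cmod (mderiv \<mu> f ?y) * cmod (F \<alpha> \<mu> n x))"
            unfolding n(2) fdb[OF schwartz_Cinf[OF f]] norm_mult[symmetric]
            by (intro mult_left_mono norm_sum) simp
          also have "\<dots> = (\<Sum>\<mu>\<in>?I. cmod (mderiv \<mu> f ?y) * ((1 + norm x) powr p * cmod (F \<alpha> \<mu> n x)))"
            by (simp add: sum_distrib_left mult_ac)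
          also have "\<dots> \<le> (\<Sum>\<mu>\<in>?I. \<bar>C \<mu>\<bar> * M)"
          proof (rule sum_mono)
            fix \<mu> assume \<mu>: "\<mu> \<in> ?I"
            \<comment> \<open>The factor (1 + |\<phi>_n(x)|)^q from (ii) is exactly the weight that
              turns the derivative of f at \<phi>_n(x) into a quantity bounded by a Schwartz
              norm.\<close>
            have "cmod (mderiv \<mu> f ?y) * ((1 + norm x) powr p * cmod (F \<alpha> \<mu> n x)) \<le>
                cmod (mderiv \<mu> f ?y) * (\<bar>C \<mu>\<bar> * (1 + norm ?y) powr q \<mu>)"
            proof (rule mult_left_mono)
              have "C \<mu> * (1 + norm ?y) powr q \<mu> \<le> \<bar>C \<mu>\<bar> * (1 + norm ?y) powr q \<mu>"
                by (intro mult_right_mono) auto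
              then show "(1 + norm x) powr p * cmod (F \<alpha> \<mu> n x) \<le> \<bar>C \<mu>\<bar> * (1 + norm ?y) powr q \<mu>"
                using C[OF \<mu> n(1), of x] by linarith
            qed simp
            also have "\<dots> = \<bar>C \<mu>\<bar> * ((1 + norm ?y) powr q \<mu> * cmod (mderiv \<mu> f ?y))" by simp
            also have "\<dots> \<le> \<bar>C \<mu>\<bar> * M"
              using K[of "q \<mu>" \<mu>] \<mu> unfolding schwartz_norm_le_iff by (intro mult_left_mono) auto
            finally show "cmod (mderiv \<mu> f ?y) * ((1 + norm x) powr p * cmod (F \<alpha> \<mu> n x)) \<le> \<bar>C \<mu>\<bar> * M" .
          qed
          also have "\<dots> \<le> B * M" using M by (simp add: B_def sum_distrib_right distrib_right)
          finally show ?thesis .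
        qed
        then show "schwartz_norm p' \<alpha>' (T f) \<le> ereal (B * M)" by (simp add: eq schwartz_norm_le_iff)
      qed
      moreover have "finite ?K" "\<forall>(q, \<nu>)\<in>?K. q > 0" using q by (auto simp: finite_mi_abs_le)
      moreover have "B > 0" unfolding B_def by (intro add_pos_nonneg sum_nonneg) auto
      ultimately show "\<exists>K C. finite K \<and> (\<forall>(q, \<nu>)\<in>K. q > 0) \<and> C > 0 \<and> schwartz_dominated ?H K C {(p, \<alpha>)}"
        by blast
    qed
    \<comment> \<open>The estimate holds before T f is known to be a Schwartz function; with finite
      norms of f on the right it yields the membership, and for n = 1 the action of the
      operator.\<close>
    have maps: "T f \<in> schwartz" if T: "T \<in> ?H" and f: "f \<in> schwartz" for T f
    proof (rule schwartzI)
      show "Cinf (T f)" using T CT[OF schwartz_Cinf[OF f]] by auto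
      fix p :: real and \<alpha> :: "'d mindex" assume p: "p > 0"
      obtain K C where K: "finite K" "\<forall>(q, \<nu>)\<in>K. q > 0" "C > 0" and dom: "schwartz_dominated ?H K C {(p, \<alpha>)}"
        using sb p unfolding schwartz_bounded_def by meson
      obtain M where M: "M > 0" "\<forall>(q, \<nu>)\<in>K. schwartz_norm q \<nu> f \<le> ereal M"
        using schwartz_norm_finite_bound[OF f K(1,2)] by blast
      have "schwartz_norm p \<alpha> (T f) \<le> ereal (C * M)"
        by (rule schwartz_dominatedD[OF dom T f M(1)]) (use M(2) in auto)
      then show "\<exists>C. schwartz_norm p \<alpha> (T f) \<le> ereal C" by blast
    qed
    have diff: "T (\<lambda>x. f x - g x) = (\<lambda>x. T f x - T g x)" if "T \<in> ?H" for T f g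
      using that by (auto simp: Tn right_diff_distrib)
    have T1: "?T \<in> ?H" by (rule CollectI, rule exI[of _ 1]) simp
    have "continuous_map schwartz_topology schwartz_topology ?T"
      by (rule continuous_map_schwartz[OF sb], erule (1) maps, erule diff, rule T1)
    moreover have "equicontinuous schwartz_topology ?H"
      by (rule equicontinuous_schwartz[OF sb], erule (1) maps, erule diff)
    moreover have "?T (\<lambda>x. f x + g x) = (\<lambda>x. ?T f x + ?T g x)" "?T (\<lambda>x. c * f x) = (\<lambda>x. c * ?T f x)" for f g c
      by (simp_all add: wcomp_def distrib_left mult.left_commute)
    ultimately have "power_bounded schwartz_topology ?T"
      unfolding power_bounded_def continuous_linear_op_def by (intro conjI ballI allI)
    moreover have "acts_on_schwartz ?T"
      unfolding acts_on_schwartz_def using maps[OF T1] by blast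
    ultimately show "acts_on_schwartz ?T \<and> power_bounded schwartz_topology ?T" by blast
  qed
qed

end
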